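(* The sets $$\{\chi_{[\eta]}\mid\eta\text{ is a nonnesting }\mathbb{F}_q\text{-set partition of }[n]\}\quad\text{and}\quad\{K_{[\nu]}\mid\nu\text{ is a nonnesting }\mathbb{F}_q\text{-set partition of }[n]\}$$ are, respectively, the supercharacters and superclasses for a supercharacter theory of $UT_n(\mathbb{F}_q)$.
   Context: Supercharacter theory: for a finite group $G$, a partition $\mathcal{K}$ of $G$ into unions of conjugacy classes and a set $\mathcal{X}$ of characters of $G$, the pair $(\mathcal{K},\mathcal{X})$ is a supercharacter theory of $G$ if (SCT1) $|\mathcal{X}|=|\mathcal{K}|$; (SCT2) every $\chi\in\mathcal{X}$ is constant on each member of $\mathcal{K}$; (SCT3) each irreducible character of $G$ is a constituent of exactly one character in $\mathcal{X}$. The members of $\mathcal{X}$ are called supercharacters, those of $\mathcal{K}$ superclasses. $\mathbb{F}_q$ is the field with $q$ elements, $\theta:\mathbb{F}_q^+\to\mathbb{C}^\times$ is a fixed nontrivial homomorphism, $[n]=\{1,\dots,n\}$. $\mathfrak{ut}_n(\mathbb{F}_q)$ is the algebra of strictly upper triangular $n\times n$ matrices over $\mathbb{F}_q$ and $G=UT_n(\mathbb{F}_q)=1+\mathfrak{ut}_n(\mathbb{F}_q)$ the group of unipotent upper triangular matrices; $f:G\to\mathfrak{ut}_n(\mathbb{F}_q)$ is $f(1+x)=x$; $e_{ij}$ denotes the elementary matrix. $G$ acts on $\mathfrak{ut}_n(\mathbb{F}_q)$ by left and right multiplication and on the dual $\mathfrak{ut}_n(\mathbb{F}_q)^*$ by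 $(g\lambda)(x)=\lambda(g^{-1}x)$ and $(\lambda g)(x)=\lambda(xg^{-1})$. An $\mathbb{F}_q$-set partition of $[n]$ is a set $\eta$ of labeled arcs $i\overset{a}{\frown}j$ ($1\le i<j\le n$, $a\in\mathbb{F}_q^\times$, at most one label for each pair $(i,j)$) such that if $i\overset{a}{\frown}j\in\eta$ and $i<k<j$ then $\eta$ contains no arc from $i$ to $k$ and no arc from $k$ to $j$ (with any label). It is nonnesting if there are no $i<j<k<l$ such that $\eta$ has an arc from $i$ to $l$ and an arc from $j$ to $k$. For an $\mathbb{F}_q$-set partition $\eta$ put $\mathrm{sml}(\eta)=\{i\overset{a}{\frown}j\in\eta\mid\text{there are no }k\overset{b}{\frown}l\in\eta\text{ with }i<k<l<j\}$ and $\mathrm{big}(\eta)=\{i\overset{a}{\frown}j\in\eta\mid\text{there are no }k\overset{b}{\frown}l\in\eta\text{ with }k<i<j<l\}$; both are nonnesting. For an $\mathbb{F}_q$-set partition $\nu$ let $x_\nu=\sum_{i\overset{a}{\frown}j\in\nu}a e_{ij}$ and $\lambda_\nu(x)=\sum_{i\overset{a}{\frown}j\in\nu}a x_{ij}$ for $x\in\mathfrak{ut}_n(\mathbb{F}_q)$, and let $K_\nu=\{h\in G\mid f(h)\in G x_\nu G\}$ and $\chi_\nu=\sum_{\mu\in G\lambda_\nu G}\theta\circ\mu\circ f$. For a nonnesting $\mathbb{F}_q$-set partition $\eta$ define $$K_{[\eta]}=\bigcup_{\mathrm{sml}(\nu)=\eta}K_\nu,\qquad\chi_{[\eta]}=\sum_{\mathrm{big}(\nu)=\eta}\chi_\nu,$$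 where $\nu$ runs over $\mathbb{F}_q$-set partitions of $[n]$. *)

theory Defs
  imports "Jordan_Normal_Form.VS_Connect" "HOL-Library.Disjoint_Sets" "HOL-Library.FuncSet"
begin

section \<open>Characters of finite groups\<close>

definition representation :: "('g, 'b) monoid_scheme \<Rightarrow> nat \<Rightarrow> ('g \<Rightarrow> complex mat) \<Rightarrow> bool" where
  "representation G d \<rho> \<longleftrightarrow> d > 0 \<and> \<rho> \<in> hom G (units_of (ring_mat TYPE(complex) d ()))"

definition irreducible_representation ::
  "('g, 'b) monoid_scheme \<Rightarrow> nat \<Rightarrow> ('g \<Rightarrow> complex mat) \<Rightarrow> bool" where
  "irreducible_representation G d \<rho> \<longleftrightarrow> representation G d \<rho> \<and>
     (\<forall>W. subspace class_ring W (module_vec TYPE(complex) d) \<longrightarrow>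
        (\<forall>g\<in>carrier G. \<forall>w\<in>W. \<rho> g *\<^sub>v w \<in> W) \<longrightarrow>
        W = {0\<^sub>v d} \<or> W = carrier_vec d)"

text \<open>Characters are extensional functions, so that equal characters are equal as HOL functions
  and the cardinality of a set of characters is meaningful.\<close>

definition rep_character ::
  "('g, 'b) monoid_scheme \<Rightarrow> nat \<Rightarrow> ('g \<Rightarrow> complex mat) \<Rightarrow> 'g \<Rightarrow> complex" where
  "rep_character G d \<rho> = (\<lambda>g\<in>carrier G. \<Sum>i<d. \<rho> g $$ (i, i))"

definition characters :: "('g, 'b) monoid_scheme \<Rightarrow> ('g \<Rightarrow> complex) set" where
  "characters G = {rep_character G d \<rho> | d \<rho>. representation G d \<rho>}"

definition irreducible_characters :: "('g, 'b) monoid_scheme \<Rightarrow> ('g \<Rightarrow> complex) set" where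
  "irreducible_characters G = {rep_character G d \<rho> | d \<rho>. irreducible_representation G d \<rho>}"

text \<open>Representations have positive degree, so the zero function is not a character and
  \<open>\<chi> = \<psi>\<close> has to be listed separately.\<close>

definition constituent ::
  "('g, 'b) monoid_scheme \<Rightarrow> ('g \<Rightarrow> complex) \<Rightarrow> ('g \<Rightarrow> complex) \<Rightarrow> bool" where
  "constituent G \<psi> \<chi> \<longleftrightarrow> \<psi> \<in> irreducible_characters G \<and> 
     (\<chi> = \<psi> \<or> (\<exists>\<phi>\<in>characters G. \<chi> = (\<lambda>g\<in>carrier G. \<psi> g + \<phi> g)))"

section \<open>Supercharacter theories\<close>

definition conjugacy_class :: "('g, 'b) monoid_scheme \<Rightarrow> 'g \<Rightarrow> 'g set" where
  "conjugacy_class G x = {g \<otimes>\<^bsub>G\<^esub> x \<otimes>\<^bsub>G\<^esub> inv\<^bsub>G\<^esub> g | g. g \<in> carrier G}"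

definition supercharacter_theory ::
  "('g, 'b) monoid_scheme \<Rightarrow> 'g set set \<Rightarrow> ('g \<Rightarrow> complex) set \<Rightarrow> bool" where
  "supercharacter_theory G \<K> \<X> \<longleftrightarrow>
     group G \<and> finite (carrier G) \<and>
     partition_on (carrier G) \<K> \<and>
     (\<forall>K\<in>\<K>. \<exists>S\<subseteq>carrier G. K = (\<Union>x\<in>S. conjugacy_class G x)) \<and>
     \<X> \<subseteq> characters G \<and>
     card \<X> = card \<K> \<and>
     (\<forall>\<chi>\<in>\<X>. \<forall>K\<in>\<K>. \<forall>g\<in>K. \<forall>h\<in>K. \<chi> g = \<chi> h) \<and>
     (\<forall>\<psi>\<in>irreducible_characters G. \<exists>!\<chi>. \<chi> \<in> \<X> \<and> constituent G \<psi> \<chi>)"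

section \<open>The unipotent upper triangular group\<close>

text \<open>The finite field is the type \<open>'a\<close>, with \<open>q = CARD('a)\<close>. As usual for \<^typ>\<open>'a mat\<close>, rows and
  columns are numbered from 0, so \<open>[n]\<close> is \<open>{0..<n}\<close> throughout.\<close>

definition ut :: "nat \<Rightarrow> 'a::field mat set" where
  "ut n = {x \<in> carrier_mat n n. \<forall>i<n. \<forall>j\<le>i. x $$ (i, j) = 0}"

definition UT :: "nat \<Rightarrow> 'a::field mat monoid" where
  "UT n = \<lparr>carrier = {1\<^sub>m n + x | x. x \<in> ut n}, mult = (*), one = 1\<^sub>m n\<rparr>"

definition f_map :: "nat \<Rightarrow> 'a::field mat \<Rightarrow> 'a mat" where
  "f_map n h = h - 1\<^sub>m n"

definition two_sided_orbit :: "nat \<Rightarrow> 'a::field mat \<Rightarrow> 'a mat set" where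
  "two_sided_orbit n x = {g * x * h | g h. g \<in> carrier (UT n) \<and> h \<in> carrier (UT n)}"

text \<open>Elements of the dual space are functions restricted to \<^term>\<open>ut n\<close>, so that orbits in the
  dual count each functional once.\<close>

definition left_act :: "nat \<Rightarrow> 'a::field mat \<Rightarrow> ('a mat \<Rightarrow> 'a) \<Rightarrow> 'a mat \<Rightarrow> 'a" where
  "left_act n g \<mu> = (\<lambda>x\<in>ut n. \<mu> (inv\<^bsub>UT n\<^esub> g * x))"

definition right_act :: "nat \<Rightarrow> ('a::field mat \<Rightarrow> 'a) \<Rightarrow> 'a mat \<Rightarrow> 'a mat \<Rightarrow> 'a" where
  "right_act n \<mu> g = (\<lambda>x\<in>ut n. \<mu> (x * inv\<^bsub>UT n\<^esub> g))"

definition dual_orbit :: "nat \<Rightarrow> ('a::field mat \<Rightarrow> 'a) \<Rightarrow> ('a mat \<Rightarrow> 'a) set" where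
  "dual_orbit n \<mu> =
     {right_act n (left_act n g \<mu>) h | g h. g \<in> carrier (UT n) \<and> h \<in> carrier (UT n)}"

section \<open>Labeled set partitions\<close>

text \<open>The triple \<open>(i, j, a)\<close> is the arc from \<open>i\<close> to \<open>j\<close> with label \<open>a\<close>.\<close>

type_synonym 'a arc = "nat \<times> nat \<times> 'a"

definition fq_set_partition :: "nat \<Rightarrow> 'a::field arc set \<Rightarrow> bool" where
  "fq_set_partition n \<eta> \<longleftrightarrow>
     (\<forall>(i, j, a)\<in>\<eta>. i < j \<and> j < n \<and> a \<noteq> 0) \<and>
     (\<forall>i j a b. (i, j, a) \<in> \<eta> \<longrightarrow> (i, j, b) \<in> \<eta> \<longrightarrow> a = b) \<and>
     (\<forall>(i, j, a)\<in>\<eta>. \<forall>k. i < k \<and> k < j \<longrightarrow> (\<forall>b. (i, k, b) \<notin> \<eta> \<and> (k, j, b) \<notin> \<eta>))"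

definition nonnesting :: "'a arc set \<Rightarrow> bool" where
  "nonnesting \<eta> \<longleftrightarrow>
     \<not> (\<exists>i j k l a b. i < j \<and> j < k \<and> k < l \<and> (i, l, a) \<in> \<eta> \<and> (j, k, b) \<in> \<eta>)"

definition sml :: "'a arc set \<Rightarrow> 'a arc set" where
  "sml \<eta> = {(i, j, a) \<in> \<eta>. \<not> (\<exists>(k, l, b)\<in>\<eta>. i < k \<and> k < l \<and> l < j)}"

definition big :: "'a arc set \<Rightarrow> 'a arc set" where
  "big \<eta> = {(i, j, a) \<in> \<eta>. \<not> (\<exists>(k, l, b)\<in>\<eta>. k < i \<and> i < j \<and> j < l)}"

section \<open>Coarsened superclasses and supercharacters\<close>

definition x_elt :: "nat \<Rightarrow> 'a::field arc set \<Rightarrow> 'a mat" where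
  "x_elt n \<nu> = mat n n (\<lambda>(r, c). \<Sum>(i, j, a)\<in>\<nu>. a * (if (r, c) = (i, j) then 1 else 0))"

definition lam :: "nat \<Rightarrow> 'a::field arc set \<Rightarrow> 'a mat \<Rightarrow> 'a" where
  "lam n \<nu> = (\<lambda>x\<in>ut n. \<Sum>(i, j, a)\<in>\<nu>. a * x $$ (i, j))"

definition K_fine :: "nat \<Rightarrow> 'a::field arc set \<Rightarrow> 'a mat set" where
  "K_fine n \<nu> = {h \<in> carrier (UT n). f_map n h \<in> two_sided_orbit n (x_elt n \<nu>)}"

definition chi_fine ::
  "nat \<Rightarrow> ('a::field \<Rightarrow> complex) \<Rightarrow> 'a arc set \<Rightarrow> 'a mat \<Rightarrow> complex" where
  "chi_fine n \<theta> \<nu> = (\<lambda>h\<in>carrier (UT n). \<Sum>\<mu>\<in>dual_orbit n (lam n \<nu>). \<theta> (\<mu> (f_map n h)))"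

definition K_block :: "nat \<Rightarrow> 'a::field arc set \<Rightarrow> 'a mat set" where
  "K_block n \<eta> = (\<Union>\<nu>\<in>{\<nu>. fq_set_partition n \<nu> \<and> sml \<nu> = \<eta>}. K_fine n \<nu>)"

definition chi_block ::
  "nat \<Rightarrow> ('a::field \<Rightarrow> complex) \<Rightarrow> 'a arc set \<Rightarrow> 'a mat \<Rightarrow> complex" where
  "chi_block n \<theta> \<eta> =
     (\<lambda>h\<in>carrier (UT n). \<Sum>\<nu> | fq_set_partition n \<nu> \<and> big \<nu> = \<eta>. chi_fine n \<theta> \<nu> h)"

text \<open>A nontrivial homomorphism from the additive group of the field to the nonzero complex
  numbers.\<close>

definition nontrivial_additive_character :: "('a::field \<Rightarrow> complex) \<Rightarrow> bool" where
  "nontrivial_additive_character \<theta> \<longleftrightarrow>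
     (\<forall>a b. \<theta> (a + b) = \<theta> a * \<theta> b) \<and> (\<forall>a. \<theta> a \<noteq> 0) \<and> (\<exists>a. \<theta> a \<noteq> 1)"

end

theory Submission
  imports Defs "Jordan_Normal_Form.Schur_Decomposition" "Jordan_Normal_Form.DL_Rank" "HOL-Algebra.Multiplicative_Group"
begin

text \<open>Let \<open>N\<close> be the set of \<open>h\<close> in \<open>UT n\<close> whose entries strictly inside the arcs of a nonnesting
  \<open>\<eta>\<close> vanish. It is a normal subgroup, \<open>\<tau>(h) = \<theta>(\<Sum> a * h\<^sub>i\<^sub>j)\<close> (sum over the arcs of
  \<open>\<eta>\<close>) is a conjugation invariant linear character of it, and \<open>\<chi>\<^bsub>[\<eta>]\<^esub>\<close> turns out to be the
  character induced from \<open>\<tau>\<close>, namely \<open>[UT n : N] * \<tau>\<close> on \<open>N\<close> and \<open>0\<close> elsewhere. Indeed the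
  functionals in the orbits with \<open>big \<nu> = \<eta>\<close> are exactly those whose coefficients at and outside the
  arcs are prescribed by \<open>\<eta>\<close>, while those strictly inside the arcs are free. Dually, the elements of
  \<open>K\<^bsub>[\<eta>]\<^esub>\<close> have the labels of \<open>\<eta>\<close> as entries at its arcs and \<open>0\<close> at all positions that do not
  contain an arc.

  The \<open>\<chi>\<^bsub>[\<eta>]\<^esub>\<close> sum to the regular character, so every irreducible \<open>\<psi>\<close> has nonzero inner product with
  one of them, and Schur averaging makes it a constituent. If \<open>\<psi>\<close> is a constituent of \<open>\<chi>\<^bsub>[\<eta>]\<^esub>\<close>,
  the triangle inequality for traces forces \<open>\<psi> = \<psi>(1) * \<tau>\<close> on \<open>N\<close>; evaluating at the transvections
  belonging to outermost arcs recovers \<open>\<eta>\<close> from these restrictions.\<close>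

section \<open>Representations of finite groups\<close>

text \<open>Single orbits are hard to describe, but their unions over a block are cut out by
  conditions on individual entries (\<open>chi_supp\<close>, \<open>K_supp\<close>). That each orbit
  lies in the expected support is a direct computation. Elimination puts every functional and every
  matrix into the orbit of some set partition, and supports of different nonnesting partitions are
  disjoint, so this partition belongs to the right block. Thus the union is identified without
  parametrising any orbit.

  Outermost arcs govern the characters and innermost arcs the classes because the dual action is
  transposed: a label of \<open>\<nu>\<close> spreads inwards in the coefficients of a functional
  but outwards in the entries of \<open>u * x * v\<close>. Hence \<open>big\<close> and
  \<open>sml\<close> are what an orbit leaves untouched.

  That different set partitions have different orbits matters on the dual side:
  \<open>chi_block\<close> is a sum, in which a functional shared by two orbits would count twice,
  whereas an overlap does not change the union \<open>K_block\<close>. Both families are indexed by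
  the nonnesting partitions, so their equal cardinality reduces to injectivity of the two
  indexings.\<close>

lemma representation_iff:
  fixes G (structure)
  assumes "group G"
  shows "representation G d \<rho> \<longleftrightarrow> d > 0 \<and> (\<forall>g\<in>carrier G. \<rho> g \<in> carrier_mat d d) \<and>
    (\<forall>g\<in>carrier G. \<forall>h\<in>carrier G. \<rho> (g \<otimes> h) = \<rho> g * \<rho> h) \<and> \<rho> \<one> = 1\<^sub>m d"
proof -
  interpret group G by fact
  let ?R = "ring_mat TYPE(complex) d ()"
  interpret R: ring ?R by (rule ring_mat)
  have u: "group (units_of ?R)" by (rule R.units_group)
  show ?thesis
  proof
    assume r: "representation G d \<rho>"
    then have h: "\<rho> \<in> hom G (units_of ?R)" and d: "d > 0" by (auto simp: representation_def)
    have "\<rho> \<one> = \<one>\<^bsub>units_of ?R\<^esub>" by (rule hom_one[OF h is_group u])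
    then have "\<rho> \<one> = 1\<^sub>m d" by (simp add: units_of_def ring_mat_def)
    moreover have "\<rho> g \<in> carrier_mat d d" if "g \<in> carrier G" for g
      using hom_in_carrier[OF h that] by (simp add: units_of_def Units_def ring_mat_def)
    moreover have "\<rho> (g \<otimes> k) = \<rho> g * \<rho> k" if "g \<in> carrier G" "k \<in> carrier G" for g k
      using hom_mult[OF h that] by (simp add: units_of_def ring_mat_def)
    ultimately show "d > 0 \<and> (\<forall>g\<in>carrier G. \<rho> g \<in> carrier_mat d d) \<and>
    (\<forall>g\<in>carrier G. \<forall>h\<in>carrier G. \<rho> (g \<otimes> h) = \<rho> g * \<rho> h) \<and> \<rho> \<one> = 1\<^sub>m d"
      using d by blast
  next
    assume a: "d > 0 \<and> (\<forall>g\<in>carrier G. \<rho> g \<in> carrier_mat d d) \<and>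
    (\<forall>g\<in>carrier G. \<forall>h\<in>carrier G. \<rho> (g \<otimes> h) = \<rho> g * \<rho> h) \<and> \<rho> \<one> = 1\<^sub>m d"
    have "\<rho> g \<in> carrier (units_of ?R)" if g: "g \<in> carrier G" for g
    proof -
      have "\<rho> g * \<rho> (inv g) = 1\<^sub>m d" "\<rho> (inv g) * \<rho> g = 1\<^sub>m d"
        using a g by (metis inv_closed r_inv) (metis a g inv_closed l_inv)
      then show ?thesis using a g
        by (auto simp: units_of_def Units_def ring_mat_def intro!: bexI[of _ "\<rho> (inv g)"])
    qed
    then show "representation G d \<rho>"
      using a by (auto simp: representation_def hom_def units_of_def ring_mat_def)
  qed
qed

section \<open>Traces and the bound on character values\<close>

lemma index_mult_mat_sum:
  assumes "A \<in> carrier_mat n k" "B \<in> carrier_mat k m" "i < n" "j < m"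
  shows "(A * B) $$ (i, j) = (\<Sum>l<k. A $$ (i, l) * B $$ (l, j))"
  using assms by (simp add: scalar_prod_def atLeast0LessThan)

lemma trace_mult_comm:
  fixes A :: "'b::comm_semiring_0 mat"
  assumes "A \<in> carrier_mat n m" "B \<in> carrier_mat m n"
  shows "(\<Sum>i<n. (A * B) $$ (i, i)) = (\<Sum>i<m. (B * A) $$ (i, i))"
proof -
  have "(\<Sum>i<n. (A * B) $$ (i, i)) = (\<Sum>i<n. \<Sum>j<m. A $$ (i, j) * B $$ (j, i))"
    using assms by (intro sum.cong refl) (auto simp: scalar_prod_def atLeast0LessThan)
  also have "\<dots> = (\<Sum>j<m. \<Sum>i<n. A $$ (i, j) * B $$ (j, i))" by (rule sum.swap)
  also have "\<dots> = (\<Sum>i<m. (B * A) $$ (i, i))"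
    using assms by (intro sum.cong refl) (auto simp: scalar_prod_def atLeast0LessThan mult.commute)
  finally show ?thesis .
qed

text \<open>Schur triangularisation keeps the trace and puts the eigenvalues on the diagonal. As
  \<open>A\<close> has finite order, these are roots of unity, so the trace is a sum of
  \<open>d\<close> numbers of norm 1.\<close>

lemma norm_trace_le:
  fixes A :: "complex mat"
  assumes A: "A \<in> carrier_mat d d" and k: "A ^\<^sub>m k = 1\<^sub>m d" "k > 0"
  shows "norm (\<Sum>i<d. A $$ (i, i)) \<le> real d"
proof -
  obtain es where cp: "char_poly A = (\<Prod>a\<leftarrow>es. [:- a, 1:])" using char_poly_factorized[OF A] by auto
  obtain B P Q where s: "schur_decomposition A es = (B, P, Q)" by (cases "schur_decomposition A es") auto
  have w: "similar_mat_wit A B P Q" and diag: "diag_mat B = es"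
    using schur_decomposition[OF A cp s] by auto
  note D = similar_mat_witD2[OF A w]
  have B: "B \<in> carrier_mat d d" by (rule D)
  have "(\<Sum>i<d. A $$ (i, i)) = (\<Sum>i<d. (P * (B * Q)) $$ (i, i))" using D by simp
  also have "\<dots> = (\<Sum>i<d. ((B * Q) * P) $$ (i, i))" using D by (intro trace_mult_comm) auto
  also have "(B * Q) * P = B" using D by (simp add: assoc_mult_mat[of _ d d _ d _ d])
  finally have tr: "(\<Sum>i<d. A $$ (i, i)) = (\<Sum>i<d. B $$ (i, i))" .
  have n1: "norm e = 1" if "e \<in> set es" for e
  proof -
    have "poly (char_poly A) e = 0" using that unfolding cp poly_prod_list
      by (auto simp: prod_list_zero_iff)
    then have "eigenvalue A e" using eigenvalue_root_char_poly[OF A] by simp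
    then obtain v where v: "eigenvector A v e" by (auto simp: eigenvalue_def)
    then have v': "v \<in> carrier_vec d" "v \<noteq> 0\<^sub>v d" using A by (auto simp: eigenvector_def)
    have "A ^\<^sub>m k *\<^sub>v v = e ^ k \<cdot>\<^sub>v v" by (rule eigenvector_pow[OF A v])
    then have "v = e ^ k \<cdot>\<^sub>v v" using k v' by simp
    moreover obtain i where i: "i < d" "v $ i \<noteq> 0" using v' by (metis eq_vecI carrier_vecD index_zero_vec)
    ultimately have "v $ i = e ^ k * v $ i" using v' by (metis index_smult_vec(1) carrier_vecD)
    then have "e ^ k = 1" using i by simp
    then have "norm e ^ k = 1" by (metis norm_power norm_one)
    then show ?thesis using k(2) power_eq_imp_eq_base[of "norm e" k 1] by simp
  qed
  have "norm (B $$ (i, i)) = 1" if "i < d" for i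
    using that B diag n1 by (auto simp: diag_mat_def)
  then have "norm (\<Sum>i<d. B $$ (i, i)) \<le> (\<Sum>i<d. 1)" by (intro sum_norm_le) auto
  then show ?thesis unfolding tr by simp
qed

lemma representation_pow:
  fixes G (structure)
  assumes "group G" "representation G d \<rho>" "g \<in> carrier G"
  shows "\<rho> (g [^] (k::nat)) = \<rho> g ^\<^sub>m k"
proof -
  interpret group G by fact
  have r: "\<rho> h \<in> carrier_mat d d" if "h \<in> carrier G" for h
    using assms that representation_iff[OF assms(1)] by blast
  show ?thesis
  proof (induction k)
    case 0
    show ?case using assms r[OF assms(3)] representation_iff[OF assms(1)] by auto
  next
    case (Suc k)
    then show ?case using assms representation_iff[OF assms(1)] by simp
  qed
qed

lemma rep_character_one:
  fixes G (structure)
  assumes "group G" "representation G d \<rho>"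
  shows "rep_character G d \<rho> \<one> = of_nat d"
  using assms representation_iff[OF assms(1), of d \<rho>]
  by (simp add: rep_character_def group.is_monoid monoid.one_closed)

text \<open>The group order is a common exponent, so every \<open>\<rho> g\<close> has finite order
  as a matrix.\<close>

lemma norm_rep_character_le:
  assumes G: "group G" "finite (carrier G)" and r: "representation G d \<rho>" and g: "g \<in> carrier G"
  shows "norm (rep_character G d \<rho> g) \<le> real d"
proof -
  interpret group G by fact
  have "\<rho> g ^\<^sub>m Coset.order G = 1\<^sub>m d"
    using representation_pow[OF G(1) r g, of "Coset.order G"] pow_order_eq_1[OF g] r
      representation_iff[OF G(1)] by metis
  moreover have "Coset.order G > 0" using G(2) order_gt_0_iff_finite by blast
  moreover have "\<rho> g \<in> carrier_mat d d" using r g representation_iff[OF G(1)] by blast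
  ultimately show ?thesis using norm_trace_le[of "\<rho> g" d "Coset.order G"] g by (simp add: rep_character_def)
qed

text \<open>The equality case of the triangle inequality: \<open>\<bar>\<psi> g\<bar> \<le> \<psi> 1\<close> and likewise for the complement of
  \<open>\<psi>\<close> in \<open>\<chi>\<close>.\<close>

lemma constituent_eq_mult:
  fixes G (structure)
  assumes G: "group G" "finite (carrier G)" and c: "constituent G \<psi> \<chi>" and g: "g \<in> carrier G"
    and z: "norm z = 1" "\<chi> g = \<chi> \<one> * z"
  shows "\<psi> g = \<psi> \<one> * z" "\<psi> \<one> \<noteq> 0"
proof -
  interpret group G by fact
  have zz: "z * cnj z = 1" using z(1) by (simp add: complex_norm_square[symmetric])
  obtain d \<rho> where psi: "\<psi> = rep_character G d \<rho>" and r: "representation G d \<rho>"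
    using c by (auto simp: constituent_def irreducible_characters_def irreducible_representation_def)
  have p1: "\<psi> \<one> = of_nat d" unfolding psi by (rule rep_character_one[OF G(1) r])
  have "d > 0" using r by (simp add: representation_def)
  then show "\<psi> \<one> \<noteq> 0" using p1 by simp
  have Re_le: "Re (rep_character G e \<sigma> g * cnj z) \<le> e" if "representation G e \<sigma>" for e \<sigma>
    using norm_rep_character_le[OF G that g] complex_Re_le_cmod[of "rep_character G e \<sigma> g * cnj z"] z(1)
    by (simp add: norm_mult)
  consider "\<chi> = \<psi>" | \<phi> where "\<phi> \<in> characters G" "\<chi> = (\<lambda>g\<in>carrier G. \<psi> g + \<phi> g)"
    using c by (auto simp: constituent_def)
  then show "\<psi> g = \<psi> \<one> * z"
  proof cases
    case 1
    then show ?thesis using z by simp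
  next
    case 2
    then obtain e \<sigma> where phi: "\<phi> = rep_character G e \<sigma>" and s: "representation G e \<sigma>"
      by (auto simp: characters_def)
    have "\<phi> \<one> = of_nat e" unfolding phi by (rule rep_character_one[OF G(1) s])
    then have "\<psi> g + \<phi> g = of_nat (d + e) * z" using z(2) 2(2) g p1 by simp
    then have "(\<psi> g + \<phi> g) * cnj z = of_nat (d + e)" using zz by (simp add: mult.assoc)
    then have "\<psi> g * cnj z + \<phi> g * cnj z = of_nat (d + e)" by (simp add: ring_distribs)
    then have "Re (\<psi> g * cnj z) + Re (\<phi> g * cnj z) = d + e"
      by (metis plus_complex.simps(1) Re_complex_of_real of_real_of_nat_eq of_nat_add)
    then have re: "Re (\<psi> g * cnj z) = d"
      using Re_le[OF r] Re_le[OF s] unfolding psi phi by linarith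
    have "norm (\<psi> g * cnj z) \<le> d" using norm_rep_character_le[OF G r g] z(1) psi by (simp add: norm_mult)
    then have "(Re (\<psi> g * cnj z))\<^sup>2 + (Im (\<psi> g * cnj z))\<^sup>2 \<le> (real d)\<^sup>2"
      by (metis cmod_power2 norm_ge_zero power_mono)
    then have "Im (\<psi> g * cnj z) = 0" using re by simp
    then have "\<psi> g * cnj z = of_nat d" using re by (simp add: complex_eq_iff)
    then have "\<psi> g * (z * cnj z) = of_nat d * z" by (metis mult.assoc mult.commute)
    then show ?thesis using zz p1 by simp
  qed
qed

section \<open>Constituents from intertwining matrices\<close>

lemma injective_mat_completion:
  fixes T :: "'b::field mat"
  assumes T: "T \<in> carrier_mat n m"
    and inj: "\<And>v. v \<in> carrier_vec m \<Longrightarrow> T *\<^sub>v v = 0\<^sub>v n \<Longrightarrow> v = 0\<^sub>v m"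
  obtains M M' where "m \<le> n" "M \<in> carrier_mat n n" "M' \<in> carrier_mat n n"
    "M * M' = 1\<^sub>m n" "M' * M = 1\<^sub>m n"
    "\<And>i j. i < n \<Longrightarrow> j < m \<Longrightarrow> M $$ (i, j) = T $$ (i, j)"
proof -
  interpret vec_space "TYPE('b)" n .
  \<comment> \<open>Independence is a property of the set of columns, which forgets repetitions;
    distinctness has to be secured separately.\<close>
  have dist: "distinct (cols T)"
  proof (rule ccontr)
    assume "\<not> distinct (cols T)"
    then obtain i j where ij: "i < m" "j < m" "i \<noteq> j" "col T i = col T j"
      using T by (auto simp: distinct_conv_nth)
    let ?v = "unit_vec m i - unit_vec m j :: 'b vec"
    have "T *\<^sub>v ?v = col T i - col T j"
    proof (intro eq_vecI)
      fix r assume "r < dim_vec (col T i - col T j)"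
      then have r: "r < n" using T by simp
      have "row T r \<in> carrier_vec m" using T r by auto
      then have "row T r \<bullet> ?v = row T r \<bullet> unit_vec m i - row T r \<bullet> unit_vec m j"
        by (intro scalar_prod_minus_distrib) auto
      then show "(T *\<^sub>v ?v) $ r = (col T i - col T j) $ r"
        using ij(1,2) T r by simp
    qed (use T in simp)
    also have "\<dots> = 0\<^sub>v n" using ij T by auto
    finally have "?v = 0\<^sub>v m" using inj by simp
    then have "?v $ i = 0" using ij by simp
    then show False using ij by (simp add: unit_vec_def)
  qed
  have li: "lin_indpt (set (cols T))"
  proof
    assume "lin_dep (set (cols T))"
    from lin_depE[OF T this dist] inj show False by metis
  qed
  have "set (cols T) \<subseteq> span (set (unit_vecs n))"
    using cols_dim[of T] T span_unit_vecs_is_carrier by simp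
  \<comment> \<open>Steinitz exchange against the standard basis: at most \<open>n - m\<close>
    further vectors complete the columns to a generating set.\<close>
  with replacement[of "set (cols T)" "set (unit_vecs n)"] li
  obtain C where C: "finite C" "C \<subseteq> carrier_vec n"
     "int (card C) \<le> int n - int m" "span (set (cols T) \<union> C) = carrier_vec n"
    using dist T by (auto simp: distinct_card unit_vecs_carrier unit_vecs_distinct span_unit_vecs_is_carrier card_length)
  obtain cs where cs: "set cs = C" "distinct cs" using finite_distinct_list[OF C(1)] by blast
  define L where "L = cols T @ cs"
  have setL: "set L = set (cols T) \<union> C" using cs by (auto simp: L_def)
  have Lc: "set L \<subseteq> carrier_vec n" using setL C cols_dim[of T] T by auto
  have len: "length L = m + card C" using T cs distinct_card[of cs] by (simp add: L_def)
  have gen: "span (set L) = carrier V" using C setL by (simp add: module_vec_simps)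
  \<comment> \<open>A generating list has at least \<open>n\<close> distinct entries, and
    \<open>L\<close> has at most \<open>n\<close> entries altogether; so it is free of repetitions
    and a basis.\<close>
  have "n \<le> card (set L)" using gen_ge_dim[of "set L"] Lc gen dim_is_n by (simp add: module_vec_simps)
  moreover have "card (set L) \<le> length L" by (rule card_length)
  moreover have "length L \<le> n" using len C(3) \<open>n \<le> card (set L)\<close> \<open>card (set L) \<le> length L\<close> by linarith
  ultimately have ln: "length L = n" "distinct L" by (auto intro: card_distinct)
  have "basis (set L)"
    using dim_gen_is_basis[of "set L"] Lc gen dim_is_n ln distinct_card[OF ln(2)] by (simp add: module_vec_simps)
  then have liL: "lin_indpt (set L)" by (simp add: basis_def)
  define M where "M = mat_of_cols n L"
  have M: "M \<in> carrier_mat n n" using ln(1) unfolding M_def by (metis mat_of_cols_carrier(1))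
  have cM: "cols M = L" using Lc by (simp add: M_def)
  have "rank M = n" by (rule lin_indpt_full_rank[OF M]) (use liL ln cM in auto)
  then have "det M \<noteq> 0" using det_rank_iff[OF M] by simp
  then have "M \<in> Units (ring_mat TYPE('b) n ())" by (rule det_non_zero_imp_unit[OF M])
  then obtain M' where M': "M' \<in> carrier_mat n n" "M * M' = 1\<^sub>m n" "M' * M = 1\<^sub>m n"
    by (auto simp: Units_def ring_mat_def)
  have "M $$ (i, j) = T $$ (i, j)" if "i < n" "j < m" for i j
    using that ln len T by (simp add: M_def mat_of_cols_def L_def nth_append)
  moreover have "m \<le> n" using len ln by simp
  ultimately show thesis using that M M' by blast
qed


lemma subspace_mat_kernel:
  fixes T :: "complex mat"
  assumes T: "T \<in> carrier_mat n m"
  shows "VectorSpace.subspace class_ring {v \<in> carrier_vec m. T *\<^sub>v v = 0\<^sub>v n} (module_vec TYPE(complex) m)"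
proof -
  interpret vec_space "TYPE(complex)" m .
  have "LinearCombinations.submodule class_ring {v \<in> carrier_vec m. T *\<^sub>v v = 0\<^sub>v n} V"
    by (unfold_locales) (use T in \<open>auto simp: module_vec_simps mult_add_distrib_mat_vec[OF T] mult_mat_vec[OF T] class_ring_simps\<close>)
  then show ?thesis by (rule VectorSpace.subspace.intro[OF vectorspace_axioms])
qed

text \<open>\<open>T\<close> is injective because its kernel is invariant. In a basis extending the columns of \<open>T\<close> the
  matrices \<open>R g\<close> are block triangular with upper left block \<open>\<rho> g\<close>; the other diagonal block affords the
  complementary character.\<close>

lemma constituent_intertwiner:
  fixes G (structure)
  assumes G: "group G" and R: "representation G n R"
    and irr: "irreducible_representation G m \<rho>"
    and T: "T \<in> carrier_mat n m" "T \<noteq> 0\<^sub>m n m"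
    and comm: "\<And>g. g \<in> carrier G \<Longrightarrow> R g * T = T * \<rho> g"
  shows "constituent G (rep_character G m \<rho>) (rep_character G n R)"
proof -
  note riff = representation_iff[OF G]
  have r: "representation G m \<rho>" using irr by (simp add: irreducible_representation_def)
  have rc: "\<And>g. g \<in> carrier G \<Longrightarrow> \<rho> g \<in> carrier_mat m m" 
    and Rc: "\<And>g. g \<in> carrier G \<Longrightarrow> R g \<in> carrier_mat n n" using r R riff by blast+
  let ?W = "{v \<in> carrier_vec m. T *\<^sub>v v = 0\<^sub>v n}"
  have "\<rho> g *\<^sub>v w \<in> ?W" if "g \<in> carrier G" "w \<in> ?W" for g w
  proof -
    have "T *\<^sub>v (\<rho> g *\<^sub>v w) = (T * \<rho> g) *\<^sub>v w" using T(1) rc[OF that(1)] that(2) by (intro assoc_mult_mat_vec[symmetric]) auto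
    also have "\<dots> = R g *\<^sub>v (T *\<^sub>v w)"
      unfolding comm[OF that(1), symmetric] using T(1) Rc[OF that(1)] that(2) by (intro assoc_mult_mat_vec) auto
    also have "T *\<^sub>v w = 0\<^sub>v n" using that by simp
    also have "R g *\<^sub>v 0\<^sub>v n = 0\<^sub>v n" using Rc[OF that(1)] by (intro eq_vecI) auto
    finally show ?thesis using mult_mat_vec_carrier[OF rc[OF that(1)]] that(2) by simp
  qed
  then consider "?W = {0\<^sub>v m}" | "?W = carrier_vec m"
    using irr subspace_mat_kernel[OF T(1)] unfolding irreducible_representation_def by blast
  then have inj: "v = 0\<^sub>v m" if "v \<in> carrier_vec m" "T *\<^sub>v v = 0\<^sub>v n" for v
  proof cases
    case 1
    then show ?thesis using that by blast
  next
    case 2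
    have "T = 0\<^sub>m n m"
    proof (rule eq_matI)
      fix i j assume ij: "i < dim_row (0\<^sub>m n m :: complex mat)" "j < dim_col (0\<^sub>m n m :: complex mat)"
      have "unit_vec m j \<in> ?W" unfolding 2 by simp
      then have "T *\<^sub>v unit_vec m j = 0\<^sub>v n" by simp
      then have "(T *\<^sub>v unit_vec m j) $ i = 0" using ij by simp
      then show "T $$ (i, j) = 0\<^sub>m n m $$ (i, j)" using ij T(1) by simp
    qed (use T in auto)
    then show ?thesis using T by simp
  qed
  obtain M M' where M: "m \<le> n" "M \<in> carrier_mat n n"
      "\<And>i j. i < n \<Longrightarrow> j < m \<Longrightarrow> M $$ (i, j) = T $$ (i, j)"
    and M': "M' \<in> carrier_mat n n" "M * M' = 1\<^sub>m n" "M' * M = 1\<^sub>m n"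
    by (rule injective_mat_completion[OF T(1) inj]) (assumption, assumption, rule that)
  define S where "S g = M' * R g * M" for g
  have Sc: "S g \<in> carrier_mat n n" if "g \<in> carrier G" for g using M M' Rc[OF that] by (auto simp: S_def)
  have S1: "S \<one> = 1\<^sub>m n" using M M' R riff by (simp add: S_def)
  have Smult: "S (g \<otimes> h) = S g * S h" if gh: "g \<in> carrier G" "h \<in> carrier G" for g h
  proof -
    note c = M(2) M'(1) Rc[OF gh(1)] Rc[OF gh(2)] mult_carrier_mat[of _ n n _ n]
    have "S g * S h = M' * (R g * ((M * M') * (R h * M)))"
      unfolding S_def using c by (simp add: assoc_mult_mat[of _ n n _ n _ n])
    also have "\<dots> = M' * (R g * R h) * M" 
      using c M'(2) by (simp add: assoc_mult_mat[of _ n n _ n _ n])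
    finally show ?thesis using R riff gh by (simp add: S_def)
  qed
  \<comment> \<open>The columns of \<open>T\<close> are the first \<open>m\<close> columns of
    \<open>M\<close>, so \<open>M' * T\<close> consists of the first \<open>m\<close> columns of the
    identity.\<close>
  have M'T: "(M' * T) $$ (i, j) = (if i = j then 1 else 0)" if "i < n" "j < m" for i j
  proof -
    have "(M' * T) $$ (i, j) = (M' * M) $$ (i, j)"
      using that M M'(1) T(1) by (auto simp: scalar_prod_def intro!: sum.cong)
    then show ?thesis using M'(3) that M(1) by simp
  qed
  have Sl: "S g $$ (i, j) = (if i < m then \<rho> g $$ (i, j) else 0)" if g: "g \<in> carrier G" and ij: "i < n" "j < m" for g i j
  proof -
    have "S g $$ (i, j) = (\<Sum>k<n. (M' * R g) $$ (i, k) * M $$ (k, j))"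
      unfolding S_def using ij M(1,2) M'(1) Rc[OF g] by (intro index_mult_mat_sum[of _ n n _ n]) auto
    also have "\<dots> = (\<Sum>k<n. (M' * R g) $$ (i, k) * T $$ (k, j))"
      using M(3) ij by (intro sum.cong) auto
    also have "\<dots> = (M' * R g * T) $$ (i, j)"
      using ij T(1) M'(1) Rc[OF g] by (intro index_mult_mat_sum[symmetric]) auto
    also have "M' * R g * T = M' * T * \<rho> g"
      using M'(1) T(1) Rc[OF g] rc[OF g] comm[OF g]
      by (simp add: assoc_mult_mat[of _ n n _ n _ m] assoc_mult_mat[of _ n n _ m _ m])
    also have "(M' * T * \<rho> g) $$ (i, j) = (\<Sum>k<m. (M' * T) $$ (i, k) * \<rho> g $$ (k, j))"
      using ij T(1) M'(1) rc[OF g] by (intro index_mult_mat_sum) auto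
    also have "\<dots> = (\<Sum>k<m. if i = k then \<rho> g $$ (k, j) else 0)"
      using M'T ij by (intro sum.cong) auto
    finally show ?thesis by simp
  qed
  have tr: "(\<Sum>i<n. R g $$ (i, i)) = (\<Sum>i<n. S g $$ (i, i))" if g: "g \<in> carrier G" for g
  proof -
    have "(\<Sum>i<n. S g $$ (i, i)) = (\<Sum>i<n. (M * (M' * R g)) $$ (i, i))"
      unfolding S_def using M(2) M'(1) Rc[OF g] by (intro trace_mult_comm) auto
    also have "M * (M' * R g) = R g" using M(2) M' Rc[OF g]
      by (simp add: assoc_mult_mat[of _ n n _ n _ n, symmetric])
    finally show ?thesis by simp
  qed
  define \<sigma> where "\<sigma> g = mat (n - m) (n - m) (\<lambda>(i, j). S g $$ (i + m, j + m))" for g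
  have split: "(\<Sum>i<n. f i) = (\<Sum>i<m. f i) + (\<Sum>i<n - m. f (i + m))" for f :: "nat \<Rightarrow> complex"
  proof -
    have "(\<Sum>i<n. f i) = (\<Sum>i=0..<m. f i) + (\<Sum>i=m..<n. f i)"
      using M(1) by (simp add: sum.atLeastLessThan_concat atLeast0LessThan[symmetric])
    also have "(\<Sum>i=m..<n. f i) = (\<Sum>i=0..<n - m. f (i + m))"
      using sum.shift_bounds_nat_ivl[of f 0 m "n - m"] M(1) by simp
    finally show ?thesis by (simp add: atLeast0LessThan)
  qed
  have chi: "(\<Sum>i<n. R g $$ (i, i)) = (\<Sum>i<m. \<rho> g $$ (i, i)) + (\<Sum>i<n - m. \<sigma> g $$ (i, i))"
    if g: "g \<in> carrier G" for g
    unfolding tr[OF g] split[of "\<lambda>i. S g $$ (i, i)"] using Sl[OF g] M(1)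
    by (auto simp: \<sigma>_def)
  have psi: "rep_character G m \<rho> \<in> irreducible_characters G"
    using irr by (auto simp: irreducible_characters_def)
  show ?thesis
  \<comment> \<open>Representations have positive degree, so for \<open>m = n\<close> no
    complementary character exists and the two characters coincide.\<close>
  proof (cases "m = n")
    case True
    then have "rep_character G n R = rep_character G m \<rho>"
      using chi by (auto simp: rep_character_def fun_eq_iff restrict_def)
    then show ?thesis using psi by (simp add: constituent_def)
  next
    case False
    then have "m < n" using M(1) by simp
    moreover have "\<sigma> (g \<otimes> h) = \<sigma> g * \<sigma> h" if gh: "g \<in> carrier G" "h \<in> carrier G" for g h
    proof (rule eq_matI)
      fix i j assume ij: "i < dim_row (\<sigma> g * \<sigma> h)" "j < dim_col (\<sigma> g * \<sigma> h)"
      then have ij': "i < n - m" "j < n - m" by (auto simp: \<sigma>_def)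
      have "\<sigma> (g \<otimes> h) $$ (i, j) = (\<Sum>k<n. S g $$ (i + m, k) * S h $$ (k, j + m))"
        using ij' Sc[OF gh(1)] Sc[OF gh(2)] index_mult_mat_sum[of "S g" n n "S h" n "i + m" "j + m"]
        by (simp add: \<sigma>_def Smult[OF gh])
      \<comment> \<open>The terms with index below \<open>m\<close> contain entries of the lower
        left block of \<open>S g\<close>, which is zero.\<close>
      also have "\<dots> = (\<Sum>k<n - m. S g $$ (i + m, k + m) * S h $$ (k + m, j + m))"
        unfolding split using Sl[OF gh(1)] ij' by simp
      also have "\<dots> = (\<sigma> g * \<sigma> h) $$ (i, j)"
        using ij' by (simp add: \<sigma>_def scalar_prod_def atLeast0LessThan)
      finally show "\<sigma> (g \<otimes> h) $$ (i, j) = (\<sigma> g * \<sigma> h) $$ (i, j)" .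
    qed (auto simp: \<sigma>_def)
    moreover have "\<sigma> \<one> = 1\<^sub>m (n - m)" unfolding \<sigma>_def S1 by (rule eq_matI) auto
    ultimately have "representation G (n - m) \<sigma>" by (auto simp: riff \<sigma>_def)
    then have "rep_character G (n - m) \<sigma> \<in> characters G" by (auto simp: characters_def)
    moreover have "rep_character G n R = (\<lambda>g\<in>carrier G. rep_character G m \<rho> g + rep_character G (n - m) \<sigma> g)"
      using chi by (auto simp: rep_character_def fun_eq_iff restrict_def)
    ultimately show ?thesis using psi by (auto simp: constituent_def)
  qed
qed

text \<open>Averaging an elementary matrix over the group gives an intertwiner \<open>T k l\<close>.
  The inner product is the sum of the entries \<open>T i j $$ (i, j)\<close>, so at least one of
  these intertwiners is nonzero.\<close>

lemma constituent_inner_product: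
  fixes G (structure)
  assumes G: "group G" "finite (carrier G)" and \<chi>: "\<chi> \<in> characters G"
    and \<psi>: "\<psi> \<in> irreducible_characters G"
    and nz: "(\<Sum>g\<in>carrier G. \<chi> g * \<psi> (inv g)) \<noteq> 0"
  shows "constituent G \<psi> \<chi>"
proof -
  interpret group G by fact
  obtain n R where chi: "\<chi> = rep_character G n R" and R: "representation G n R"
    using \<chi> by (auto simp: characters_def)
  obtain m \<rho> where psi: "\<psi> = rep_character G m \<rho>" and irr: "irreducible_representation G m \<rho>"
    using \<psi> by (auto simp: irreducible_characters_def)
  note riff = representation_iff[OF G(1)]
  have r: "representation G m \<rho>" using irr by (simp add: irreducible_representation_def)
  have rc: "\<And>g. g \<in> carrier G \<Longrightarrow> \<rho> g \<in> carrier_mat m m" 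
    and Rc: "\<And>g. g \<in> carrier G \<Longrightarrow> R g \<in> carrier_mat n n" using r R riff by blast+
  \<comment> \<open>the average of the elementary matrix \<open>e\<^sub>k\<^sub>l\<close> over the group\<close>
  define T where "T k l = mat n m (\<lambda>(i, j). \<Sum>g\<in>carrier G. R g $$ (i, k) * \<rho> (inv g) $$ (l, j))" for k l
  have Tc: "T k l \<in> carrier_mat n m" for k l by (simp add: T_def)
  have "\<exists>k<n. \<exists>l<m. T k l \<noteq> 0\<^sub>m n m"
  proof (rule ccontr)
    assume "\<not> ?thesis"
    then have z: "T k l = 0\<^sub>m n m" if "k < n" "l < m" for k l using that by blast
    have "(\<Sum>g\<in>carrier G. \<chi> g * \<psi> (inv g)) =
      (\<Sum>g\<in>carrier G. \<Sum>i<n. \<Sum>j<m. R g $$ (i, i) * \<rho> (inv g) $$ (j, j))"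
      by (intro sum.cong refl) (simp add: chi psi rep_character_def sum_product)
    also have "\<dots> = (\<Sum>i<n. \<Sum>g\<in>carrier G. \<Sum>j<m. R g $$ (i, i) * \<rho> (inv g) $$ (j, j))"
      by (rule sum.swap)
    also have "\<dots> = (\<Sum>i<n. \<Sum>j<m. \<Sum>g\<in>carrier G. R g $$ (i, i) * \<rho> (inv g) $$ (j, j))"
      by (intro sum.cong refl sum.swap)
    also have "\<dots> = (\<Sum>i<n. \<Sum>j<m. T i j $$ (i, j))"
      by (intro sum.cong refl) (simp add: T_def)
    also have "\<dots> = 0" using z by simp
    finally show False using nz by simp
  qed
  then obtain k l where kl: "k < n" "l < m" "T k l \<noteq> 0\<^sub>m n m" by blast
  have "R h * T k l = T k l * \<rho> h" if h: "h \<in> carrier G" for h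
  proof (rule eq_matI)
    fix i j assume "i < dim_row (T k l * \<rho> h)" "j < dim_col (T k l * \<rho> h)"
    then have ij: "i < n" "j < m" using Tc[of k l] rc[OF h] by auto
    have "(R h * T k l) $$ (i, j) = (\<Sum>a<n. R h $$ (i, a) * T k l $$ (a, j))"
      using ij Rc[OF h] Tc[of k l] by (simp add: scalar_prod_def atLeast0LessThan)
    also have "\<dots> = (\<Sum>a<n. \<Sum>g\<in>carrier G. R h $$ (i, a) * R g $$ (a, k) * \<rho> (inv g) $$ (l, j))"
      using ij by (intro sum.cong refl) (simp add: T_def sum_distrib_left mult.assoc)
    also have "\<dots> = (\<Sum>g\<in>carrier G. \<Sum>a<n. R h $$ (i, a) * R g $$ (a, k) * \<rho> (inv g) $$ (l, j))"
      by (rule sum.swap)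
    also have "\<dots> = (\<Sum>g\<in>carrier G. R (h \<otimes> g) $$ (i, k) * \<rho> (inv g) $$ (l, j))"
    proof (intro sum.cong refl)
      fix g assume g: "g \<in> carrier G"
      have "R (h \<otimes> g) = R h * R g" using R riff h g by blast
      then have "R (h \<otimes> g) $$ (i, k) = (\<Sum>a<n. R h $$ (i, a) * R g $$ (a, k))"
        using ij kl Rc[OF h] Rc[OF g] by (simp add: scalar_prod_def atLeast0LessThan)
      then show "(\<Sum>a<n. R h $$ (i, a) * R g $$ (a, k) * \<rho> (inv g) $$ (l, j)) =
        R (h \<otimes> g) $$ (i, k) * \<rho> (inv g) $$ (l, j)" by (simp add: sum_distrib_right)
    qed
    \<comment> \<open>Replacing \<open>h \<otimes> g\<close> by \<open>g\<close> as the summation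
      variable moves \<open>h\<close> from the left factor into the right one.\<close>
    also have "\<dots> = (\<Sum>g\<in>carrier G. R g $$ (i, k) * \<rho> (inv g \<otimes> h) $$ (l, j))"
      by (rule sum.reindex_bij_witness[of _ "\<lambda>g. inv h \<otimes> g" "\<lambda>g. h \<otimes> g"])
        (use h in \<open>auto simp: m_assoc[symmetric] inv_mult_group\<close>, auto simp: m_assoc)
    also have "\<dots> = (\<Sum>g\<in>carrier G. \<Sum>b<m. R g $$ (i, k) * \<rho> (inv g) $$ (l, b) * \<rho> h $$ (b, j))"
    proof (intro sum.cong refl)
      fix g assume g: "g \<in> carrier G"
      then have "\<rho> (inv g \<otimes> h) = \<rho> (inv g) * \<rho> h" using r riff h by simp
      then have "\<rho> (inv g \<otimes> h) $$ (l, j) = (\<Sum>b<m. \<rho> (inv g) $$ (l, b) * \<rho> h $$ (b, j))"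
        using ij kl rc[OF h] rc[of "inv g"] g by (simp add: scalar_prod_def atLeast0LessThan)
      then show "R g $$ (i, k) * \<rho> (inv g \<otimes> h) $$ (l, j) =
        (\<Sum>b<m. R g $$ (i, k) * \<rho> (inv g) $$ (l, b) * \<rho> h $$ (b, j))"
        by (simp add: sum_distrib_left mult.assoc)
    qed
    also have "\<dots> = (\<Sum>b<m. \<Sum>g\<in>carrier G. R g $$ (i, k) * \<rho> (inv g) $$ (l, b) * \<rho> h $$ (b, j))"
      by (rule sum.swap)
    also have "\<dots> = (\<Sum>b<m. T k l $$ (i, b) * \<rho> h $$ (b, j))"
      using ij by (intro sum.cong refl) (simp add: T_def sum_distrib_right)
    also have "\<dots> = (T k l * \<rho> h) $$ (i, j)"
      using ij rc[OF h] Tc[of k l] by (simp add: scalar_prod_def atLeast0LessThan)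
    finally show "(R h * T k l) $$ (i, j) = (T k l * \<rho> h) $$ (i, j)" .
  qed (use Tc[of k l] Rc[OF h] rc[OF h] in auto)
  then show ?thesis unfolding chi psi
    using constituent_intertwiner[OF G(1) R irr Tc kl(3)] by blast
qed

text \<open>The induced representation is written out as matrices over coset representatives
  \<open>t i\<close>, with at most one nonzero entry in each column. Since \<open>N\<close> is
  normal and \<open>\<tau>\<close> is invariant, all diagonal entries of \<open>R g\<close> equal
  \<open>\<tau>' g\<close>, which gives the trace at once.\<close>

lemma induced_character:
  fixes G (structure)
  assumes G: "group G" "finite (carrier G)" and N: "normal N G"
    and \<tau>1: "\<tau> \<one> = (1::complex)"
    and mult: "\<And>x y. x \<in> N \<Longrightarrow> y \<in> N \<Longrightarrow> \<tau> (x \<otimes> y) = \<tau> x * \<tau> y"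
    and conj: "\<And>g x. g \<in> carrier G \<Longrightarrow> x \<in> N \<Longrightarrow> \<tau> (inv g \<otimes> x \<otimes> g) = \<tau> x"
  shows "(\<lambda>g\<in>carrier G. if g \<in> N then of_nat (card (rcosets N)) * \<tau> g else 0) \<in> characters G"
proof -
  interpret group G by fact
  interpret normal N G by fact
  define m where "m = card (rcosets N)"
  have finrc: "finite (rcosets N)" using G(2) by (simp add: RCOSETS_def)
  obtain C where C: "bij_betw C {..<m} (rcosets N)"
    using ex_bij_betw_nat_finite[OF finrc] by (auto simp: m_def atLeast0LessThan)
  have "\<exists>t\<in>carrier G. C i = N #> t" if "i < m" for i
  proof -
    have "C i \<in> rcosets N" using bij_betwE[OF C] that by blast
    then show ?thesis unfolding RCOSETS_def by blast
  qed
  then obtain t where t: "\<And>i. i < m \<Longrightarrow> t i \<in> carrier G" "\<And>i. i < m \<Longrightarrow> C i = N #> t i" by metis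
  \<comment> \<open>The matrix entries ask for left cosets while \<open>rcosets\<close> enumerates
    right ones; normality identifies them.\<close>
  have coset: "inv g \<otimes> h \<in> N \<longleftrightarrow> N #> g = N #> h" if "g \<in> carrier G" "h \<in> carrier G" for g h
  proof -
    have "inv g \<otimes> h \<in> N \<longleftrightarrow> h \<in> g <# N"
    proof
      assume "inv g \<otimes> h \<in> N"
      moreover have "h = g \<otimes> (inv g \<otimes> h)" using that by (simp add: m_assoc[symmetric])
      ultimately show "h \<in> g <# N" unfolding l_coset_def by blast
    next
      assume "h \<in> g <# N"
      then obtain x where x: "x \<in> N" "h = g \<otimes> x" by (auto simp: l_coset_def)
      then show "inv g \<otimes> h \<in> N" using that by (simp add: m_assoc[symmetric])
    qed
    also have "\<dots> \<longleftrightarrow> h \<in> N #> g" using coset_eq that by simp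
    also have "\<dots> \<longleftrightarrow> N #> g = N #> h"
      using that repr_independence[OF _ that(1) subgroup_axioms] rcos_self[OF that(2) subgroup_axioms] by auto
    finally show ?thesis .
  qed
  have uniq: "\<exists>!i. i < m \<and> inv (t i) \<otimes> g \<in> N" if g: "g \<in> carrier G" for g
  proof -
    have "N #> g \<in> rcosets N" using g by (auto simp: RCOSETS_def)
    then have "N #> g \<in> C ` {..<m}" using C by (simp add: bij_betw_def)
    then obtain i where i: "i < m" "C i = N #> g" by auto
    have "inj_on C {..<m}" using C by (simp add: bij_betw_def)
    have u: "j = i" if "j < m" "C j = N #> g" for j
      using inj_onD[OF \<open>inj_on C {..<m}\<close>, of j i] that i by simp
    have iff: "inv (t j) \<otimes> g \<in> N \<longleftrightarrow> C j = N #> g" if "j < m" for j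
      using coset[OF t(1)[OF that] g] t(2)[OF that] by simp
    show ?thesis
    proof (rule ex1I[of _ i])
      show "i < m \<and> inv (t i) \<otimes> g \<in> N" using i iff by blast
    next
      fix j assume "j < m \<and> inv (t j) \<otimes> g \<in> N"
      then show "j = i" using u iff by blast
    qed
  qed
  define \<tau>' where "\<tau>' g = (if g \<in> N then \<tau> g else 0)" for g
  \<comment> \<open>One factor has to lie in \<open>N\<close>: two elements outside can have their
    product inside, where \<open>\<tau>'\<close> need not vanish.\<close>
  have mult': "\<tau>' (x \<otimes> y) = \<tau>' x * \<tau>' y" if "x \<in> N" "y \<in> carrier G" for x y
  proof (cases "y \<in> N")
    case False
    then have "x \<otimes> y \<notin> N"
      using that by (metis inv_solve_left m_inv_closed m_closed mem_carrier)
    then show ?thesis using False by (simp add: \<tau>'_def)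
  qed (use that mult in \<open>auto simp: \<tau>'_def\<close>)
  have conjN: "inv g \<otimes> x \<otimes> g \<in> N \<longleftrightarrow> x \<in> N" if "g \<in> carrier G" "x \<in> carrier G" for g x
  proof
    assume "inv g \<otimes> x \<otimes> g \<in> N"
    from inv_op_closed2[OF that(1) this]
    show "x \<in> N" using that by (simp add: m_assoc) (simp add: m_assoc[symmetric])
  qed (use that inv_op_closed1 in auto)
  have conj': "\<tau>' (inv g \<otimes> x \<otimes> g) = \<tau>' x" if "g \<in> carrier G" "x \<in> carrier G" for g x
    using conjN[OF that] conj that by (auto simp: \<tau>'_def)
  define R where "R g = mat m m (\<lambda>(i, j). \<tau>' (inv (t i) \<otimes> g \<otimes> t j))" for g
  have "R (g \<otimes> h) = R g * R h" if gh: "g \<in> carrier G" "h \<in> carrier G" for g h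
  proof (rule eq_matI)
    fix i k assume "i < dim_row (R g * R h)" "k < dim_col (R g * R h)"
    then have ik: "i < m" "k < m" by (auto simp: R_def)
    have canc: "x \<otimes> (inv x \<otimes> y) = y" if "x \<in> carrier G" "y \<in> carrier G" for x y
      using that by (simp add: m_assoc[symmetric])
    obtain j where j: "j < m" "inv (t j) \<otimes> (h \<otimes> t k) \<in> N"
      and ju: "\<And>j'. j' < m \<Longrightarrow> j' \<noteq> j \<Longrightarrow> inv (t j') \<otimes> (h \<otimes> t k) \<notin> N"
      using uniq[of "h \<otimes> t k"] t ik gh by blast
    have "(R g * R h) $$ (i, k) = (\<Sum>j<m. \<tau>' (inv (t i) \<otimes> g \<otimes> t j) * \<tau>' (inv (t j) \<otimes> h \<otimes> t k))"
      using ik by (simp add: R_def scalar_prod_def atLeast0LessThan)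
    also have "\<dots> = (\<Sum>j'<m. if j' = j then \<tau>' (inv (t i) \<otimes> g \<otimes> t j) * \<tau>' (inv (t j) \<otimes> h \<otimes> t k) else 0)"
      using ju t ik gh by (intro sum.cong refl) (auto simp: \<tau>'_def m_assoc)
    also have "\<dots> = \<tau>' (inv (t j) \<otimes> h \<otimes> t k) * \<tau>' (inv (t i) \<otimes> g \<otimes> t j)"
      using j by simp
    \<comment> \<open>Of the two elements to be multiplied only the right one is known to lie in
      \<open>N\<close>, while \<open>mult'\<close> wants it on the left. Conjugating the other
      element by it interchanges them:
      \<open>y \<otimes> (inv y \<otimes> x \<otimes> y) = x \<otimes> y\<close>.\<close>
    also have "\<tau>' (inv (t i) \<otimes> g \<otimes> t j) = 
       \<tau>' (inv (inv (t j) \<otimes> h \<otimes> t k) \<otimes> (inv (t i) \<otimes> g \<otimes> t j) \<otimes> (inv (t j) \<otimes> h \<otimes> t k))"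
      using t ik gh j(1) by (intro conj'[symmetric]) auto
    also have "\<tau>' (inv (t j) \<otimes> h \<otimes> t k) * \<dots> = 
       \<tau>' ((inv (t j) \<otimes> h \<otimes> t k) \<otimes> (inv (inv (t j) \<otimes> h \<otimes> t k) \<otimes> (inv (t i) \<otimes> g \<otimes> t j) \<otimes> (inv (t j) \<otimes> h \<otimes> t k)))"
      using j t ik gh by (intro mult'[symmetric]) (auto simp: m_assoc)
    also have "(inv (t j) \<otimes> h \<otimes> t k) \<otimes> (inv (inv (t j) \<otimes> h \<otimes> t k) \<otimes> (inv (t i) \<otimes> g \<otimes> t j) \<otimes> (inv (t j) \<otimes> h \<otimes> t k))
       = (inv (t i) \<otimes> g \<otimes> t j) \<otimes> (inv (t j) \<otimes> h \<otimes> t k)"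
      using t ik gh j(1) by (simp add: m_assoc[symmetric])
    also have "\<dots> = inv (t i) \<otimes> g \<otimes> (t j \<otimes> inv (t j)) \<otimes> h \<otimes> t k"
      using t ik gh j(1) by (simp add: m_assoc canc del: r_inv)
    also have "\<tau>' \<dots> = R (g \<otimes> h) $$ (i, k)" using t ik gh j(1) by (simp add: R_def m_assoc canc)
    finally show "R (g \<otimes> h) $$ (i, k) = (R g * R h) $$ (i, k)" by simp
  qed (auto simp: R_def)
  moreover have "R \<one> = 1\<^sub>m m"
  proof (rule eq_matI)
    fix i j assume "i < dim_row (1\<^sub>m m :: complex mat)" "j < dim_col (1\<^sub>m m :: complex mat)"
    then have ij: "i < m" "j < m" by auto
    have "inv (t i) \<otimes> t j \<in> N \<longleftrightarrow> i = j" using uniq[of "t j"] ij t one_closed by (metis l_inv)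
    then show "R \<one> $$ (i, j) = 1\<^sub>m m $$ (i, j)" using ij t \<tau>1 by (auto simp: R_def \<tau>'_def)
  qed (auto simp: R_def)
  moreover have "m > 0" using uniq[of "\<one>"] by auto
  ultimately have R: "representation G m R" by (simp add: representation_iff[OF G(1)] R_def)
  have "rep_character G m R = (\<lambda>g\<in>carrier G. if g \<in> N then of_nat m * \<tau> g else 0)"
  proof (rule ext)
    fix g
    show "rep_character G m R g = (\<lambda>g\<in>carrier G. if g \<in> N then of_nat m * \<tau> g else 0) g"
    proof (cases "g \<in> carrier G")
      case True
      then have "(\<Sum>i<m. R g $$ (i, i)) = (\<Sum>i<m. \<tau>' g)"
        using t by (intro sum.cong refl) (simp add: R_def conj')
      then show ?thesis using True by (simp add: rep_character_def \<tau>'_def)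
    qed (simp add: rep_character_def)
  qed
  then show ?thesis using R by (force simp: characters_def m_def)
qed

section \<open>The group of unipotent upper triangular matrices\<close>

lemma UT_carrier_iff:
  "h \<in> carrier (UT n) \<longleftrightarrow> h \<in> carrier_mat n n \<and> (\<forall>i<n. h $$ (i, i) = 1) \<and> (\<forall>i<n. \<forall>j<i. h $$ (i, j) = 0)"
proof
  assume "h \<in> carrier (UT n)"
  then show "h \<in> carrier_mat n n \<and> (\<forall>i<n. h $$ (i, i) = 1) \<and> (\<forall>i<n. \<forall>j<i. h $$ (i, j) = 0)"
    by (auto simp: UT_def ut_def)
next
  assume h: "h \<in> carrier_mat n n \<and> (\<forall>i<n. h $$ (i, i) = 1) \<and> (\<forall>i<n. \<forall>j<i. h $$ (i, j) = 0)"
  have "h = 1\<^sub>m n + (h - 1\<^sub>m n)" by (rule eq_matI) (use h in auto)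
  moreover have "h - 1\<^sub>m n \<in> ut n" using h by (auto simp: ut_def le_less)
  ultimately show "h \<in> carrier (UT n)" by (auto simp: UT_def)
qed

lemma UT_carrier_mat: "h \<in> carrier (UT n) \<Longrightarrow> h \<in> carrier_mat n n"
  by (simp add: UT_carrier_iff)

lemma UT_lower: "h \<in> carrier (UT n) \<Longrightarrow> i < n \<Longrightarrow> j < i \<Longrightarrow> h $$ (i, j) = 0"
  by (simp add: UT_carrier_iff)

lemma UT_diag: "h \<in> carrier (UT n) \<Longrightarrow> i < n \<Longrightarrow> h $$ (i, i) = 1"
  by (simp add: UT_carrier_iff)

lemma ut_carrier_mat: "x \<in> ut n \<Longrightarrow> x \<in> carrier_mat n n"
  by (simp add: ut_def)

lemma ut_zero: "x \<in> ut n \<Longrightarrow> i < n \<Longrightarrow> j \<le> i \<Longrightarrow> x $$ (i, j) = 0"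
  by (simp add: ut_def)

lemma f_map_ut: "h \<in> carrier (UT n) \<Longrightarrow> f_map n h \<in> ut n"
  by (auto simp: f_map_def ut_def UT_carrier_iff le_less)

lemma f_map_index: "h \<in> carrier (UT n) \<Longrightarrow> i < j \<Longrightarrow> j < n \<Longrightarrow> f_map n h $$ (i, j) = h $$ (i, j)"
  by (auto simp: f_map_def UT_carrier_iff)

lemma UT_mult_simp [simp]: "x \<otimes>\<^bsub>UT n\<^esub> y = x * y"
  by (simp add: UT_def)

lemma UT_one_simp [simp]: "\<one>\<^bsub>UT n\<^esub> = 1\<^sub>m n"
  by (simp add: UT_def)

lemma UT_mult_closed:
  assumes g: "g \<in> carrier (UT n)" and h: "h \<in> carrier (UT n)"
  shows "g * h \<in> carrier (UT n)"
proof -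
  note gc = UT_carrier_mat[OF g] and hc = UT_carrier_mat[OF h]
  have "(g * h) $$ (i, i) = 1" if i: "i < n" for i
  proof -
    have "(g * h) $$ (i, i) = (\<Sum>l<n. g $$ (i, l) * h $$ (l, i))"
      by (rule index_mult_mat_sum[OF gc hc i i])
    also have "\<dots> = (\<Sum>l<n. if l = i then 1 else 0)"
    proof (rule sum.cong)
      fix l assume "l \<in> {..<n}"
      then show "g $$ (i, l) * h $$ (l, i) = (if l = i then 1 else 0)"
        using i UT_lower[OF g, of i l] UT_lower[OF h, of l i] UT_diag[OF g] UT_diag[OF h]
        by (cases l i rule: linorder_cases) auto
    qed simp
    finally show ?thesis using i by simp
  qed
  moreover have "(g * h) $$ (i, j) = 0" if i: "i < n" and j: "j < i" for i j
  proof -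
    have jn: "j < n" using i j by simp
    have "(g * h) $$ (i, j) = (\<Sum>l<n. g $$ (i, l) * h $$ (l, j))"
      by (rule index_mult_mat_sum[OF gc hc i jn])
    also have "\<dots> = 0"
    proof (rule sum.neutral, rule ballI)
      fix l assume "l \<in> {..<n}"
      then show "g $$ (i, l) * h $$ (l, j) = 0"
        using i j UT_lower[OF g, of i l] UT_lower[OF h, of l j] by (cases "l < i") auto
    qed
    finally show ?thesis .
  qed
  ultimately show ?thesis using gc hc by (simp add: UT_carrier_iff)
qed

lemma one_UT: "1\<^sub>m n \<in> carrier (UT n)"
  by (simp add: UT_carrier_iff)

section \<open>Finiteness and group structure\<close>

lemma finite_carrier_mat: "finite (carrier_mat n m :: 'a::finite mat set)"
proof -
  have "carrier_mat n m \<subseteq> (\<lambda>f. mat n m f) ` (({..<n} \<times> {..<m}) \<rightarrow>\<^sub>E (UNIV :: 'a set))"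
  proof
    fix A :: "'a mat" assume A: "A \<in> carrier_mat n m"
    show "A \<in> (\<lambda>f. mat n m f) ` (({..<n} \<times> {..<m}) \<rightarrow>\<^sub>E (UNIV :: 'a set))"
    proof (rule image_eqI)
      show "A = mat n m (restrict (($$) A) ({..<n} \<times> {..<m}))" by (rule eq_matI) (use A in auto)
    qed simp
  qed
  then show ?thesis by (rule finite_subset) (intro finite_imageI finite_PiE, auto)
qed

lemma finite_UT: "finite (carrier (UT n :: 'a::{field,finite} mat monoid))"
  by (rule finite_subset[OF _ finite_carrier_mat[of n n]]) (auto dest: UT_carrier_mat)

text \<open>Inverses are not computed. Determinant 1 makes \<open>x\<close> invertible as a matrix,
  so right multiplication by \<open>x\<close> is injective on a finite set, hence surjective, and
  attains the identity.\<close>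

lemma group_UT: "group (UT n :: 'a::{field,finite} mat monoid)"
proof (rule groupI)
  let ?U = "UT n :: 'a mat monoid"
  show "x \<otimes>\<^bsub>?U\<^esub> y \<in> carrier ?U" if "x \<in> carrier ?U" "y \<in> carrier ?U" for x y
    using UT_mult_closed[OF that] by simp
  show "\<one>\<^bsub>?U\<^esub> \<in> carrier ?U" by (simp add: one_UT)
  show "x \<otimes>\<^bsub>?U\<^esub> y \<otimes>\<^bsub>?U\<^esub> z = x \<otimes>\<^bsub>?U\<^esub> (y \<otimes>\<^bsub>?U\<^esub> z)"
    if "x \<in> carrier ?U" "y \<in> carrier ?U" "z \<in> carrier ?U" for x y z
    using that by (simp add: assoc_mult_mat[of _ n n _ n _ n] UT_carrier_mat)
  show "\<one>\<^bsub>?U\<^esub> \<otimes>\<^bsub>?U\<^esub> x = x" if "x \<in> carrier ?U" for x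
    using UT_carrier_mat[OF that] by simp
  show "\<exists>y\<in>carrier ?U. y \<otimes>\<^bsub>?U\<^esub> x = \<one>\<^bsub>?U\<^esub>" if x: "x \<in> carrier ?U" for x
  proof -
    note xc = UT_carrier_mat[OF x]
    have "upper_triangular x" using x xc by (auto simp: UT_carrier_iff)
    then have "det x = prod_list (diag_mat x)" using det_upper_triangular xc by blast
    also have "diag_mat x = map (\<lambda>i. 1) [0..<n]" using xc UT_diag[OF x] by (auto simp: diag_mat_def)
    also have "prod_list \<dots> = 1" by (induction n) auto
    finally have "det x \<noteq> 0" by simp
    then have "x \<in> Units (ring_mat TYPE('a) n ())" by (rule det_non_zero_imp_unit[OF xc])
    then obtain x' where x': "x' \<in> carrier_mat n n" "x * x' = 1\<^sub>m n"
      by (auto simp: Units_def ring_mat_def)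
    have "inj_on (\<lambda>y. y * x) (carrier ?U)"
    proof (rule inj_onI)
      fix y z assume y: "y \<in> carrier ?U" and z: "z \<in> carrier ?U" and "y * x = z * x"
      then have "y * x * x' = z * x * x'" by simp
      then have "y * (x * x') = z * (x * x')"
        using assoc_mult_mat[OF UT_carrier_mat[OF y] xc x'(1)] assoc_mult_mat[OF UT_carrier_mat[OF z] xc x'(1)] by simp
      then show "y = z" using x' UT_carrier_mat[OF y] UT_carrier_mat[OF z] by simp
    qed
    moreover have "(\<lambda>y. y * x) ` carrier ?U \<subseteq> carrier ?U" using UT_mult_closed x by auto
    ultimately have "(\<lambda>y. y * x) ` carrier ?U = carrier ?U"
      using finite_UT endo_inj_surj by blast
    then have "1\<^sub>m n \<in> (\<lambda>y. y * x) ` carrier ?U" using one_UT by blast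
    then show ?thesis by auto
  qed
qed

lemma UT_inv:
  fixes g :: "'a::{field,finite} mat"
  assumes "g \<in> carrier (UT n)"
  shows "inv\<^bsub>UT n\<^esub> g \<in> carrier (UT n)" "inv\<^bsub>UT n\<^esub> g * g = 1\<^sub>m n" "g * inv\<^bsub>UT n\<^esub> g = 1\<^sub>m n"
  using group.inv_closed[OF group_UT assms] group.l_inv[OF group_UT assms] group.r_inv[OF group_UT assms]
  by simp_all

section \<open>Products with unitriangular matrices on both sides\<close>

lemma sandwich_index:
  assumes u: "u \<in> carrier_mat n n" and x: "x \<in> carrier_mat n n" and v: "v \<in> carrier_mat n n"
    and r: "r < n" and c: "c < n"
  shows "(u * x * v) $$ (r, c) = (\<Sum>i<n. \<Sum>j<n. u $$ (r, i) * x $$ (i, j) * v $$ (j, c))"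
proof -
  have "(u * x * v) $$ (r, c) = (\<Sum>j<n. (u * x) $$ (r, j) * v $$ (j, c))"
    using assms by (intro index_mult_mat_sum) auto
  also have "\<dots> = (\<Sum>j<n. \<Sum>i<n. u $$ (r, i) * x $$ (i, j) * v $$ (j, c))"
    using assms by (intro sum.cong refl) (simp add: index_mult_mat_sum[OF u x] sum_distrib_right del: index_mult_mat)
  also have "\<dots> = (\<Sum>i<n. \<Sum>j<n. u $$ (r, i) * x $$ (i, j) * v $$ (j, c))" by (rule sum.swap)
  finally show ?thesis .
qed

text \<open>Triangularity of \<open>u\<close> and \<open>v\<close> lets the entry at
  \<open>(r, c)\<close> receive contributions only from positions contained in the interval from
  \<open>r\<close> to \<open>c\<close>: labels spread outwards.\<close>

lemma sandwich_nonzero: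
  assumes u: "u \<in> carrier (UT n)" and x: "x \<in> ut n" and v: "v \<in> carrier (UT n)"
    and rc: "r < n" "c < n" "(u * x * v) $$ (r, c) \<noteq> 0"
  obtains i j where "r \<le> i" "i < j" "j \<le> c" "x $$ (i, j) \<noteq> 0"
proof -
  have "(\<Sum>i<n. \<Sum>j<n. u $$ (r, i) * x $$ (i, j) * v $$ (j, c)) \<noteq> 0"
    using sandwich_index[OF UT_carrier_mat[OF u] ut_carrier_mat[OF x] UT_carrier_mat[OF v] rc(1,2)] rc(3) by simp
  then obtain i where i: "i < n" "(\<Sum>j<n. u $$ (r, i) * x $$ (i, j) * v $$ (j, c)) \<noteq> 0"
    by (meson lessThan_iff sum.neutral)
  then obtain j where j: "j < n" "u $$ (r, i) * x $$ (i, j) * v $$ (j, c) \<noteq> 0"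
    by (meson lessThan_iff sum.neutral)
  have "r \<le> i" using UT_lower[OF u rc(1), of i] j(2) by (cases "r \<le> i") auto
  moreover have "j \<le> c" using UT_lower[OF v j(1), of c] j(2) by (cases "j \<le> c") auto
  moreover have "i < j" using ut_zero[OF x i(1), of j] j(2) by (cases "i < j") auto
  ultimately show thesis using that j(2) by auto
qed

lemma sandwich_ut:
  assumes "u \<in> carrier (UT n)" "x \<in> ut n" "v \<in> carrier (UT n)"
  shows "u * x * v \<in> ut n"
proof -
  have "(u * x * v) $$ (i, j) = 0" if "i < n" "j \<le> i" for i j
    using sandwich_nonzero[OF assms, of i j] that by force
  moreover have "u * x * v \<in> carrier_mat n n"
    using UT_carrier_mat[OF assms(1)] ut_carrier_mat[OF assms(2)] UT_carrier_mat[OF assms(3)] by simp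
  ultimately show ?thesis by (simp add: ut_def del: index_mult_mat)
qed

text \<open>Once all positions properly contained in the interval from \<open>r\<close> to
  \<open>c\<close> are zero, the only surviving term carries the two diagonal entries 1.\<close>

lemma sandwich_eq:
  assumes u: "u \<in> carrier (UT n)" and x: "x \<in> ut n" and v: "v \<in> carrier (UT n)"
    and rc: "r < n" "c < n"
    and z: "\<And>i j. r \<le> i \<Longrightarrow> i < j \<Longrightarrow> j \<le> c \<Longrightarrow> (i, j) \<noteq> (r, c) \<Longrightarrow> x $$ (i, j) = 0"
  shows "(u * x * v) $$ (r, c) = x $$ (r, c)"
proof -
  have t: "u $$ (r, i) * x $$ (i, j) * v $$ (j, c) = (if i = r then if j = c then x $$ (r, c) else 0 else 0)"
    if ij: "i < n" "j < n" for i j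
  proof (cases "r \<le> i \<and> i < j \<and> j \<le> c")
    case True
    then show ?thesis using z[of i j] UT_diag[OF u rc(1)] UT_diag[OF v rc(2)] by auto
  next
    case False
    then consider "i < r" | "j \<le> i" | "c < j" by linarith
    then show ?thesis
      using UT_lower[OF u rc(1)] ut_zero[OF x] UT_lower[OF v ij(2), of c] ij rc by cases auto
  qed
  have "(u * x * v) $$ (r, c) = (\<Sum>i<n. \<Sum>j<n. if i = r then if j = c then x $$ (r, c) else 0 else 0)"
    unfolding sandwich_index[OF UT_carrier_mat[OF u] ut_carrier_mat[OF x] UT_carrier_mat[OF v] rc]
    by (intro sum.cong refl) (simp add: t)
  also have "\<dots> = (\<Sum>i<n. if i = r then (\<Sum>j<n. if j = c then x $$ (r, c) else 0) else 0)"
    by (intro sum.cong refl) auto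
  also have "\<dots> = x $$ (r, c)" using rc by simp
  finally show ?thesis .
qed

definition arc_positions :: "nat \<Rightarrow> (nat \<times> nat) set" where
  "arc_positions n = {(i, j). i < j \<and> j < n}"

lemma arc_positions_iff [simp]: "(i, j) \<in> arc_positions n \<longleftrightarrow> i < j \<and> j < n"
  by (simp add: arc_positions_def)

lemma finite_arc_positions [simp]: "finite (arc_positions n)"
  by (rule finite_subset[of _ "{..<n} \<times> {..<n}"]) auto

text \<open>Coefficient families for matrices and functionals alike. Their values off the arc
  positions are fixed, so that different families represent different objects and the set is finite
  over a finite field.\<close>

definition strict_upper :: "nat \<Rightarrow> (nat \<times> nat \<Rightarrow> 'a::zero) set" where
  "strict_upper n = {y. \<forall>p. p \<notin> arc_positions n \<longrightarrow> y p = 0}"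

section \<open>Elimination\<close>

text \<open>Powers of 2 make one position heavier than all lighter ones together, provided these
  have distinct weights: \<open>2 ^ 0 + ... + 2 ^ (k - 1) < 2 ^ k\<close>. Arbitrary fill-in on
  \<open>D\<close> is therefore affordable.\<close>

lemma weight_decrease:
  fixes w :: "'p \<Rightarrow> nat"
  assumes "finite A" "p \<in> A" "finite D" "A' \<subseteq> (A - {p}) \<union> D" "inj_on w D" "\<And>d. d \<in> D \<Longrightarrow> w d < w p"
  shows "(\<Sum>q\<in>A'. 2 ^ w q) < (\<Sum>q\<in>A. (2::nat) ^ w q)"
proof -
  have "(\<Sum>q\<in>D. (2::nat) ^ w q) = (\<Sum>e\<in>w ` D. 2 ^ e)" using assms(5) by (simp add: sum.reindex)
  also have "\<dots> \<le> (\<Sum>e\<in>{..<w p}. 2 ^ e)" using assms(6) by (intro sum_mono2) auto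
  also have "(\<Sum>e\<in>{..<k}. (2::nat) ^ e) < 2 ^ k" for k by (induction k) auto
  finally have D: "(\<Sum>q\<in>D. (2::nat) ^ w q) < 2 ^ w p" .
  have "(\<Sum>q\<in>A'. (2::nat) ^ w q) \<le> (\<Sum>q\<in>(A - {p}) \<union> D. 2 ^ w q)"
    using assms by (intro sum_mono2) auto
  also have "\<dots> \<le> (\<Sum>q\<in>A - {p}. 2 ^ w q) + (\<Sum>q\<in>D. 2 ^ w q)"
    using assms sum.union_inter[of "A - {p}" D "\<lambda>q. (2::nat) ^ w q"] by simp
  also have "\<dots> < (\<Sum>q\<in>A - {p}. 2 ^ w q) + 2 ^ w p" using D by simp
  also have "\<dots> = (\<Sum>q\<in>A. 2 ^ w q)" using assms(1,2) by (simp add: sum.remove)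
  finally show ?thesis .
qed

text \<open>Row \<open>i\<close> may be added to rows with smaller \<open>\<rho>\<close>, column \<open>j\<close> to columns with smaller \<open>\<kappa>\<close>; the two
  instances below are \<open>\<rho> k = k, \<kappa> l = n - l\<close> for matrices and \<open>\<rho> k = n - k, \<kappa> l = l\<close> for functionals,
  where the operations are truncated to the arc positions. Weighting the position \<open>(k, l)\<close> by
  \<open>2 ^ (\<rho> k + \<kappa> l)\<close>, clearing an entry with a pivot lowers the total weight of the support, whatever
  happens to the lighter entries; hence a member of \<open>Y\<close> of minimal weight is reduced.\<close>

lemma elimination:
  fixes Y :: "(nat \<times> nat \<Rightarrow> 'a::field) set" and \<rho> \<kappa> :: "nat \<Rightarrow> nat"
  assumes ne: "Y \<noteq> {}" and supp: "Y \<subseteq> strict_upper n"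
    and inj: "inj_on \<rho> {..<n}" "inj_on \<kappa> {..<n}"
    and row: "\<And>y i i' t. y \<in> Y \<Longrightarrow> i < n \<Longrightarrow> i' < n \<Longrightarrow> \<rho> i' < \<rho> i \<Longrightarrow>
      (\<lambda>(k, l). if k = i' \<and> (k, l) \<in> arc_positions n then y (k, l) + t * y (i, l) else y (k, l)) \<in> Y"
    and col: "\<And>y j j' t. y \<in> Y \<Longrightarrow> j < n \<Longrightarrow> j' < n \<Longrightarrow> \<kappa> j' < \<kappa> j \<Longrightarrow>
      (\<lambda>(k, l). if l = j' \<and> (k, l) \<in> arc_positions n then y (k, l) + t * y (k, j) else y (k, l)) \<in> Y"
  obtains y where "y \<in> Y" "\<And>i j k. y (i, j) \<noteq> 0 \<Longrightarrow> y (i, k) \<noteq> 0 \<Longrightarrow> j = k"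
    "\<And>i j k. y (i, k) \<noteq> 0 \<Longrightarrow> y (j, k) \<noteq> 0 \<Longrightarrow> i = j"
proof -
  define w where "w p = \<rho> (fst p) + \<kappa> (snd p)" for p
  define m where "m y = (\<Sum>p\<in>{p. y p \<noteq> 0}. (2::nat) ^ w p)" for y :: "nat \<times> nat \<Rightarrow> 'a"
  obtain y where y: "y \<in> Y" and min: "\<And>z. z \<in> Y \<Longrightarrow> m y \<le> m z"
    using ne ex_has_least_nat[of "\<lambda>y. y \<in> Y" _ m] by blast
  have pos: "(i, j) \<in> arc_positions n" if "y (i, j) \<noteq> 0" for i j using supp y that by (auto simp: strict_upper_def)
  have fin: "finite {p. y p \<noteq> 0}" by (rule finite_subset[OF _ finite_arc_positions[of n]]) (use pos in auto)
  \<comment> \<open>With the \<kappa>-largest entry of its row as pivot, clearing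
    \<open>(i', j)\<close> creates new entries only at lighter positions of row \<open>i'\<close>.
    By minimality there was nothing to clear.\<close>
  have rowp: "y (i', j) = 0" if ij: "y (i, j) \<noteq> 0" and top: "\<And>l. y (i, l) \<noteq> 0 \<Longrightarrow> \<kappa> l \<le> \<kappa> j"
    and i': "\<rho> i' < \<rho> i" for i i' j
  proof (rule ccontr)
    assume nz: "y (i', j) \<noteq> 0"
    define z where "z = (\<lambda>(k, l). if k = i' \<and> (k, l) \<in> arc_positions n
       then y (k, l) + (- y (i', j) / y (i, j)) * y (i, l) else y (k, l))"
    have b: "i < n" "i' < n" "j < n" using pos[OF ij] pos[OF nz] by auto
    have "z \<in> Y" unfolding z_def by (rule row[OF y b(1,2) i'])
    define L where "L = {l. l < n \<and> \<kappa> l < \<kappa> j}"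
    have "m z < m y" unfolding m_def
    proof (rule weight_decrease[where p = "(i', j)" and D = "{i'} \<times> L"])
      show "{p. z p \<noteq> 0} \<subseteq> {p. y p \<noteq> 0} - {(i', j)} \<union> {i'} \<times> L"
      proof
        fix p assume p: "p \<in> {p. z p \<noteq> 0}"
        obtain k l where kl: "p = (k, l)" by (cases p)
        show "p \<in> {p. y p \<noteq> 0} - {(i', j)} \<union> {i'} \<times> L"
        proof (cases "k = i' \<and> (k, l) \<in> arc_positions n")
          case False
          then show ?thesis using p kl pos[OF nz] by (auto simp: z_def split: if_splits)
        next
          case True
          then have zv: "z p = y (i', l) + (- y (i', j) / y (i, j)) * y (i, l)" by (simp add: z_def kl)
          show ?thesis
          proof (cases "y (i, l) = 0")
            case True
            then show ?thesis using zv p kl ij \<open>k = i' \<and> (k, l) \<in> arc_positions n\<close> by auto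
          next
            case False
            have "l \<noteq> j" using zv p ij by auto
            then have "\<kappa> l \<noteq> \<kappa> j" using inj(2) b True by (auto dest: inj_onD)
            then have "l \<in> L" using top[OF False] True by (auto simp: L_def)
            then show ?thesis using kl True by auto
          qed
        qed
      qed
      show "inj_on w ({i'} \<times> L)" using inj(2) by (auto simp: inj_on_def w_def L_def)
    qed (use fin nz in \<open>auto simp: L_def w_def\<close>)
    then show False using min[OF \<open>z \<in> Y\<close>] by simp
  qed
  have colp: "y (i, j') = 0" if ij: "y (i, j) \<noteq> 0" and top: "\<And>k. y (k, j) \<noteq> 0 \<Longrightarrow> \<rho> k \<le> \<rho> i"
    and j': "\<kappa> j' < \<kappa> j" for i j j'
  proof (rule ccontr)
    assume nz: "y (i, j') \<noteq> 0"
    define z where "z = (\<lambda>(k, l). if l = j' \<and> (k, l) \<in> arc_positions n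
       then y (k, l) + (- y (i, j') / y (i, j)) * y (k, j) else y (k, l))"
    have b: "j < n" "j' < n" "i < n" using pos[OF ij] pos[OF nz] by auto
    have "z \<in> Y" unfolding z_def by (rule col[OF y b(1,2) j'])
    define L where "L = {k. k < n \<and> \<rho> k < \<rho> i}"
    have "m z < m y" unfolding m_def
    proof (rule weight_decrease[where p = "(i, j')" and D = "L \<times> {j'}"])
      show "{p. z p \<noteq> 0} \<subseteq> {p. y p \<noteq> 0} - {(i, j')} \<union> L \<times> {j'}"
      proof
        fix p assume p: "p \<in> {p. z p \<noteq> 0}"
        obtain k l where kl: "p = (k, l)" by (cases p)
        show "p \<in> {p. y p \<noteq> 0} - {(i, j')} \<union> L \<times> {j'}"
        proof (cases "l = j' \<and> (k, l) \<in> arc_positions n")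
          case False
          then show ?thesis using p kl pos[OF nz] by (auto simp: z_def split: if_splits)
        next
          case True
          then have zv: "z p = y (k, j') + (- y (i, j') / y (i, j)) * y (k, j)" by (simp add: z_def kl)
          show ?thesis
          proof (cases "y (k, j) = 0")
            case True
            then show ?thesis using zv p kl ij \<open>l = j' \<and> (k, l) \<in> arc_positions n\<close> by auto
          next
            case False
            have "k \<noteq> i" using zv p ij by auto
            then have "\<rho> k \<noteq> \<rho> i" using inj(1) b True by (auto dest: inj_onD)
            then have "k \<in> L" using top[OF False] True by (auto simp: L_def)
            then show ?thesis using kl True by auto
          qed
        qed
      qed
      show "inj_on w (L \<times> {j'})" using inj(1) by (auto simp: inj_on_def w_def L_def)
    qed (use fin nz in \<open>auto simp: L_def w_def\<close>)
    then show False using min[OF \<open>z \<in> Y\<close>] by simp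
  qed
  obtain M where M: "\<And>p. y p \<noteq> 0 \<Longrightarrow> w p \<le> M"
    using fin finite_nat_set_iff_bounded_le[of "w ` {p. y p \<noteq> 0}"] by auto
  \<comment> \<open>Induction from heavy entries to light ones. A heavier entry in the same row or
    column would be alone there by induction, so \<open>(i, j)\<close> is the largest entry of both
    and may serve as pivot for \<open>rowp\<close> and \<open>colp\<close>.\<close>
  have alone: "(\<forall>l. y (i, l) \<noteq> 0 \<longrightarrow> l = j) \<and> (\<forall>k. y (k, j) \<noteq> 0 \<longrightarrow> k = i)" if "y (i, j) \<noteq> 0" for i j
    using that
  proof (induction "M - w (i, j)" arbitrary: i j rule: less_induct)
    case less
    have r: "\<kappa> l \<le> \<kappa> j" if l: "y (i, l) \<noteq> 0" for l
    proof (rule ccontr)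
      assume "\<not> \<kappa> l \<le> \<kappa> j"
      then have "w (i, j) < w (i, l)" by (simp add: w_def)
      then have "M - w (i, l) < M - w (i, j)" using M[OF l] M[OF less.prems] by linarith
      from less.hyps[OF this l] less.prems have "j = l" by blast
      then show False using \<open>\<not> \<kappa> l \<le> \<kappa> j\<close> by simp
    qed
    have c: "\<rho> k \<le> \<rho> i" if k: "y (k, j) \<noteq> 0" for k
    proof (rule ccontr)
      assume "\<not> \<rho> k \<le> \<rho> i"
      then have "w (i, j) < w (k, j)" by (simp add: w_def)
      then have "M - w (k, j) < M - w (i, j)" using M[OF k] M[OF less.prems] by linarith
      from less.hyps[OF this k] less.prems have "i = k" by blast
      then show False using \<open>\<not> \<rho> k \<le> \<rho> i\<close> by simp
    qed
    have "l = j" if l: "y (i, l) \<noteq> 0" for l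
    proof -
      have "\<not> \<kappa> l < \<kappa> j" using colp[OF less.prems c] l by blast
      then have "\<kappa> l = \<kappa> j" using r[OF l] by simp
      then show ?thesis using inj(2) pos[OF l] pos[OF less.prems] by (auto dest: inj_onD)
    qed
    moreover have "k = i" if k: "y (k, j) \<noteq> 0" for k
    proof -
      have "\<not> \<rho> k < \<rho> i" using rowp[OF less.prems r] k by blast
      then have "\<rho> k = \<rho> i" using c[OF k] by simp
      then show ?thesis using inj(1) pos[OF k] pos[OF less.prems] by (auto dest: inj_onD)
    qed
    ultimately show ?case by blast
  qed
  show thesis by (rule that[OF y]) (use alone in blast)+
qed

section \<open>Set partitions\<close>

text \<open>The definition forbids the shorter of two arcs with a common end. This amounts to each
  point being the left end of at most one arc and the right end of at most one arc.\<close>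

lemma fq_set_partitionI:
  assumes "\<And>i j a. (i, j, a) \<in> \<nu> \<Longrightarrow> i < j \<and> j < n \<and> a \<noteq> 0"
    and "\<And>i j k a b. (i, j, a) \<in> \<nu> \<Longrightarrow> (i, k, b) \<in> \<nu> \<Longrightarrow> j = k \<and> a = b"
    and "\<And>i j k a b. (i, k, a) \<in> \<nu> \<Longrightarrow> (j, k, b) \<in> \<nu> \<Longrightarrow> i = j"
  shows "fq_set_partition n \<nu>"
  unfolding fq_set_partition_def by (safe; metis assms less_irrefl)

lemma fq_arcD:
  assumes "fq_set_partition n \<nu>" "(i, j, a) \<in> \<nu>"
  shows "i < j" "j < n" "a \<noteq> 0"
  using assms unfolding fq_set_partition_def by auto

lemma fq_rowD:
  assumes "fq_set_partition n \<nu>" "(i, j, a) \<in> \<nu>" "(i, k, b) \<in> \<nu>"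
  shows "j = k" "a = b"
proof -
  note D = fq_arcD[OF assms(1)]
  show "j = k"
  proof (cases j k rule: linorder_cases)
    case less
    then show ?thesis using assms D(1)[OF assms(2)] unfolding fq_set_partition_def by blast
  next
    case greater
    then show ?thesis using assms D(1)[OF assms(3)] unfolding fq_set_partition_def by blast
  qed
  then show "a = b" using assms unfolding fq_set_partition_def by blast
qed

lemma fq_colD:
  assumes "fq_set_partition n \<nu>" "(i, k, a) \<in> \<nu>" "(j, k, b) \<in> \<nu>"
  shows "i = j"
proof (cases i j rule: linorder_cases)
  case less
  then show ?thesis using assms fq_arcD(1)[OF assms(1,3)] unfolding fq_set_partition_def by blast
next
  case greater
  then show ?thesis using assms fq_arcD(1)[OF assms(1,2)] unfolding fq_set_partition_def by blast
qed

lemma fq_subset: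
  assumes "fq_set_partition n \<nu>" "\<eta> \<subseteq> \<nu>"
  shows "fq_set_partition n \<eta>"
proof (rule fq_set_partitionI)
  show "i < j \<and> j < n \<and> a \<noteq> 0" if "(i, j, a) \<in> \<eta>" for i j a
    using fq_arcD[OF assms(1)] that assms(2) by blast
  show "j = k \<and> a = b" if "(i, j, a) \<in> \<eta>" "(i, k, b) \<in> \<eta>" for i j k a b
    using fq_rowD[OF assms(1)] that assms(2) by blast
  show "i = j" if "(i, k, a) \<in> \<eta>" "(j, k, b) \<in> \<eta>" for i j k a b
    using fq_colD[OF assms(1)] that assms(2) by blast
qed

lemma fq_set_partition_subset:
  assumes "fq_set_partition n \<nu>"
  shows "\<nu> \<subseteq> {..<n} \<times> {..<n} \<times> UNIV"
proof
  fix p assume "p \<in> \<nu>"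
  then obtain i j a where "p = (i, j, a)" "(i, j, a) \<in> \<nu>" by (cases p) auto
  then show "p \<in> {..<n} \<times> {..<n} \<times> UNIV" using fq_arcD(1,2)[OF assms, of i j a] by simp
qed

lemma finite_fq_set_partition: "fq_set_partition n (\<nu> :: 'a::{field,finite} arc set) \<Longrightarrow> finite \<nu>"
  by (rule finite_subset[OF fq_set_partition_subset]) auto

lemma finite_fq_set_partitions: "finite {\<nu> :: 'a::{field,finite} arc set. fq_set_partition n \<nu>}"
proof (rule finite_subset)
  show "{\<nu> :: 'a arc set. fq_set_partition n \<nu>} \<subseteq> Pow ({..<n} \<times> {..<n} \<times> UNIV)"
    by (rule subsetI, rule PowI, rule fq_set_partition_subset) (rule CollectD)
qed simp

lemma nonnestingD:
  assumes "nonnesting \<nu>" "(i, l, a) \<in> \<nu>" "(j, k, b) \<in> \<nu>" "i < j" "j < k"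
  shows "\<not> k < l"
  using assms(1)[unfolded nonnesting_def not_ex, THEN spec, THEN spec, THEN spec, THEN spec, THEN spec, THEN spec, of i j k l a b]
    assms(2-) by simp

text \<open>Nonnesting excludes containment with both ends different, the partition property
  excludes a common end. So the arcs are an antichain under containment, which is what the
  uniqueness arguments exploit.\<close>

lemma fq_nested_eq:
  assumes fq: "fq_set_partition n \<eta>" and nn: "nonnesting \<eta>"
    and a: "(i, j, a) \<in> \<eta>" and b: "(k, l, b) \<in> \<eta>" and "i \<le> k" "l \<le> j"
  shows "i = k" "j = l" "a = b"
proof -
  have "i = k \<or> j = l"
  proof (rule ccontr)
    assume "\<not> (i = k \<or> j = l)"
    then have "i < k" "l < j" using assms by auto
    then show False using nonnestingD[OF nn a b _ fq_arcD(1)[OF fq b]] by simp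
  qed
  then show *: "i = k" "j = l"
    using fq_rowD(1)[OF fq a, of l b] fq_colD[OF fq a, of k b] b by auto
  show "a = b" by (rule fq_rowD(2)[OF fq a]) (use b * in simp)
qed

text \<open>The coefficient family shared by \<open>x_elt\<close> and \<open>lam\<close>. In a set
  partition at most one arc sits at \<open>p\<close>, so the sum is its label or 0.\<close>

definition coefs :: "'a::field arc set \<Rightarrow> nat \<times> nat \<Rightarrow> 'a" where
  "coefs \<nu> p = (\<Sum>(i, j, a)\<in>\<nu>. if p = (i, j) then a else 0)"

lemma coefs_arc:
  fixes \<nu> :: "'a::{field,finite} arc set"
  assumes "fq_set_partition n \<nu>" "(i, j, a) \<in> \<nu>"
  shows "coefs \<nu> (i, j) = a"
proof -
  have "coefs \<nu> (i, j) = (\<Sum>q\<in>\<nu>. if q = (i, j, a) then a else 0)"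
    unfolding coefs_def
  proof (intro sum.cong refl)
    fix q assume q: "q \<in> \<nu>"
    obtain k l b where qq: "q = (k, l, b)" by (cases q)
    have "k = i \<Longrightarrow> l = j \<Longrightarrow> b = a" using fq_rowD(2)[OF assms, of l b] q qq by simp
    then show "(case q of (i', j', a) \<Rightarrow> if (i, j) = (i', j') then a else 0) = (if q = (i, j, a) then a else 0)"
      by (auto simp: qq)
  qed
  then show ?thesis using assms finite_fq_set_partition[OF assms(1)] by simp
qed

lemma coefs_nonzero:
  assumes "coefs \<nu> (i, j) \<noteq> 0" shows "\<exists>a. (i, j, a) \<in> \<nu>"
proof (rule ccontr)
  assume "\<not> ?thesis"
  then have "coefs \<nu> (i, j) = 0" unfolding coefs_def by (intro sum.neutral) auto
  then show False using assms by simp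
qed

lemma coefs_strict_upper:
  assumes "fq_set_partition n \<nu>"
  shows "coefs \<nu> \<in> strict_upper n"
proof -
  have "(i, j) \<in> arc_positions n" if nz: "coefs \<nu> (i, j) \<noteq> 0" for i j
    using coefs_nonzero[OF nz] fq_arcD[OF assms] by auto
  then show ?thesis unfolding strict_upper_def by fast
qed

lemma coefs_sum:
  fixes \<nu> :: "'a::{field,finite} arc set"
  assumes "fq_set_partition n \<nu>"
  shows "(\<Sum>(i, j, a)\<in>\<nu>. a * g (i, j)) = (\<Sum>p\<in>arc_positions n. coefs \<nu> p * g p)"
proof -
  have "(\<Sum>p\<in>arc_positions n. coefs \<nu> p * g p) = (\<Sum>p\<in>arc_positions n. \<Sum>q\<in>\<nu>. if p = (fst q, fst (snd q)) then snd (snd q) * g p else 0)"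
    unfolding coefs_def sum_distrib_right by (intro sum.cong refl) (auto split: if_splits)
  also have "\<dots> = (\<Sum>q\<in>\<nu>. \<Sum>p\<in>arc_positions n. if p = (fst q, fst (snd q)) then snd (snd q) * g p else 0)"
    by (rule sum.swap)
  also have "\<dots> = (\<Sum>(i, j, a)\<in>\<nu>. a * g (i, j))"
  proof (intro sum.cong refl)
    fix q assume q: "q \<in> \<nu>"
    obtain i j a where qq: "q = (i, j, a)" by (cases q)
    then have "(i, j) \<in> arc_positions n" using q fq_arcD[OF assms, of i j a] by simp
    then show "(\<Sum>p\<in>arc_positions n. if p = (fst q, fst (snd q)) then snd (snd q) * g p else 0) = (case q of (i, j, a) \<Rightarrow> a * g (i, j))"
      by (simp add: qq)
  qed
  finally show ?thesis ..
qed

lemma coefs_exists: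
  assumes y: "y \<in> strict_upper n" and r: "\<And>i j k. y (i, j) \<noteq> 0 \<Longrightarrow> y (i, k) \<noteq> 0 \<Longrightarrow> j = k"
    and c: "\<And>i j k. y (i, k) \<noteq> 0 \<Longrightarrow> y (j, k) \<noteq> 0 \<Longrightarrow> i = j"
  obtains \<nu> :: "'a::{field,finite} arc set" where "fq_set_partition n \<nu>" "coefs \<nu> = y"
proof -
  define \<nu> where "\<nu> = {(i, j, a). y (i, j) = a \<and> a \<noteq> 0}"
  have fq: "fq_set_partition n \<nu>"
  proof (rule fq_set_partitionI)
    show "i < j \<and> j < n \<and> a \<noteq> 0" if "(i, j, a) \<in> \<nu>" for i j a
      using that y by (force simp: \<nu>_def strict_upper_def)
  qed (use r c in \<open>auto simp: \<nu>_def\<close>)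
  have "coefs \<nu> (i, j) = y (i, j)" for i j
  proof (cases "y (i, j) = 0")
    case True
    then show ?thesis using coefs_nonzero[of \<nu> i j] by (auto simp: \<nu>_def)
  next
    case False
    then show ?thesis using coefs_arc[OF fq] by (simp add: \<nu>_def)
  qed
  then have "coefs \<nu> = y" by auto
  with fq show thesis by (rule that)
qed

text \<open>Pass to a strictly nested arc as long as there is one; lengths decrease.\<close>

lemma sml_refine:
  assumes fq: "fq_set_partition n \<nu>" and "(i, j, a) \<in> \<nu>"
  shows "\<exists>(k, l, b)\<in>sml \<nu>. i \<le> k \<and> l \<le> j"
  using assms(2)
proof (induction "j - i" arbitrary: i j a rule: less_induct)
  case less
  show ?case
  proof (cases "(i, j, a) \<in> sml \<nu>")
    case False
    then obtain k l b where k: "(k, l, b) \<in> \<nu>" "i < k" "k < l" "l < j" using less.prems by (auto simp: sml_def)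
    then have "l - k < j - i" by linarith
    from less.hyps[OF this k(1)] obtain k' l' b' where "(k', l', b') \<in> sml \<nu>" "k \<le> k'" "l' \<le> l" by blast
    then show ?thesis using k by (intro bexI[of _ "(k', l', b')"]) auto
  qed auto
qed

text \<open>Pass to a strictly surrounding arc as long as there is one; lengths increase but stay
  below \<open>n\<close>.\<close>

lemma big_refine:
  assumes fq: "fq_set_partition n \<nu>" and "(i, j, a) \<in> \<nu>"
  shows "\<exists>(k, l, b)\<in>big \<nu>. k \<le> i \<and> j \<le> l"
  using assms(2)
proof (induction "n - (j - i)" arbitrary: i j a rule: less_induct)
  case less
  show ?case
  proof (cases "(i, j, a) \<in> big \<nu>")
    case False
    then obtain k l b where k: "(k, l, b) \<in> \<nu>" "k < i" "i < j" "j < l" using less.prems by (auto simp: big_def)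
    then have "n - (l - k) < n - (j - i)" using fq_arcD[OF fq k(1)] by linarith
    from less.hyps[OF this k(1)] obtain k' l' b' where "(k', l', b') \<in> big \<nu>" "k' \<le> k" "l \<le> l'" by blast
    then show ?thesis using k by (intro bexI[of _ "(k', l', b')"]) auto
  qed auto
qed

lemma sml_subset: "sml \<nu> \<subseteq> \<nu>" and big_subset: "big \<nu> \<subseteq> \<nu>"
  by (auto simp: sml_def big_def)

lemma mem_sml_iff: "(i, j, a) \<in> sml \<nu> \<longleftrightarrow>
    (i, j, a) \<in> \<nu> \<and> (\<forall>k l b. (k, l, b) \<in> \<nu> \<longrightarrow> i < k \<longrightarrow> k < l \<longrightarrow> \<not> l < j)"
  by (auto simp: sml_def)

lemma mem_big_iff: "(i, j, a) \<in> big \<nu> \<longleftrightarrow>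
    (i, j, a) \<in> \<nu> \<and> (\<forall>k l b. (k, l, b) \<in> \<nu> \<longrightarrow> k < i \<longrightarrow> i < j \<longrightarrow> \<not> j < l)"
  by (auto simp: big_def)

lemma nonnestingI:
  assumes "\<And>i j k l a b. (i, l, a) \<in> \<nu> \<Longrightarrow> (j, k, b) \<in> \<nu> \<Longrightarrow> i < j \<Longrightarrow> j < k \<Longrightarrow> \<not> k < l"
  shows "nonnesting \<nu>"
  unfolding nonnesting_def
proof (intro notI, elim exE conjE)
  fix i j k l a b
  assume "i < j" "j < k" "k < l" "(i, l, a) \<in> \<nu>" "(j, k, b) \<in> \<nu>"
  then show False using assms[of i l a j k b] by simp
qed

lemma nonnesting_sml: "nonnesting (sml \<nu>)"
proof (rule nonnestingI)
  fix i j k l a b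
  assume 1: "(i, l, a) \<in> sml \<nu>" and 2: "(j, k, b) \<in> sml \<nu>" and 3: "i < j" "j < k"
  show "\<not> k < l" using 1[unfolded mem_sml_iff, THEN conjunct2, rule_format, of j k b] 2 3 sml_subset by blast
qed

lemma nonnesting_big: "nonnesting (big \<nu>)"
proof (rule nonnestingI)
  fix i j k l a b
  assume 1: "(i, l, a) \<in> big \<nu>" and 2: "(j, k, b) \<in> big \<nu>" and 3: "i < j" "j < k"
  show "\<not> k < l" using 2[unfolded mem_big_iff, THEN conjunct2, rule_format, of i l a] 1 3 big_subset by blast
qed

lemma sml_nonnesting:
  assumes "nonnesting \<nu>"
  shows "sml \<nu> = \<nu>"
proof
  show "\<nu> \<subseteq> sml \<nu>"
  proof
    fix p assume p: "p \<in> \<nu>"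
    obtain i j a where ij: "p = (i, j, a)" by (cases p)
    have "\<not> l < j" if "(k, l, b) \<in> \<nu>" "i < k" "k < l" for k l b
      by (rule nonnestingD[OF assms p[unfolded ij] that])
    then show "p \<in> sml \<nu>" using p unfolding ij mem_sml_iff by simp
  qed
qed (rule sml_subset)

text \<open>Minimality excludes an arc with both ends strictly inside, the partition property one
  with a common end. This is the vanishing condition under which an entry survives in
  \<open>sandwich_eq\<close>.\<close>

lemma sml_inner:
  assumes fq: "fq_set_partition n \<nu>" and a: "(i, j, a) \<in> sml \<nu>" and b: "(k, l, b) \<in> \<nu>" and "i \<le> k" "l \<le> j"
  shows "(k, l) = (i, j)"
proof -
  have a': "(i, j, a) \<in> \<nu>" using a sml_subset by blast
  have "i = k \<or> j = l" using a b assms(4,5) fq_arcD(1)[OF fq b] by (fastforce simp: sml_def)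
  then show ?thesis using fq_rowD[OF fq a'] fq_colD[OF fq a'] b by blast
qed

text \<open>An arc of \<open>\<nu>'\<close> lies below an arc of \<open>\<nu>\<close> with the same left end, which lies below an arc of \<open>\<nu>'\<close>
  with the same right end as the latter; induction from the long arcs downwards shows that neither step
  is proper.\<close>

lemma fq_set_partition_eqI:
  assumes fq: "fq_set_partition n \<nu>" and fq': "fq_set_partition n \<nu>'"
    and 1: "\<And>r c a. (r, c, a) \<in> \<nu>' \<Longrightarrow> \<Phi> r c = a"
    and 2: "\<And>r c a. (r, c, a) \<in> \<nu> \<Longrightarrow> \<Phi> r c = a"
    and 3: "\<And>r c. r < c \<Longrightarrow> c < n \<Longrightarrow> \<Phi> r c \<noteq> 0 \<Longrightarrow> \<exists>i a. i \<le> r \<and> (i, c, a) \<in> \<nu>'"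
    and 4: "\<And>r c. r < c \<Longrightarrow> c < n \<Longrightarrow> \<Phi> r c \<noteq> 0 \<Longrightarrow> \<exists>j a. c \<le> j \<and> (r, j, a) \<in> \<nu>"
  shows "\<nu>' = \<nu>"
proof -
  have sub: "(r, c, a) \<in> \<nu>" if "(r, c, a) \<in> \<nu>'" for r c a
    using that
  proof (induction "n - (c - r)" arbitrary: r c a rule: less_induct)
    case less
    note rc = fq_arcD[OF fq' less.prems]
    obtain j b where j: "c \<le> j" "(r, j, b) \<in> \<nu>" using 4[of r c] rc 1[OF less.prems] by auto
    obtain i d where i: "i \<le> r" "(i, j, d) \<in> \<nu>'" using 3[of r j] 2[OF j(2)] fq_arcD[OF fq j(2)] by auto
    show ?case
    proof (cases "(i, j) = (r, c)")
      case True
      then show ?thesis using 1[OF less.prems] 2[OF j(2)] j by auto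
    next
      case False
      then have "n - (j - i) < n - (c - r)" using i j fq_arcD[OF fq' i(2)] rc by auto
      from less.hyps[OF this i(2)] have "i = r" using fq_colD[OF fq _ j(2)] by blast
      then show ?thesis using fq_rowD(1)[OF fq' less.prems] i False by blast
    qed
  qed
  moreover have "(r, c, a) \<in> \<nu>'" if rc: "(r, c, a) \<in> \<nu>" for r c a
  proof -
    obtain i b where i: "(i, c, b) \<in> \<nu>'" using 3[of r c] 2[OF rc] fq_arcD[OF fq rc] by auto
    have "i = r" by (rule fq_colD[OF fq sub[OF i] rc])
    then show ?thesis using i sub[OF i] fq_rowD(2)[OF fq rc] by blast
  qed
  ultimately show ?thesis by auto
qed

section \<open>Two-sided orbits\<close>

definition transvection :: "nat \<Rightarrow> nat \<Rightarrow> nat \<Rightarrow> 'a::field \<Rightarrow> 'a mat" where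
  "transvection n i j t = mat n n (\<lambda>(r, c). if r = c then 1 else if r = i \<and> c = j then t else 0)"

lemma transvection_index:
  "r < n \<Longrightarrow> c < n \<Longrightarrow> transvection n i j t $$ (r, c) = (if r = c then 1 else if r = i \<and> c = j then t else 0)"
  by (simp add: transvection_def)

lemma transvection_UT: "i < j \<Longrightarrow> transvection n i j t \<in> carrier (UT n)"
  by (auto simp: UT_carrier_iff transvection_def)

lemma transvection_mult_left:
  assumes x: "x \<in> carrier_mat n n" and "i < n" "j < n" "i \<noteq> j" and rc: "r < n" "c < n"
  shows "(transvection n i j t * x) $$ (r, c) = x $$ (r, c) + (if r = i then t * x $$ (j, c) else 0)"
proof -
  have "(transvection n i j t * x) $$ (r, c) = (\<Sum>l<n. transvection n i j t $$ (r, l) * x $$ (l, c))"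
    by (rule index_mult_mat_sum[OF _ x rc]) (simp add: transvection_def)
  also have "\<dots> = (\<Sum>l<n. (if l = r then x $$ (l, c) else 0) + (if l = j then if r = i then t * x $$ (j, c) else 0 else 0))"
    using assms by (intro sum.cong refl) (auto simp: transvection_index)
  also have "\<dots> = x $$ (r, c) + (if r = i then t * x $$ (j, c) else 0)"
    unfolding sum.distrib using assms by simp
  finally show ?thesis .
qed

lemma transvection_mult_right:
  assumes x: "x \<in> carrier_mat n n" and "i < n" "j < n" "i \<noteq> j" and rc: "r < n" "c < n"
  shows "(x * transvection n i j t) $$ (r, c) = x $$ (r, c) + (if c = j then t * x $$ (r, i) else 0)"
proof -
  have "(x * transvection n i j t) $$ (r, c) = (\<Sum>l<n. x $$ (r, l) * transvection n i j t $$ (l, c))"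
    by (rule index_mult_mat_sum[OF x _ rc]) (simp add: transvection_def)
  also have "\<dots> = (\<Sum>l<n. (if l = c then x $$ (r, l) else 0) + (if l = i then if c = j then t * x $$ (r, i) else 0 else 0))"
    using assms by (intro sum.cong refl) (auto simp: transvection_index)
  also have "\<dots> = x $$ (r, c) + (if c = j then t * x $$ (r, i) else 0)"
    unfolding sum.distrib using assms by simp
  finally show ?thesis .
qed

lemma two_sided_orbit_mult:
  assumes x: "x \<in> carrier_mat n n" and y: "y \<in> two_sided_orbit n x" and u: "u \<in> carrier (UT n)" and v: "v \<in> carrier (UT n)"
  shows "u * y * v \<in> two_sided_orbit n x"
proof -
  obtain g h where gh: "y = g * x * h" "g \<in> carrier (UT n)" "h \<in> carrier (UT n)"
    using y by (auto simp: two_sided_orbit_def)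
  note c = UT_carrier_mat[OF u] UT_carrier_mat[OF v] UT_carrier_mat[OF gh(2)] UT_carrier_mat[OF gh(3)] x mult_carrier_mat[of _ n n _ n]
  have "u * y * v = (u * g) * x * (h * v)"
    unfolding gh(1) using c by (simp add: assoc_mult_mat[of _ n n _ n _ n])
  then show ?thesis using UT_mult_closed[OF u gh(2)] UT_mult_closed[OF gh(3) v]
    unfolding two_sided_orbit_def by blast
qed

lemma two_sided_orbit_refl:
  assumes "x \<in> carrier_mat n n" shows "x \<in> two_sided_orbit n x"
proof -
  have "x = 1\<^sub>m n * x * 1\<^sub>m n" using assms by simp
  then show ?thesis using one_UT[of n] unfolding two_sided_orbit_def by blast
qed

lemma two_sided_orbit_sym:
  fixes x :: "'a::{field,finite} mat"
  assumes x: "x \<in> carrier_mat n n" and y: "y \<in> two_sided_orbit n x"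
  shows "x \<in> two_sided_orbit n y"
proof -
  obtain g h where gh: "y = g * x * h" "g \<in> carrier (UT n)" "h \<in> carrier (UT n)"
    using y by (auto simp: two_sided_orbit_def)
  note g = UT_inv[OF gh(2)] and h = UT_inv[OF gh(3)]
  note c = UT_carrier_mat[OF gh(2)] UT_carrier_mat[OF gh(3)] UT_carrier_mat[OF g(1)] UT_carrier_mat[OF h(1)] x mult_carrier_mat[of _ n n _ n]
  have "inv\<^bsub>UT n\<^esub> g * y * inv\<^bsub>UT n\<^esub> h = (inv\<^bsub>UT n\<^esub> g * g) * (x * (h * inv\<^bsub>UT n\<^esub> h))"
    unfolding gh(1) using c by (simp add: assoc_mult_mat[of _ n n _ n _ n])
  also have "\<dots> = x" using g(2) h(3) x by simp
  finally have "x = inv\<^bsub>UT n\<^esub> g * y * inv\<^bsub>UT n\<^esub> h" by simp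
  then show ?thesis using g(1) h(1) unfolding two_sided_orbit_def by blast
qed

lemma x_elt_coefs: "x_elt n \<nu> = mat n n (coefs \<nu>)"
proof (rule eq_matI)
  fix r c assume "r < dim_row (mat n n (coefs \<nu>))" "c < dim_col (mat n n (coefs \<nu>))"
  then show "x_elt n \<nu> $$ (r, c) = mat n n (coefs \<nu>) $$ (r, c)"
    by (auto simp: x_elt_def coefs_def intro!: sum.cong)
qed (auto simp: x_elt_def)

lemma strict_upper_zero: "y \<in> strict_upper n \<Longrightarrow> \<not> (i < j \<and> j < n) \<Longrightarrow> y (i, j) = 0"
  by (simp add: strict_upper_def)

lemma x_elt_ut: "fq_set_partition n \<nu> \<Longrightarrow> x_elt n \<nu> \<in> ut n"
  by (auto simp: ut_def x_elt_coefs intro!: strict_upper_zero[OF coefs_strict_upper])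

text \<open>Transvections realise the operations of \<open>elimination\<close>: rows are added to
  higher rows, columns to columns further right. Truncation loses nothing here, since the entries it
  would discard are zero anyway.\<close>

lemma two_sided_orbit_x_elt_exists:
  fixes x :: "'a::{field,finite} mat"
  assumes x: "x \<in> ut n"
  obtains \<nu> where "fq_set_partition n \<nu>" "x \<in> two_sided_orbit n (x_elt n \<nu>)"
proof -
  note xc = ut_carrier_mat[OF x]
  define Y where "Y = {y \<in> strict_upper n. mat n n y \<in> two_sided_orbit n x}"
  define y0 where "y0 p = (if p \<in> arc_positions n then x $$ p else 0)" for p
  have "mat n n y0 = x" by (rule eq_matI) (use x ut_zero[OF x] xc in \<open>auto simp: y0_def\<close>)
  then have "y0 \<in> Y" using two_sided_orbit_refl[OF xc] by (simp add: Y_def strict_upper_def y0_def)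
  obtain y where y: "y \<in> Y" "\<And>i j k. y (i, j) \<noteq> 0 \<Longrightarrow> y (i, k) \<noteq> 0 \<Longrightarrow> j = k"
    "\<And>i j k. y (i, k) \<noteq> 0 \<Longrightarrow> y (j, k) \<noteq> 0 \<Longrightarrow> i = j"
  proof (rule elimination[of Y n "\<lambda>k. k" "\<lambda>l. n - l"])
    show "Y \<noteq> {}" using \<open>y0 \<in> Y\<close> by blast
    show "Y \<subseteq> strict_upper n" by (auto simp: Y_def)
    show "inj_on (\<lambda>l. n - l) {..<n}" by (auto simp: inj_on_def)
    fix y i i' t assume y: "y \<in> Y" and i: "i < n" "i' < n" "i' < i"
    let ?y = "\<lambda>(k, l). if k = i' \<and> (k, l) \<in> arc_positions n then y (k, l) + t * y (i, l) else y (k, l)"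
    have su: "y \<in> strict_upper n" and yo: "mat n n y \<in> two_sided_orbit n x" using y by (auto simp: Y_def)
    have "mat n n ?y = transvection n i' i t * mat n n y * 1\<^sub>m n"
    proof (rule eq_matI)
      fix r c assume "r < dim_row (transvection n i' i t * mat n n y * 1\<^sub>m n)" "c < dim_col (transvection n i' i t * mat n n y * 1\<^sub>m n)"
      then have rc: "r < n" "c < n" by (auto simp: transvection_def)
      have "transvection n i' i t * mat n n y * 1\<^sub>m n = transvection n i' i t * mat n n y"
        by (simp add: transvection_def)
      then have "(transvection n i' i t * mat n n y * 1\<^sub>m n) $$ (r, c) = y (r, c) + (if r = i' then t * y (i, c) else 0)"
        using transvection_mult_left[of "mat n n y" n i' i r c t] rc i by simp
      also have "\<dots> = ?y (r, c)" using strict_upper_zero[OF su] rc i by auto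
      finally show "mat n n ?y $$ (r, c) = (transvection n i' i t * mat n n y * 1\<^sub>m n) $$ (r, c)"
        using rc by simp
    qed (auto simp: transvection_def)
    then have "mat n n ?y \<in> two_sided_orbit n x"
      using two_sided_orbit_mult[OF xc yo transvection_UT[OF i(3)] one_UT] by simp
    moreover have "?y \<in> strict_upper n" using su by (auto simp: strict_upper_def)
    ultimately show "?y \<in> Y" by (simp add: Y_def)
  next
    fix y j j' t assume y: "y \<in> Y" and j: "j < n" "j' < n" "n - j' < n - j"
    let ?y = "\<lambda>(k, l). if l = j' \<and> (k, l) \<in> arc_positions n then y (k, l) + t * y (k, j) else y (k, l)"
    have jj: "j < j'" using j by linarith
    have su: "y \<in> strict_upper n" and yo: "mat n n y \<in> two_sided_orbit n x" using y by (auto simp: Y_def)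
    have "mat n n ?y = 1\<^sub>m n * mat n n y * transvection n j j' t"
    proof (rule eq_matI)
      fix r c assume "r < dim_row (1\<^sub>m n * mat n n y * transvection n j j' t)" "c < dim_col (1\<^sub>m n * mat n n y * transvection n j j' t)"
      then have rc: "r < n" "c < n" by (auto simp: transvection_def)
      have "(1\<^sub>m n * mat n n y * transvection n j j' t) $$ (r, c) = y (r, c) + (if c = j' then t * y (r, j) else 0)"
        using transvection_mult_right[of "mat n n y" n j j' r c t] rc j jj by simp
      also have "\<dots> = ?y (r, c)" using strict_upper_zero[OF su] rc j jj by auto
      finally show "mat n n ?y $$ (r, c) = (1\<^sub>m n * mat n n y * transvection n j j' t) $$ (r, c)"
        using rc by simp
    qed (auto simp: transvection_def)
    then have "mat n n ?y \<in> two_sided_orbit n x"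
      using two_sided_orbit_mult[OF xc yo one_UT transvection_UT[OF jj]] by simp
    moreover have "?y \<in> strict_upper n" using su by (auto simp: strict_upper_def)
    ultimately show "?y \<in> Y" by (simp add: Y_def)
  qed auto
  have "y \<in> strict_upper n" using y(1) by (simp add: Y_def)
  then obtain \<nu> where nu: "fq_set_partition n \<nu>" "coefs \<nu> = y" using coefs_exists y(2,3) by metis
  have "x_elt n \<nu> \<in> two_sided_orbit n x" using y(1) nu(2) by (simp add: Y_def x_elt_coefs)
  then show thesis using that[OF nu(1)] two_sided_orbit_sym[OF xc] by blast
qed

section \<open>Functionals and their orbits\<close>

definition lin :: "nat \<Rightarrow> (nat \<times> nat \<Rightarrow> 'a::field) \<Rightarrow> 'a mat \<Rightarrow> 'a" where
  "lin n y x = (\<Sum>p\<in>arc_positions n. y p * x $$ p)"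

definition functional :: "nat \<Rightarrow> (nat \<times> nat \<Rightarrow> 'a::field) \<Rightarrow> 'a mat \<Rightarrow> 'a" where
  "functional n y = (\<lambda>x\<in>ut n. lin n y x)"

text \<open>The coefficients of \<open>x \<mapsto> lin n y (u * x * v)\<close>.\<close>

definition coadjoint :: "nat \<Rightarrow> 'a::field mat \<Rightarrow> 'a mat \<Rightarrow> (nat \<times> nat \<Rightarrow> 'a) \<Rightarrow> nat \<times> nat \<Rightarrow> 'a" where
  "coadjoint n u v y p = (if p \<in> arc_positions n
     then \<Sum>q\<in>arc_positions n. y q * (u $$ (fst q, fst p) * v $$ (snd p, snd q)) else 0)"

lemma coadjoint_strict_upper: "coadjoint n u v y \<in> strict_upper n"
  by (simp add: strict_upper_def coadjoint_def)

lemma lam_functional: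
  "fq_set_partition n (\<nu> :: 'a::{field,finite} arc set) \<Longrightarrow> lam n \<nu> = functional n (coefs \<nu>)"
  unfolding lam_def functional_def lin_def by (intro restrict_ext) (rule coefs_sum)

lemma lin_inj:
  assumes y: "y \<in> strict_upper n" "y' \<in> strict_upper n" and eq: "\<And>x. x \<in> ut n \<Longrightarrow> lin n y x = lin n y' x"
  shows "y = y'"
proof
  fix p
  show "y p = y' p"
  proof (cases "p \<in> arc_positions n")
    case True
    define e where "e = mat n n (\<lambda>q. if q = p then 1 else 0 :: 'a)"
    have "e \<in> ut n" using True by (auto simp: e_def ut_def)
    moreover have "lin n z e = z p" for z :: "nat \<times> nat \<Rightarrow> 'a"
    proof -
      have "lin n z e = (\<Sum>q\<in>arc_positions n. if q = p then z q else 0)"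
        unfolding lin_def e_def by (intro sum.cong refl) auto
      then show ?thesis using True by simp
    qed
    ultimately show ?thesis using eq by metis
  next
    case False
    then have "y p = 0" "y' p = 0" using y unfolding strict_upper_def by blast+
    then show ?thesis by simp
  qed
qed

lemma functional_inj: "inj_on (functional n) (strict_upper n)"
proof (rule inj_onI)
  fix y y' :: "nat \<times> nat \<Rightarrow> 'a" assume y: "y \<in> strict_upper n" "y' \<in> strict_upper n" and eq: "functional n y = functional n y'"
  have "lin n y x = lin n y' x" if "x \<in> ut n" for x using fun_cong[OF eq, of x] that by (simp add: functional_def)
  then show "y = y'" by (rule lin_inj[OF y])
qed

lemma sandwich_arc_positions:
  assumes u: "u \<in> carrier (UT n)" and x: "x \<in> ut n" and v: "v \<in> carrier (UT n)" and rc: "r < n" "c < n"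
  shows "(u * x * v) $$ (r, c) = (\<Sum>p\<in>arc_positions n. u $$ (r, fst p) * x $$ p * v $$ (snd p, c))"
proof -
  have "(u * x * v) $$ (r, c) = (\<Sum>p\<in>{..<n} \<times> {..<n}. u $$ (r, fst p) * x $$ p * v $$ (snd p, c))"
    unfolding sandwich_index[OF UT_carrier_mat[OF u] ut_carrier_mat[OF x] UT_carrier_mat[OF v] rc] sum.cartesian_product
    by (intro sum.cong) auto
  also have "\<dots> = (\<Sum>p\<in>arc_positions n. u $$ (r, fst p) * x $$ p * v $$ (snd p, c))"
    by (rule sum.mono_neutral_right) (use ut_zero[OF x] in \<open>auto simp: not_less\<close>)
  finally show ?thesis .
qed

lemma lin_coadjoint:
  assumes u: "u \<in> carrier (UT n)" and x: "x \<in> ut n" and v: "v \<in> carrier (UT n)"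
  shows "lin n y (u * x * v) = lin n (coadjoint n u v y) x"
proof -
  have "lin n y (u * x * v) = (\<Sum>q\<in>arc_positions n. \<Sum>p\<in>arc_positions n. y q * (u $$ (fst q, fst p) * v $$ (snd p, snd q)) * x $$ p)"
    unfolding lin_def
  proof (intro sum.cong refl)
    fix q assume q: "q \<in> arc_positions n"
    obtain r c where rc: "q = (r, c)" by (cases q)
    show "y q * (u * x * v) $$ q = (\<Sum>p\<in>arc_positions n. y q * (u $$ (fst q, fst p) * v $$ (snd p, snd q)) * x $$ p)"
      using q sandwich_arc_positions[OF u x v, of r c] unfolding rc
      by (simp add: sum_distrib_left mult_ac del: index_mult_mat)
  qed
  also have "\<dots> = (\<Sum>p\<in>arc_positions n. \<Sum>q\<in>arc_positions n. y q * (u $$ (fst q, fst p) * v $$ (snd p, snd q)) * x $$ p)"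
    by (rule sum.swap)
  also have "\<dots> = lin n (coadjoint n u v y) x"
    unfolding lin_def by (intro sum.cong refl) (simp add: coadjoint_def sum_distrib_right)
  finally show ?thesis .
qed

text \<open>Inversion permutes the group, so the inverses in the two actions disappear when the
  whole orbit is formed.\<close>

lemma dual_orbit_eq:
  fixes \<mu> :: "'a::{field,finite} mat \<Rightarrow> 'a"
  shows "dual_orbit n \<mu> = {\<lambda>x\<in>ut n. \<mu> (u * x * v) | u v. u \<in> carrier (UT n) \<and> v \<in> carrier (UT n)}"
proof -
  have act: "right_act n (left_act n g \<mu>) h = (\<lambda>x\<in>ut n. \<mu> (inv\<^bsub>UT n\<^esub> g * x * inv\<^bsub>UT n\<^esub> h))"
    if gh: "g \<in> carrier (UT n)" "h \<in> carrier (UT n)" for g h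
    unfolding right_act_def left_act_def
  proof (rule restrict_ext)
    fix x :: "'a mat" assume x: "x \<in> ut n"
    note g = UT_inv(1)[OF gh(1)] and h = UT_inv(1)[OF gh(2)]
    have "x * inv\<^bsub>UT n\<^esub> h \<in> ut n" using sandwich_ut[OF one_UT x h] ut_carrier_mat[OF x] by simp
    then show "(\<lambda>x\<in>ut n. \<mu> (inv\<^bsub>UT n\<^esub> g * x)) (x * inv\<^bsub>UT n\<^esub> h) = \<mu> (inv\<^bsub>UT n\<^esub> g * x * inv\<^bsub>UT n\<^esub> h)"
      using assoc_mult_mat[OF UT_carrier_mat[OF g] ut_carrier_mat[OF x] UT_carrier_mat[OF h]] by simp
  qed
  show ?thesis
  proof (intro equalityI subsetI)
    fix \<psi> assume "\<psi> \<in> dual_orbit n \<mu>"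
    then obtain g h where gh: "g \<in> carrier (UT n)" "h \<in> carrier (UT n)" "\<psi> = right_act n (left_act n g \<mu>) h"
      by (auto simp: dual_orbit_def)
    then show "\<psi> \<in> {\<lambda>x\<in>ut n. \<mu> (u * x * v) | u v. u \<in> carrier (UT n) \<and> v \<in> carrier (UT n)}"
      using act[OF gh(1,2)] UT_inv(1)[OF gh(1)] UT_inv(1)[OF gh(2)] by blast
  next
    fix \<psi> assume "\<psi> \<in> {\<lambda>x\<in>ut n. \<mu> (u * x * v) | u v. u \<in> carrier (UT n) \<and> v \<in> carrier (UT n)}"
    then obtain u v where uv: "u \<in> carrier (UT n)" "v \<in> carrier (UT n)" "\<psi> = (\<lambda>x\<in>ut n. \<mu> (u * x * v))" by blast
    note i = UT_inv(1)[OF uv(1)] UT_inv(1)[OF uv(2)]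
    have "\<psi> = right_act n (left_act n (inv\<^bsub>UT n\<^esub> u) \<mu>) (inv\<^bsub>UT n\<^esub> v)"
      unfolding act[OF i] group.inv_inv[OF group_UT uv(1)] group.inv_inv[OF group_UT uv(2)] by (rule uv(3))
    then show "\<psi> \<in> dual_orbit n \<mu>" using i unfolding dual_orbit_def by blast
  qed
qed

lemma functional_sandwich:
  fixes u v :: "'a::field mat"
  assumes "u \<in> carrier (UT n)" "v \<in> carrier (UT n)"
  shows "(\<lambda>x\<in>ut n. functional n y (u * x * v)) = functional n (coadjoint n u v y)"
  unfolding functional_def[of n "coadjoint n u v y"]
proof (rule restrict_ext)
  fix x :: "'a mat" assume x: "x \<in> ut n"
  show "functional n y (u * x * v) = lin n (coadjoint n u v y) x"
    using sandwich_ut[OF assms(1) x assms(2)] lin_coadjoint[OF assms(1) x assms(2)] by (simp add: functional_def)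
qed

lemma dual_orbit_functional:
  fixes y :: "nat \<times> nat \<Rightarrow> 'a::{field,finite}"
  shows "dual_orbit n (functional n y) = {functional n (coadjoint n u v y) | u v. u \<in> carrier (UT n) \<and> v \<in> carrier (UT n)}"
  unfolding dual_orbit_eq
proof (rule Collect_cong)
  fix \<psi>
  have "\<psi> = (\<lambda>x\<in>ut n. functional n y (u * x * v)) \<and> u \<in> carrier (UT n) \<and> v \<in> carrier (UT n) \<longleftrightarrow>
    \<psi> = functional n (coadjoint n u v y) \<and> u \<in> carrier (UT n) \<and> v \<in> carrier (UT n)" for u v
    using functional_sandwich[of u n v y] by auto
  then show "(\<exists>u v. \<psi> = (\<lambda>x\<in>ut n. functional n y (u * x * v)) \<and> u \<in> carrier (UT n) \<and> v \<in> carrier (UT n)) \<longleftrightarrow>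
    (\<exists>u v. \<psi> = functional n (coadjoint n u v y) \<and> u \<in> carrier (UT n) \<and> v \<in> carrier (UT n))"
    by presburger
qed

lemma dual_orbit_mult:
  fixes \<mu> :: "'a::{field,finite} mat \<Rightarrow> 'a"
  assumes "\<psi> \<in> dual_orbit n \<mu>" "u \<in> carrier (UT n)" "v \<in> carrier (UT n)"
  shows "(\<lambda>x\<in>ut n. \<psi> (u * x * v)) \<in> dual_orbit n \<mu>"
proof -
  obtain g h where gh: "g \<in> carrier (UT n)" "h \<in> carrier (UT n)" "\<psi> = (\<lambda>x\<in>ut n. \<mu> (g * x * h))"
    using assms(1) unfolding dual_orbit_eq by blast
  have "(\<lambda>x\<in>ut n. \<psi> (u * x * v)) = (\<lambda>x\<in>ut n. \<mu> ((g * u) * x * (v * h)))"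
  proof (rule restrict_ext)
    fix x :: "'a mat" assume x: "x \<in> ut n"
    note c = UT_carrier_mat[OF gh(1)] UT_carrier_mat[OF gh(2)] UT_carrier_mat[OF assms(2)] UT_carrier_mat[OF assms(3)]
      ut_carrier_mat[OF x] mult_carrier_mat[of _ n n _ n]
    have "g * (u * x * v) * h = (g * u) * x * (v * h)" using c by (simp add: assoc_mult_mat[of _ n n _ n _ n])
    then show "\<psi> (u * x * v) = \<mu> ((g * u) * x * (v * h))"
      using sandwich_ut[OF assms(2) x assms(3)] by (simp add: gh(3))
  qed
  then show ?thesis unfolding dual_orbit_eq
    using UT_mult_closed[OF gh(1) assms(2)] UT_mult_closed[OF assms(3) gh(2)] by blast
qed

lemma dual_orbit_sym:
  fixes \<mu> :: "'a::{field,finite} mat \<Rightarrow> 'a"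
  assumes "\<psi> \<in> dual_orbit n \<mu>" "\<mu> \<in> extensional (ut n)"
  shows "\<mu> \<in> dual_orbit n \<psi>"
proof -
  obtain g h where gh: "g \<in> carrier (UT n)" "h \<in> carrier (UT n)" "\<psi> = (\<lambda>x\<in>ut n. \<mu> (g * x * h))"
    using assms(1) unfolding dual_orbit_eq by blast
  note g = UT_inv[OF gh(1)] and h = UT_inv[OF gh(2)]
  have "\<mu> = (\<lambda>x\<in>ut n. \<psi> (inv\<^bsub>UT n\<^esub> g * x * inv\<^bsub>UT n\<^esub> h))"
  proof (rule extensionalityI[OF assms(2)])
    fix x :: "'a mat" assume x: "x \<in> ut n"
    note c = UT_carrier_mat[OF gh(1)] UT_carrier_mat[OF gh(2)] UT_carrier_mat[OF g(1)] UT_carrier_mat[OF h(1)]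
      ut_carrier_mat[OF x] mult_carrier_mat[of _ n n _ n]
    have "g * (inv\<^bsub>UT n\<^esub> g * x * inv\<^bsub>UT n\<^esub> h) * h = (g * inv\<^bsub>UT n\<^esub> g) * (x * (inv\<^bsub>UT n\<^esub> h * h))"
      using c by (simp add: assoc_mult_mat[of _ n n _ n _ n])
    also have "\<dots> = x" using g(3) h(2) c by simp
    finally show "\<mu> x = (\<lambda>x\<in>ut n. \<psi> (inv\<^bsub>UT n\<^esub> g * x * inv\<^bsub>UT n\<^esub> h)) x"
      using x sandwich_ut[OF g(1) x h(1)] by (simp add: gh(3))
  qed simp
  then show ?thesis unfolding dual_orbit_eq using g(1) h(1) by blast
qed

lemma functional_extensional: "functional n y \<in> extensional (ut n)"
  by (simp add: functional_def)

text \<open>On coefficients the operations are transposed: rows are added to lower rows, columns to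
  columns further left, hence the reversed weights. Truncation is genuine here: a coefficient moved
  on or below the diagonal pairs with a zero entry and is lost.\<close>

lemma dual_orbit_lam_exists:
  fixes y :: "nat \<times> nat \<Rightarrow> 'a::{field,finite}"
  assumes y0: "y \<in> strict_upper n"
  obtains \<nu> where "fq_set_partition n \<nu>" "functional n y \<in> dual_orbit n (lam n \<nu>)"
proof -
  define Y where "Y = {z \<in> strict_upper n. functional n z \<in> dual_orbit n (functional n y)}"
  have closed: "coadjoint n u v z \<in> Y" if "z \<in> Y" "u \<in> carrier (UT n)" "v \<in> carrier (UT n)" for u v z
  proof -
    note functional_sandwich[OF that(2,3), of z]
    moreover have "(\<lambda>x\<in>ut n. functional n z (u * x * v)) \<in> dual_orbit n (functional n y)"
      by (rule dual_orbit_mult) (use that in \<open>auto simp: Y_def\<close>)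
    ultimately show ?thesis using coadjoint_strict_upper by (simp add: Y_def)
  qed
  have "functional n y \<in> dual_orbit n (functional n y)"
  proof -
    have "functional n y = (\<lambda>x\<in>ut n. functional n y (1\<^sub>m n * x * 1\<^sub>m n))"
      by (rule extensionalityI[OF functional_extensional]) (auto dest: ut_carrier_mat)
    then show ?thesis unfolding dual_orbit_eq using one_UT[of n] by blast
  qed
  then have "y \<in> Y" using y0 by (simp add: Y_def)
  obtain z where z: "z \<in> Y" "\<And>i j k. z (i, j) \<noteq> 0 \<Longrightarrow> z (i, k) \<noteq> 0 \<Longrightarrow> j = k"
    "\<And>i j k. z (i, k) \<noteq> 0 \<Longrightarrow> z (j, k) \<noteq> 0 \<Longrightarrow> i = j"
  proof (rule elimination[of Y n "\<lambda>k. n - k" "\<lambda>l. l"])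
    show "Y \<noteq> {}" using \<open>y \<in> Y\<close> by blast
    show "Y \<subseteq> strict_upper n" by (auto simp: Y_def)
    show "inj_on (\<lambda>k. n - k) {..<n}" by (auto simp: inj_on_def)
    fix z i i' t assume z: "z \<in> Y" and i: "i < n" "i' < n" "n - i' < n - i"
    let ?z = "\<lambda>(k, l). if k = i' \<and> (k, l) \<in> arc_positions n then z (k, l) + t * z (i, l) else z (k, l)"
    have ii: "i < i'" using i by linarith
    have su: "z \<in> strict_upper n" using z by (auto simp: Y_def)
    have "?z = coadjoint n (transvection n i i' t) (1\<^sub>m n) z"
    proof
      fix p :: "nat \<times> nat"
      obtain r c where p: "p = (r, c)" by (cases p)
      show "?z p = coadjoint n (transvection n i i' t) (1\<^sub>m n) z p"
      proof (cases "p \<in> arc_positions n")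
        case True
        have "coadjoint n (transvection n i i' t) (1\<^sub>m n) z p =
          (\<Sum>q\<in>arc_positions n. (if q = p then z p else 0) + (if q = (i, c) then if r = i' then t * z (i, c) else 0 else 0))"
          unfolding coadjoint_def if_P[OF True]
          by (intro sum.cong refl) (use True ii i in \<open>auto simp: p transvection_index split: if_splits\<close>)
        also have "\<dots> = z p + (if r = i' then t * z (i, c) else 0)"
          unfolding sum.distrib using True i ii by (auto simp: p)
        finally show ?thesis using True by (auto simp: p)
      next
        case False
        then show ?thesis using strict_upper_zero[OF su] by (auto simp: p coadjoint_def)
      qed
    qed
    then show "?z \<in> Y" using closed[OF z transvection_UT[OF ii] one_UT] by simp
  next
    fix z j j' t assume z: "z \<in> Y" and j: "j < n" "j' < n" "j' < j"
    let ?z = "\<lambda>(k, l). if l = j' \<and> (k, l) \<in> arc_positions n then z (k, l) + t * z (k, j) else z (k, l)"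
    have su: "z \<in> strict_upper n" using z by (auto simp: Y_def)
    have "?z = coadjoint n (1\<^sub>m n) (transvection n j' j t) z"
    proof
      fix p :: "nat \<times> nat"
      obtain r c where p: "p = (r, c)" by (cases p)
      show "?z p = coadjoint n (1\<^sub>m n) (transvection n j' j t) z p"
      proof (cases "p \<in> arc_positions n")
        case True
        have "coadjoint n (1\<^sub>m n) (transvection n j' j t) z p =
          (\<Sum>q\<in>arc_positions n. (if q = p then z p else 0) + (if q = (r, j) then if c = j' then t * z (r, j) else 0 else 0))"
          unfolding coadjoint_def if_P[OF True]
          by (intro sum.cong refl) (use True j in \<open>auto simp: p transvection_index split: if_splits\<close>)
        also have "\<dots> = z p + (if c = j' then t * z (r, j) else 0)"
          unfolding sum.distrib using True j by (auto simp: p)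
        finally show ?thesis using True by (auto simp: p)
      next
        case False
        then show ?thesis using strict_upper_zero[OF su] by (auto simp: p coadjoint_def)
      qed
    qed
    then show "?z \<in> Y" using closed[OF z one_UT transvection_UT[OF j(3)]] by simp
  qed auto
  have "z \<in> strict_upper n" using z(1) by (simp add: Y_def)
  then obtain \<nu> where nu: "fq_set_partition n \<nu>" "coefs \<nu> = z" using coefs_exists z(2,3) by metis
  have "lam n \<nu> \<in> dual_orbit n (functional n y)" using z(1) nu by (simp add: Y_def lam_functional)
  then show thesis using that[OF nu(1)] dual_orbit_sym functional_extensional by blast
qed

text \<open>Guarantees that no functional is counted twice when the orbit sums of a block are
  added.\<close>

lemma dual_orbit_lam_disjoint:
  fixes \<nu> \<nu>' :: "'a::{field,finite} arc set"
  assumes fq: "fq_set_partition n \<nu>" and fq': "fq_set_partition n \<nu>'"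
    and \<psi>: "\<psi> \<in> dual_orbit n (lam n \<nu>)" "\<psi> \<in> dual_orbit n (lam n \<nu>')"
  shows "\<nu>' = \<nu>"
proof -
  have "lam n \<nu>' \<in> dual_orbit n \<psi>"
    by (rule dual_orbit_sym[OF \<psi>(2)]) (simp add: lam_functional[OF fq'] functional_extensional)
  then obtain u v where uv: "u \<in> carrier (UT n)" "v \<in> carrier (UT n)" "lam n \<nu>' = (\<lambda>x\<in>ut n. \<psi> (u * x * v))"
    unfolding dual_orbit_eq by blast
  have "lam n \<nu>' \<in> dual_orbit n (lam n \<nu>)" unfolding uv(3) by (rule dual_orbit_mult[OF \<psi>(1) uv(1,2)])
  then obtain u v where uv: "u \<in> carrier (UT n)" "v \<in> carrier (UT n)" "lam n \<nu>' = (\<lambda>x\<in>ut n. lam n \<nu> (u * x * v))"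
    unfolding dual_orbit_eq by blast
  \<comment> \<open>moving \<open>u\<close> to the other side leaves row operations on \<open>\<nu>'\<close> and column operations on \<open>\<nu>\<close>\<close>
  define w where "w = inv\<^bsub>UT n\<^esub> u"
  note w = UT_inv[OF uv(1), folded w_def]
  have eq: "coadjoint n w (1\<^sub>m n) (coefs \<nu>') = coadjoint n (1\<^sub>m n) v (coefs \<nu>)"
  proof (rule lin_inj[OF coadjoint_strict_upper coadjoint_strict_upper])
    fix x :: "'a mat" assume x: "x \<in> ut n"
    note xc = ut_carrier_mat[OF x]
    have wx: "w * x * 1\<^sub>m n \<in> ut n" "1\<^sub>m n * x * v \<in> ut n" using sandwich_ut x w(1) one_UT uv(2) by blast+
    have "lin n (coadjoint n w (1\<^sub>m n) (coefs \<nu>')) x = lam n \<nu>' (w * x * 1\<^sub>m n)"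
      using wx lin_coadjoint[OF w(1) x one_UT] by (simp add: lam_functional[OF fq'] functional_def)
    also have "\<dots> = lam n \<nu> (u * (w * x * 1\<^sub>m n) * v)" unfolding uv(3) using wx by simp
    also have "u * (w * x * 1\<^sub>m n) * v = (u * w) * x * v"
      using UT_carrier_mat[OF uv(1)] UT_carrier_mat[OF w(1)] xc UT_carrier_mat[OF uv(2)]
      by (simp add: assoc_mult_mat[of _ n n _ n _ n])
    also have "\<dots> = 1\<^sub>m n * x * v" by (simp add: w(3))
    also have "lam n \<nu> \<dots> = lin n (coadjoint n (1\<^sub>m n) v (coefs \<nu>)) x"
      using wx lin_coadjoint[OF one_UT x uv(2)] by (simp add: lam_functional[OF fq] functional_def)
    finally show "lin n (coadjoint n w (1\<^sub>m n) (coefs \<nu>')) x = lin n (coadjoint n (1\<^sub>m n) v (coefs \<nu>)) x" .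
  qed
  \<comment> \<open>The same family read in two ways: labels of \<open>\<nu>'\<close> spread
    downwards in their columns, and labels of \<open>\<nu>\<close> spread leftwards in their rows.
    \<open>fq_set_partition_eqI\<close> compares the two readings.\<close>
  define \<Phi> where "\<Phi> r c = coadjoint n w (1\<^sub>m n) (coefs \<nu>') (r, c)" for r c
  have P1: "\<Phi> r c = (\<Sum>q\<in>arc_positions n. coefs \<nu>' q * (w $$ (fst q, r) * 1\<^sub>m n $$ (c, snd q)))"
    and P2: "\<Phi> r c = (\<Sum>q\<in>arc_positions n. coefs \<nu> q * (1\<^sub>m n $$ (fst q, r) * v $$ (c, snd q)))"
    if "r < c" "c < n" for r c
  proof -
    show "\<Phi> r c = (\<Sum>q\<in>arc_positions n. coefs \<nu>' q * (w $$ (fst q, r) * 1\<^sub>m n $$ (c, snd q)))"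
      using that by (simp add: \<Phi>_def coadjoint_def)
    show "\<Phi> r c = (\<Sum>q\<in>arc_positions n. coefs \<nu> q * (1\<^sub>m n $$ (fst q, r) * v $$ (c, snd q)))"
      unfolding \<Phi>_def eq using that by (simp add: coadjoint_def)
  qed
  show ?thesis
  proof (rule fq_set_partition_eqI[OF fq fq', of \<Phi>])
    fix r c a assume a: "(r, c, a) \<in> \<nu>'"
    note rc = fq_arcD[OF fq' a]
    have "\<Phi> r c = (\<Sum>q\<in>arc_positions n. if q = (r, c) then a else 0)"
      unfolding P1[OF rc(1,2)]
    proof (intro sum.cong refl)
      fix q assume q: "q \<in> arc_positions n"
      obtain i j where ij: "q = (i, j)" by (cases q)
      show "coefs \<nu>' q * (w $$ (fst q, r) * 1\<^sub>m n $$ (c, snd q)) = (if q = (r, c) then a else 0)"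
      proof (cases "coefs \<nu>' q = 0 \<or> j \<noteq> c")
        case True
        then show ?thesis using q ij rc coefs_arc[OF fq' a] by auto
      next
        case False
        then obtain b where "(i, c, b) \<in> \<nu>'" using coefs_nonzero ij by blast
        then have "i = r" using fq_colD[OF fq' _ a] by blast
        then show ?thesis using False ij rc coefs_arc[OF fq' a] UT_diag[OF w(1)] by simp
      qed
    qed
    then show "\<Phi> r c = a" using rc by simp
  next
    fix r c a assume a: "(r, c, a) \<in> \<nu>"
    note rc = fq_arcD[OF fq a]
    have "\<Phi> r c = (\<Sum>q\<in>arc_positions n. if q = (r, c) then a else 0)"
      unfolding P2[OF rc(1,2)]
    proof (intro sum.cong refl)
      fix q assume q: "q \<in> arc_positions n"
      obtain i j where ij: "q = (i, j)" by (cases q)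
      show "coefs \<nu> q * (1\<^sub>m n $$ (fst q, r) * v $$ (c, snd q)) = (if q = (r, c) then a else 0)"
      proof (cases "coefs \<nu> q = 0 \<or> i \<noteq> r")
        case True
        then show ?thesis using q ij rc coefs_arc[OF fq a] by auto
      next
        case False
        then obtain b where "(r, j, b) \<in> \<nu>" using coefs_nonzero ij by blast
        then have "c = j" using fq_rowD(1)[OF fq a] by blast
        then show ?thesis using False ij rc coefs_arc[OF fq a] UT_diag[OF uv(2)] by simp
      qed
    qed
    then show "\<Phi> r c = a" using rc by simp
  next
    fix r c assume rc: "r < c" "c < n" "\<Phi> r c \<noteq> 0"
    then obtain q where q: "q \<in> arc_positions n" "coefs \<nu>' q * (w $$ (fst q, r) * 1\<^sub>m n $$ (c, snd q)) \<noteq> 0"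
      unfolding P1[OF rc(1,2)] by (meson sum.neutral)
    obtain i j where ij: "q = (i, j)" by (cases q)
    have "j = c" using q rc ij by (auto split: if_splits)
    moreover have "i \<le> r" using q ij UT_lower[OF w(1), of i r] by (cases "i \<le> r") auto
    moreover have "coefs \<nu>' (i, j) \<noteq> 0" using q ij by auto
    ultimately show "\<exists>i a. i \<le> r \<and> (i, c, a) \<in> \<nu>'" using coefs_nonzero by blast
  next
    fix r c assume rc: "r < c" "c < n" "\<Phi> r c \<noteq> 0"
    then obtain q where q: "q \<in> arc_positions n" "coefs \<nu> q * (1\<^sub>m n $$ (fst q, r) * v $$ (c, snd q)) \<noteq> 0"
      unfolding P2[OF rc(1,2)] by (meson sum.neutral)
    obtain i j where ij: "q = (i, j)" by (cases q)
    have "i = r" using q rc ij by (auto split: if_splits)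
    moreover have "c \<le> j" using q ij rc UT_lower[OF uv(2), of c j] by (cases "c \<le> j") auto
    moreover have "coefs \<nu> (i, j) \<noteq> 0" using q ij by auto
    ultimately show "\<exists>j a. c \<le> j \<and> (r, j, a) \<in> \<nu>" using coefs_nonzero by blast
  qed
qed

section \<open>The characters as induced characters\<close>

text \<open>A common end with the surrounding arc is allowed, unlike for nesting: multiplication on
  one side alone already reaches such positions.\<close>

definition strictly_inside :: "nat \<Rightarrow> 'a arc set \<Rightarrow> (nat \<times> nat) set" where
  "strictly_inside n \<eta> = {(k, l). k < l \<and> l < n \<and> (\<exists>(i, j, a)\<in>\<eta>. i \<le> k \<and> l \<le> j \<and> (i, j) \<noteq> (k, l))}"

text \<open>The coefficient families of the functionals occurring in \<open>\<chi>\<^bsub>[\<eta>]\<^esub>\<close>; \<open>coefs \<eta>\<close> vanishes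
  off the arcs.\<close>

definition chi_supp :: "nat \<Rightarrow> 'a::field arc set \<Rightarrow> (nat \<times> nat \<Rightarrow> 'a) set" where
  "chi_supp n \<eta> = {y \<in> strict_upper n. \<forall>p\<in>arc_positions n - strictly_inside n \<eta>. y p = coefs \<eta> p}"

definition kernel_subgroup :: "nat \<Rightarrow> 'a::field arc set \<Rightarrow> 'a mat set" where
  "kernel_subgroup n \<eta> = {h \<in> carrier (UT n). \<forall>p\<in>strictly_inside n \<eta>. h $$ p = 0}"

lemma strictly_inside_iff:
  "(k, l) \<in> strictly_inside n \<eta> \<longleftrightarrow> k < l \<and> l < n \<and> (\<exists>i j a. (i, j, a) \<in> \<eta> \<and> i \<le> k \<and> l \<le> j \<and> (i, j) \<noteq> (k, l))"
  unfolding strictly_inside_def by fastforce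

lemma strictly_inside_subset: "strictly_inside n \<eta> \<subseteq> arc_positions n"
  by (auto simp: strictly_inside_def arc_positions_def)

lemma strictly_inside_closed:
  assumes "(k, l) \<in> strictly_inside n \<eta>" "k \<le> r" "r < c" "c \<le> l"
  shows "(r, c) \<in> strictly_inside n \<eta>"
proof -
  obtain i j a where "(i, j, a) \<in> \<eta>" "i \<le> k" "l \<le> j" "(i, j) \<noteq> (k, l)" "l < n"
    using assms(1) unfolding strictly_inside_iff by blast
  then show ?thesis using assms unfolding strictly_inside_iff by (intro conjI exI[of _ i] exI[of _ j] exI[of _ a]) auto
qed

lemma arc_strictly_inside:
  assumes "(i, j, a) \<in> \<eta>" "i \<le> r" "r < c" "c \<le> j" "(i, j) \<noteq> (r, c)" "j < n"
  shows "(r, c) \<in> strictly_inside n \<eta>"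
  unfolding strictly_inside_iff using assms by (intro conjI exI[of _ i] exI[of _ j] exI[of _ a]) auto

lemma arc_not_strictly_inside:
  assumes fq: "fq_set_partition n \<eta>" and nn: "nonnesting \<eta>" and a: "(i, j, a) \<in> \<eta>"
  shows "(i, j) \<notin> strictly_inside n \<eta>"
proof
  assume "(i, j) \<in> strictly_inside n \<eta>"
  then obtain k l b where "(k, l, b) \<in> \<eta>" "k \<le> i" "j \<le> l" "(k, l) \<noteq> (i, j)"
    unfolding strictly_inside_iff by blast
  then show False using fq_nested_eq(1,2)[OF fq nn _ a] by blast
qed

lemma chi_supp_nonzero:
  assumes y: "y \<in> chi_supp n \<eta>" and nz: "y (k, l) \<noteq> 0"
  obtains i j a where "(i, j, a) \<in> \<eta>" "i \<le> k" "l \<le> j"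
proof (cases "(k, l) \<in> strictly_inside n \<eta>")
  case True
  then show thesis using that unfolding strictly_inside_iff by blast
next
  case False
  have "(k, l) \<in> arc_positions n" using y nz by (auto simp: chi_supp_def strict_upper_def)
  then have "coefs \<eta> (k, l) \<noteq> 0" using y nz False by (auto simp: chi_supp_def)
  then show thesis using that coefs_nonzero by blast
qed

lemma chi_supp_arc:
  fixes \<eta> :: "'a::{field,finite} arc set"
  assumes fq: "fq_set_partition n \<eta>" and nn: "nonnesting \<eta>" and y: "y \<in> chi_supp n \<eta>" and a: "(i, j, a) \<in> \<eta>"
  shows "y (i, j) = a"
proof -
  have "(i, j) \<in> arc_positions n - strictly_inside n \<eta>"
    using fq_arcD[OF fq a] arc_not_strictly_inside[OF fq nn a] by simp
  then show ?thesis using y coefs_arc[OF fq a] by (simp add: chi_supp_def)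
qed

text \<open>Each arc of \<open>\<eta>\<close> lies under an arc of \<open>\<eta>'\<close>, which in
  turn lies under an arc of \<open>\<eta>\<close>; the antichain property makes all three coincide,
  and \<open>y\<close> gives the label.\<close>

lemma chi_supp_disjoint:
  fixes \<eta> \<eta>' :: "'a::{field,finite} arc set"
  assumes fq: "fq_set_partition n \<eta>" "fq_set_partition n \<eta>'" and nn: "nonnesting \<eta>" "nonnesting \<eta>'"
    and y: "y \<in> chi_supp n \<eta>" "y \<in> chi_supp n \<eta>'"
  shows "\<eta> = \<eta>'"
proof -
  have sub: "\<eta> \<subseteq> \<eta>'" if fq: "fq_set_partition n \<eta>" "fq_set_partition n \<eta>'" and nn: "nonnesting \<eta>" "nonnesting \<eta>'"
    and y: "y \<in> chi_supp n \<eta>" "y \<in> chi_supp n \<eta>'" for \<eta> \<eta>' :: "'a arc set"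
  proof
    fix p assume "p \<in> \<eta>"
    moreover obtain r c a where p: "p = (r, c, a)" by (cases p)
    ultimately have a: "(r, c, a) \<in> \<eta>" by simp
    have ya: "y (r, c) = a" by (rule chi_supp_arc[OF fq(1) nn(1) y(1) a])
    then obtain i j b where b: "(i, j, b) \<in> \<eta>'" "i \<le> r" "c \<le> j"
      using chi_supp_nonzero[OF y(2), of r c] fq_arcD[OF fq(1) a] by blast
    have yb: "y (i, j) = b" by (rule chi_supp_arc[OF fq(2) nn(2) y(2) b(1)])
    then obtain k l d where d: "(k, l, d) \<in> \<eta>" "k \<le> i" "j \<le> l"
      using chi_supp_nonzero[OF y(1), of i j] fq_arcD[OF fq(2) b(1)] by blast
    have "k = r" "l = c" using fq_nested_eq(1,2)[OF fq(1) nn(1) d(1) a] d b by auto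
    then have "i = r" "j = c" using d b by auto
    then show "p \<in> \<eta>'" using b ya yb p by simp
  qed
  show ?thesis using sub[OF fq nn y] sub[OF fq(2,1) nn(2,1) y(2,1)] by blast
qed

lemma coefs_chi_supp: "fq_set_partition n \<eta> \<Longrightarrow> coefs \<eta> \<in> chi_supp n \<eta>"
  by (simp add: chi_supp_def coefs_strict_upper)

lemma fq_big: "fq_set_partition n \<nu> \<Longrightarrow> fq_set_partition n (big \<nu>)"
  and fq_sml: "fq_set_partition n \<nu> \<Longrightarrow> fq_set_partition n (sml \<nu>)"
  by (erule fq_subset, rule big_subset) (erule fq_subset, rule sml_subset)

text \<open>The coefficient at \<open>(r, c)\<close> collects arcs containing \<open>(r, c)\<close>.
  Each of them lies under an outermost arc; if \<open>(r, c)\<close> is not strictly inside that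
  arc, all three coincide, so only an outermost arc at \<open>(r, c)\<close> itself
  contributes.\<close>

lemma coadjoint_chi_supp:
  fixes \<nu> :: "'a::{field,finite} arc set"
  assumes fq: "fq_set_partition n \<nu>" and u: "u \<in> carrier (UT n)" and v: "v \<in> carrier (UT n)"
  shows "coadjoint n u v (coefs \<nu>) \<in> chi_supp n (big \<nu>)"
proof -
  have "coadjoint n u v (coefs \<nu>) p = coefs (big \<nu>) p" if p: "p \<in> arc_positions n - strictly_inside n (big \<nu>)" for p
  proof -
    obtain r c where rc: "p = (r, c)" by (cases p)
    have rcn: "r < c" "c < n" "(r, c) \<notin> strictly_inside n (big \<nu>)" using p by (auto simp: rc)
    have out: "(i, j) = (r, c) \<and> (i, j, a) \<in> big \<nu>" if ij: "(i, j, a) \<in> \<nu>" "i \<le> r" "c \<le> j" for i j a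
    proof -
      obtain k l b where b: "(k, l, b) \<in> big \<nu>" "k \<le> i" "j \<le> l" using big_refine[OF fq ij(1)] by blast
      have "(k, l) = (r, c)"
        using arc_strictly_inside[OF b(1), of r c n] b ij rcn fq_arcD[OF fq_big[OF fq] b(1)] by fastforce
      then have *: "k = r" "l = c" "i = r" "j = c" using b ij by auto
      then have "a = b" using fq_rowD(2)[OF fq ij(1), of l b] b(1) big_subset by blast
      then show ?thesis using * b by simp
    qed
    have "coadjoint n u v (coefs \<nu>) p = (\<Sum>q\<in>arc_positions n. coefs \<nu> q * (u $$ (fst q, fst p) * v $$ (snd p, snd q)))"
      using p by (simp add: coadjoint_def)
    also have "\<dots> = (\<Sum>q\<in>arc_positions n. if q = p then coefs \<nu> p else 0)"
    proof (intro sum.cong refl)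
      fix q assume q: "q \<in> arc_positions n"
      obtain i j where ij: "q = (i, j)" by (cases q)
      show "coefs \<nu> q * (u $$ (fst q, fst p) * v $$ (snd p, snd q)) = (if q = p then coefs \<nu> p else 0)"
      proof (cases "q = p")
        case True
        then show ?thesis using UT_diag[OF u] UT_diag[OF v] rcn by (simp add: rc)
      next
        case False
        have "coefs \<nu> q = 0 \<or> u $$ (i, r) = 0 \<or> v $$ (c, j) = 0"
        proof (rule ccontr)
          assume nz: "\<not> ?thesis"
          then obtain a where "(i, j, a) \<in> \<nu>" using coefs_nonzero ij by blast
          moreover have "i \<le> r" using nz q ij UT_lower[OF u, of i r] by (cases "i \<le> r") auto
          moreover have "c \<le> j" using nz rcn UT_lower[OF v, of c j] by (cases "c \<le> j") auto
          ultimately show False using out False ij rc by blast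
        qed
        then show ?thesis using False by (auto simp: rc ij)
      qed
    qed
    also have "\<dots> = coefs \<nu> p" using p by simp
    also have "\<dots> = coefs (big \<nu>) p"
    proof (cases "\<exists>a. (r, c, a) \<in> \<nu>")
      case True
      then obtain a where a: "(r, c, a) \<in> \<nu>" by blast
      then have "(r, c, a) \<in> big \<nu>" using out by blast
      then show ?thesis using coefs_arc[OF fq a] coefs_arc[OF fq_big[OF fq]] by (simp add: rc)
    next
      case False
      then have "coefs \<nu> (r, c) = 0" "coefs (big \<nu>) (r, c) = 0" using coefs_nonzero big_subset by blast+
      then show ?thesis by (simp add: rc)
    qed
    finally show ?thesis .
  qed
  then show ?thesis by (simp add: chi_supp_def coadjoint_strict_upper)
qed

lemma chi_supp_big_exists:
  fixes y :: "nat \<times> nat \<Rightarrow> 'a::{field,finite}"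
  assumes su: "y \<in> strict_upper n"
  obtains \<nu> where "fq_set_partition n \<nu>" "functional n y \<in> dual_orbit n (lam n \<nu>)" "y \<in> chi_supp n (big \<nu>)"
proof -
  obtain \<nu> where nu: "fq_set_partition n \<nu>" "functional n y \<in> dual_orbit n (lam n \<nu>)"
    by (rule dual_orbit_lam_exists[OF su])
  obtain u v where uv: "u \<in> carrier (UT n)" "v \<in> carrier (UT n)" "functional n y = functional n (coadjoint n u v (coefs \<nu>))"
    using nu(2) unfolding lam_functional[OF nu(1)] dual_orbit_functional by blast
  have "y = coadjoint n u v (coefs \<nu>)" by (rule inj_onD[OF functional_inj uv(3) su coadjoint_strict_upper])
  then have "y \<in> chi_supp n (big \<nu>)" using coadjoint_chi_supp[OF nu(1) uv(1,2)] by simp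
  with nu show thesis by (rule that)
qed

text \<open>For the inclusion from right to left no group elements are constructed: \<open>y\<close>
  lies in some orbit, hence in the support of its \<open>big\<close> part, and disjointness of the
  supports identifies that part with \<open>\<eta>\<close>.\<close>

lemma functional_chi_supp:
  fixes \<eta> :: "'a::{field,finite} arc set"
  assumes fq: "fq_set_partition n \<eta>" and nn: "nonnesting \<eta>"
  shows "(\<Union>\<nu>\<in>{\<nu>. fq_set_partition n \<nu> \<and> big \<nu> = \<eta>}. dual_orbit n (lam n \<nu>)) = functional n ` chi_supp n \<eta>"
proof (intro equalityI subsetI)
  fix \<psi> assume "\<psi> \<in> (\<Union>\<nu>\<in>{\<nu>. fq_set_partition n \<nu> \<and> big \<nu> = \<eta>}. dual_orbit n (lam n \<nu>))"
  then obtain \<nu> where nu: "fq_set_partition n \<nu>" "big \<nu> = \<eta>" "\<psi> \<in> dual_orbit n (lam n \<nu>)" by blast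
  then obtain u v where "u \<in> carrier (UT n)" "v \<in> carrier (UT n)" "\<psi> = functional n (coadjoint n u v (coefs \<nu>))"
    unfolding lam_functional[OF nu(1)] dual_orbit_functional by blast
  then show "\<psi> \<in> functional n ` chi_supp n \<eta>" using coadjoint_chi_supp[OF nu(1)] nu(2) by blast
next
  fix \<psi> assume "\<psi> \<in> functional n ` chi_supp n \<eta>"
  then obtain y where y: "y \<in> chi_supp n \<eta>" "\<psi> = functional n y" by blast
  then have su: "y \<in> strict_upper n" by (simp add: chi_supp_def)
  obtain \<nu> where nu: "fq_set_partition n \<nu>" "functional n y \<in> dual_orbit n (lam n \<nu>)" "y \<in> chi_supp n (big \<nu>)"
    by (rule chi_supp_big_exists[OF su])
  have "big \<nu> = \<eta>" by (rule chi_supp_disjoint[OF fq_big[OF nu(1)] fq nonnesting_big nn nu(3) y(1)])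
  then show "\<psi> \<in> (\<Union>\<nu>\<in>{\<nu>. fq_set_partition n \<nu> \<and> big \<nu> = \<eta>}. dual_orbit n (lam n \<nu>))"
    using nu y(2) by blast
qed

lemma finite_dual_orbit: "finite (dual_orbit n (\<mu> :: 'a::{field,finite} mat \<Rightarrow> 'a))"
proof -
  have "dual_orbit n \<mu> \<subseteq> (\<lambda>(u, v). \<lambda>x\<in>ut n. \<mu> (u * x * v)) ` (carrier (UT n) \<times> carrier (UT n))"
    unfolding dual_orbit_eq by auto
  then show ?thesis by (rule finite_subset) (simp add: finite_UT)
qed

text \<open>\<open>lin\<close> reads only entries above the diagonal, so subtracting the identity
  makes no difference; from here on it is applied to group elements directly.\<close>

lemma lin_f_map:
  assumes "h \<in> carrier (UT n)" shows "lin n y (f_map n h) = lin n y h"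
  unfolding lin_def using f_map_index[OF assms] by (intro sum.cong refl) (auto simp: arc_positions_def)

lemma chi_block_eq_sum:
  fixes \<eta> :: "'a::{field,finite} arc set"
  assumes fq: "fq_set_partition n \<eta>" and nn: "nonnesting \<eta>" and h: "h \<in> carrier (UT n)"
  shows "chi_block n \<theta> \<eta> h = (\<Sum>y\<in>chi_supp n \<eta>. \<theta> (lin n y h))"
proof -
  let ?I = "{\<nu>. fq_set_partition n \<nu> \<and> big \<nu> = \<eta>}"
  have "chi_block n \<theta> \<eta> h = (\<Sum>\<nu>\<in>?I. \<Sum>\<mu>\<in>dual_orbit n (lam n \<nu>). \<theta> (\<mu> (f_map n h)))"
    using h by (simp add: chi_block_def chi_fine_def)
  also have "\<dots> = (\<Sum>\<mu>\<in>(\<Union>\<nu>\<in>?I. dual_orbit n (lam n \<nu>)). \<theta> (\<mu> (f_map n h)))"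
  proof (rule sum.UNION_disjoint[symmetric])
    show "finite ?I" by (rule finite_subset[OF _ finite_fq_set_partitions[of n]]) auto
    show "\<forall>\<nu>\<in>?I. finite (dual_orbit n (lam n \<nu>))" by (simp add: finite_dual_orbit)
    show "\<forall>\<nu>\<in>?I. \<forall>\<nu>'\<in>?I. \<nu> \<noteq> \<nu>' \<longrightarrow> dual_orbit n (lam n \<nu>) \<inter> dual_orbit n (lam n \<nu>') = {}"
      using dual_orbit_lam_disjoint[of n] by blast
  qed
  also have "\<dots> = (\<Sum>y\<in>chi_supp n \<eta>. \<theta> (functional n y (f_map n h)))"
    unfolding functional_chi_supp[OF fq nn]
    by (rule sum.reindex[unfolded o_def]) (rule inj_on_subset[OF functional_inj[of n]], auto simp: chi_supp_def)
  also have "\<dots> = (\<Sum>y\<in>chi_supp n \<eta>. \<theta> (lin n y h))"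
    using f_map_ut[OF h] by (simp add: functional_def lin_f_map[OF h])
  finally show ?thesis .
qed

section \<open>Additive characters and exponential sums\<close>

lemma additive_character_zero: "nontrivial_additive_character \<theta> \<Longrightarrow> \<theta> 0 = 1"
  unfolding nontrivial_additive_character_def
  by (metis add_0 mult_cancel_right1)

text \<open>The largest norm \<open>M\<close> exists because the field is finite, and doubling its
  argument gives \<open>M * M \<le> M\<close>. So all norms are at most 1, while those at
  \<open>a\<close> and \<open>- a\<close> multiply to 1.\<close>

lemma additive_character_norm:
  fixes \<theta> :: "'a::{field,finite} \<Rightarrow> complex"
  assumes \<theta>: "nontrivial_additive_character \<theta>"
  shows "norm (\<theta> a) = 1"
proof -
  have add: "\<theta> (a + b) = \<theta> a * \<theta> b" for a b using \<theta> by (simp add: nontrivial_additive_character_def)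
  have le: "norm (\<theta> a) \<le> 1" for a
  proof -
    define M where "M = Max (range (\<lambda>a. norm (\<theta> a)))"
    have M: "norm (\<theta> b) \<le> M" for b unfolding M_def by (rule Max_ge) auto
    have "M \<in> range (\<lambda>a. norm (\<theta> a))" unfolding M_def by (rule Max_in) auto
    then obtain b where b: "M = norm (\<theta> b)" by auto
    have "M * M = norm (\<theta> (b + b))" unfolding add b by (simp add: norm_mult)
    then have "M * M \<le> M" using M[of "b + b"] by simp
    moreover have "M > 0" using \<theta> b by (simp add: nontrivial_additive_character_def)
    ultimately have "M \<le> 1" by simp
    then show ?thesis using M[of a] by linarith
  qed
  have "norm (\<theta> a) * norm (\<theta> (- a)) = 1"
    using add[of a "- a"] additive_character_zero[OF \<theta>] by (simp flip: norm_mult)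
  moreover have "norm (\<theta> a) * norm (\<theta> (- a)) \<le> norm (\<theta> a) * 1"
    using le[of "- a"] by (intro mult_left_mono) auto
  ultimately show ?thesis using le[of a] by linarith
qed

lemma chi_supp_upd:
  fixes \<eta> :: "'a::field arc set"
  assumes "y \<in> chi_supp n \<eta>" "p \<in> strictly_inside n \<eta>"
  shows "y(p := s) \<in> chi_supp n \<eta>"
  using assms strictly_inside_subset[of n \<eta>] by (auto simp: chi_supp_def strict_upper_def)

lemma lin_upd:
  assumes "p \<in> arc_positions n"
  shows "lin n (y(p := y p + t)) h = lin n y h + t * h $$ p"
proof -
  have "lin n (y(p := y p + t)) h = (\<Sum>q\<in>arc_positions n. y q * h $$ q + (if q = p then t * h $$ p else 0))"
    unfolding lin_def by (intro sum.cong refl) (auto simp: algebra_simps)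
  then show ?thesis using assms by (simp add: sum.distrib lin_def)
qed

text \<open>Shifting coordinate \<open>p\<close> by \<open>s / h $$ p\<close> permutes
  \<open>Y\<close> and multiplies the sum by \<open>\<theta> s\<close>, which is not 1.\<close>

lemma sum_additive_character_zero:
  fixes \<theta> :: "'a::{field,finite} \<Rightarrow> complex"
  assumes \<theta>: "nontrivial_additive_character \<theta>" and p: "p \<in> arc_positions n" "h $$ p \<noteq> 0"
    and Y: "\<And>y s. y \<in> Y \<Longrightarrow> y(p := s) \<in> Y"
  shows "(\<Sum>y\<in>Y. \<theta> (lin n y h)) = 0"
proof -
  obtain s where s: "\<theta> s \<noteq> 1" using \<theta> by (auto simp: nontrivial_additive_character_def)
  define t where "t = s / h $$ p"
  have "(\<Sum>y\<in>Y. \<theta> (lin n y h)) = (\<Sum>y\<in>Y. \<theta> (lin n (y(p := y p + t)) h))"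
    by (rule sum.reindex_bij_witness[of _ "\<lambda>y. y(p := y p + t)" "\<lambda>y. y(p := y p - t)"]) (auto intro: Y)
  also have "\<dots> = (\<Sum>y\<in>Y. \<theta> (lin n y h) * \<theta> s)"
    using \<theta> p by (intro sum.cong refl) (simp add: lin_upd t_def nontrivial_additive_character_def)
  also have "\<dots> = (\<Sum>y\<in>Y. \<theta> (lin n y h)) * \<theta> s" by (simp add: sum_distrib_right)
  finally show ?thesis using s by simp
qed

definition kernel_char :: "nat \<Rightarrow> ('a::field \<Rightarrow> complex) \<Rightarrow> 'a arc set \<Rightarrow> 'a mat \<Rightarrow> complex" where
  "kernel_char n \<theta> \<eta> h = \<theta> (lin n (coefs \<eta>) h)"

text \<open>On the subgroup the free coefficients meet zero entries, so all summands agree. Outside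
  it some free coefficient meets a nonzero entry and the sum cancels.\<close>

lemma chi_block_eq:
  fixes \<eta> :: "'a::{field,finite} arc set"
  assumes \<theta>: "nontrivial_additive_character \<theta>"
    and fq: "fq_set_partition n \<eta>" and nn: "nonnesting \<eta>" and h: "h \<in> carrier (UT n)"
  shows "chi_block n \<theta> \<eta> h = (if h \<in> kernel_subgroup n \<eta> then of_nat (card (chi_supp n \<eta>)) * kernel_char n \<theta> \<eta> h else 0)"
proof (cases "h \<in> kernel_subgroup n \<eta>")
  case True
  have "lin n y h = lin n (coefs \<eta>) h" if y: "y \<in> chi_supp n \<eta>" for y
    unfolding lin_def
  proof (intro sum.cong refl)
    fix p assume p: "p \<in> arc_positions n"
    show "y p * h $$ p = coefs \<eta> p * h $$ p"
      using p y True by (cases "p \<in> strictly_inside n \<eta>") (auto simp: kernel_subgroup_def chi_supp_def)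
  qed
  then show ?thesis using True by (simp add: chi_block_eq_sum[OF fq nn h] kernel_char_def)
next
  case False
  then obtain p where p: "p \<in> strictly_inside n \<eta>" "h $$ p \<noteq> 0" using h by (auto simp: kernel_subgroup_def)
  have "(\<Sum>y\<in>chi_supp n \<eta>. \<theta> (lin n y h)) = 0"
    by (rule sum_additive_character_zero[where p = p]) (use \<theta> p strictly_inside_subset[of n \<eta>] chi_supp_upd[OF _ p(1)] in auto)
  then show ?thesis using False by (simp add: chi_block_eq_sum[OF fq nn h])
qed

section \<open>Counting, and the kernel subgroup\<close>

lemma card_strict_upper_fixed:
  fixes c :: "nat \<times> nat \<Rightarrow> 'a::{zero,finite}"
  assumes "A \<subseteq> arc_positions n"
  shows "card {y \<in> strict_upper n. \<forall>p\<in>A. y p = c p} = card (UNIV :: 'a set) ^ card (arc_positions n - A)"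
proof -
  let ?B = "arc_positions n - A"
  have "bij_betw (\<lambda>y. restrict y ?B) {y \<in> strict_upper n. \<forall>p\<in>A. y p = c p} (?B \<rightarrow>\<^sub>E UNIV)"
    by (rule bij_betw_byWitness[where f' = "\<lambda>z p. if p \<in> ?B then z p else if p \<in> A then c p else 0"])
      (use assms in \<open>auto simp: strict_upper_def fun_eq_iff PiE_def extensional_def split: if_splits\<close>)
  then have "card {y \<in> strict_upper n. \<forall>p\<in>A. y p = c p} = card (?B \<rightarrow>\<^sub>E (UNIV :: 'a set))"
    by (rule bij_betw_same_card)
  also have "\<dots> = card (UNIV :: 'a set) ^ card ?B" by (subst card_PiE) auto
  finally show ?thesis .
qed

lemma card_UT_fixed:
  fixes n :: nat
  assumes "A \<subseteq> arc_positions n"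
  shows "card {h \<in> carrier (UT n :: 'a::{field,finite} mat monoid). \<forall>p\<in>A. h $$ p = 0} = card (UNIV :: 'a set) ^ card (arc_positions n - A)"
proof -
  have "bij_betw (\<lambda>h p. if p \<in> arc_positions n then h $$ p else 0)
     {h \<in> carrier (UT n :: 'a mat monoid). \<forall>p\<in>A. h $$ p = 0} {y \<in> strict_upper n. \<forall>p\<in>A. y p = 0}"
  proof (rule bij_betw_byWitness[where f' = "\<lambda>y. mat n n (\<lambda>(r, c). if r = c then 1 else y (r, c))"])
    show "\<forall>h\<in>{h \<in> carrier (UT n :: 'a mat monoid). \<forall>p\<in>A. h $$ p = 0}.
      mat n n (\<lambda>(r, c). if r = c then 1 else if (r, c) \<in> arc_positions n then h $$ (r, c) else 0) = h"
    proof
      fix h :: "'a mat" assume "h \<in> {h \<in> carrier (UT n :: 'a mat monoid). \<forall>p\<in>A. h $$ p = 0}"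
      then have h: "h \<in> carrier (UT n)" by simp
      show "mat n n (\<lambda>(r, c). if r = c then 1 else if (r, c) \<in> arc_positions n then h $$ (r, c) else 0) = h"
        by (rule eq_matI) (use h UT_carrier_mat[OF h] UT_diag[OF h] UT_lower[OF h] in auto)
    qed
    show "\<forall>y\<in>{y \<in> strict_upper n. \<forall>p\<in>A. y p = 0}.
       (\<lambda>p. if p \<in> arc_positions n then mat n n (\<lambda>(r, c). if r = c then 1 else y (r, c)) $$ p else 0) = (y :: nat \<times> nat \<Rightarrow> 'a)"
      by (auto simp: strict_upper_def fun_eq_iff)
    show "(\<lambda>h p. if p \<in> arc_positions n then h $$ p else 0) `
      {h \<in> carrier (UT n :: 'a mat monoid). \<forall>p\<in>A. h $$ p = 0} \<subseteq> {y \<in> strict_upper n. \<forall>p\<in>A. y p = 0}"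
      by (auto simp: strict_upper_def)
    show "(\<lambda>y. mat n n (\<lambda>(r, c). if r = c then 1 else y (r, c))) ` {y \<in> strict_upper n. \<forall>p\<in>A. y p = 0}
      \<subseteq> {h \<in> carrier (UT n :: 'a mat monoid). \<forall>p\<in>A. h $$ p = 0}"
      using assms by (force simp: UT_carrier_iff strict_upper_def)
  qed
  then show ?thesis using card_strict_upper_fixed[OF assms, of "\<lambda>_. 0 :: 'a"] by (simp add: bij_betw_same_card)
qed

text \<open>Positions strictly inside are closed under passing to smaller intervals, so their zeros
  persist; and at an arc everything that could be mixed in lies strictly inside. Normality,
  invariance and multiplicativity all come from this.\<close>

lemma kernel_sandwich:
  fixes \<eta> :: "'a::{field,finite} arc set"
  assumes fq: "fq_set_partition n \<eta>"
    and u: "u \<in> carrier (UT n)" and v: "v \<in> carrier (UT n)"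
    and x: "x \<in> ut n" "\<And>p. p \<in> strictly_inside n \<eta> \<Longrightarrow> x $$ p = 0"
  shows "p \<in> strictly_inside n \<eta> \<Longrightarrow> (u * x * v) $$ p = 0"
    and "lin n (coefs \<eta>) (u * x * v) = lin n (coefs \<eta>) x"
proof -
  show "(u * x * v) $$ p = 0" if p: "p \<in> strictly_inside n \<eta>"
  proof (rule ccontr)
    assume nz: "(u * x * v) $$ p \<noteq> 0"
    obtain r c where rc: "p = (r, c)" by (cases p)
    have b: "r < n" "c < n" using p by (auto simp: rc strictly_inside_iff)
    obtain i j where ij: "r \<le> i" "i < j" "j \<le> c" "x $$ (i, j) \<noteq> 0"
      by (rule sandwich_nonzero[OF u x(1) v b]) (use nz rc in auto)
    then show False using strictly_inside_closed[OF p[unfolded rc] ij(1-3)] x(2) by blast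
  qed
  show "lin n (coefs \<eta>) (u * x * v) = lin n (coefs \<eta>) x"
    unfolding lin_def
  proof (intro sum.cong refl)
    fix p assume p: "p \<in> arc_positions n"
    obtain r c where rc: "p = (r, c)" by (cases p)
    show "coefs \<eta> p * (u * x * v) $$ p = coefs \<eta> p * x $$ p"
    proof (cases "coefs \<eta> p = 0")
      case False
      then obtain a where a: "(r, c, a) \<in> \<eta>" using coefs_nonzero rc by blast
      note b = fq_arcD[OF fq a]
      have "(u * x * v) $$ (r, c) = x $$ (r, c)"
      proof (rule sandwich_eq[OF u x(1) v])
        fix i j assume "r \<le> i" "i < j" "j \<le> c" "(i, j) \<noteq> (r, c)"
        then show "x $$ (i, j) = 0" using arc_strictly_inside[OF a, of i j n] b x(2) by auto
      qed (use b in auto)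
      then show ?thesis by (simp add: rc)
    qed simp
  qed
qed

lemma kernel_subgroup_UT: "h \<in> kernel_subgroup n \<eta> \<Longrightarrow> h \<in> carrier (UT n)"
  by (simp add: kernel_subgroup_def)

lemma kernel_subgroup_f_map:
  assumes "h \<in> kernel_subgroup n \<eta>"
  shows "p \<in> strictly_inside n \<eta> \<Longrightarrow> f_map n h $$ p = 0" 
  using assms f_map_index[OF kernel_subgroup_UT[OF assms]]
  by (cases p) (auto simp: kernel_subgroup_def strictly_inside_iff)

lemma kernel_subgroup_f_mapI:
  assumes "h \<in> carrier (UT n)" "\<And>p. p \<in> strictly_inside n \<eta> \<Longrightarrow> f_map n h $$ p = 0"
  shows "h \<in> kernel_subgroup n \<eta>"
  using assms f_map_index[OF assms(1)] by (fastforce simp: kernel_subgroup_def strictly_inside_iff)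

text \<open>Because \<open>u * v\<close> is the identity, \<open>f_map\<close> commutes with this
  operation. Stated for a pair \<open>u\<close>, \<open>v\<close> so as to cover conjugation by
  \<open>g\<close> as well as by its inverse.\<close>

lemma kernel_conj:
  fixes \<eta> :: "'a::{field,finite} arc set"
  assumes fq: "fq_set_partition n \<eta>" and h: "h \<in> kernel_subgroup n \<eta>" and u: "u \<in> carrier (UT n)" and v: "v \<in> carrier (UT n)"
    and uv: "u * v = 1\<^sub>m n"
  shows "u * h * v \<in> kernel_subgroup n \<eta>" "lin n (coefs \<eta>) (u * h * v) = lin n (coefs \<eta>) h"
proof -
  note h' = kernel_subgroup_UT[OF h]
  note c = UT_carrier_mat[OF u] UT_carrier_mat[OF v] UT_carrier_mat[OF h']
  have U: "u * h * v \<in> carrier (UT n)" by (intro UT_mult_closed u v h')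
  have "u * f_map n h * v = u * h * v - u * 1\<^sub>m n * v"
    unfolding f_map_def using c by (simp add: mult_minus_distrib_mat[of _ n n _ n] minus_mult_distrib_mat[of _ n n _ _ n])
  then have f: "f_map n (u * h * v) = u * f_map n h * v" using c uv by (simp add: f_map_def)
  note k = kernel_sandwich[OF fq u v f_map_ut[OF h'] kernel_subgroup_f_map[OF h]]
  show "u * h * v \<in> kernel_subgroup n \<eta>"
    by (rule kernel_subgroup_f_mapI[OF U]) (simp add: f k(1) del: index_mult_mat)
  show "lin n (coefs \<eta>) (u * h * v) = lin n (coefs \<eta>) h"
    using k(2) lin_f_map[OF U, of "coefs \<eta>"] lin_f_map[OF h', of "coefs \<eta>"] by (simp add: f)
qed

text \<open>Write \<open>g * h = g + g * (h - 1)\<close>; by \<open>kernel_sandwich\<close> the last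
  term behaves like \<open>h - 1\<close>.\<close>

lemma kernel_mult:
  fixes \<eta> :: "'a::{field,finite} arc set"
  assumes fq: "fq_set_partition n \<eta>" and g: "g \<in> kernel_subgroup n \<eta>" and h: "h \<in> kernel_subgroup n \<eta>"
  shows "g * h \<in> kernel_subgroup n \<eta>" "lin n (coefs \<eta>) (g * h) = lin n (coefs \<eta>) g + lin n (coefs \<eta>) h"
proof -
  note g' = kernel_subgroup_UT[OF g] and h' = kernel_subgroup_UT[OF h]
  note c = UT_carrier_mat[OF g'] UT_carrier_mat[OF h']
  have gh: "g * h \<in> carrier (UT n)" by (intro UT_mult_closed g' h')
  note k = kernel_sandwich[OF fq g' one_UT f_map_ut[OF h'] kernel_subgroup_f_map[OF h]]
  have "g * f_map n h * 1\<^sub>m n = g * h - g"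
    unfolding f_map_def using c by (simp add: mult_minus_distrib_mat[of _ n n _ n])
  then have e: "(g * h) $$ p = (g * f_map n h * 1\<^sub>m n) $$ p + g $$ p" if "p \<in> arc_positions n" for p
    using that c by (cases p) (simp del: index_mult_mat(1) add: index_mult_mat(2,3))
  show "g * h \<in> kernel_subgroup n \<eta>"
    using gh e k(1) g strictly_inside_subset[of n \<eta>] by (auto simp: kernel_subgroup_def simp del: index_mult_mat)
  have "lin n (coefs \<eta>) (g * h) = lin n (coefs \<eta>) (g * f_map n h * 1\<^sub>m n) + lin n (coefs \<eta>) g"
    unfolding lin_def by (simp add: e distrib_left sum.distrib del: index_mult_mat)
  then show "lin n (coefs \<eta>) (g * h) = lin n (coefs \<eta>) g + lin n (coefs \<eta>) h"
    using k(2) lin_f_map[OF h', of "coefs \<eta>"] by (simp add: add.commute)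
qed

lemma one_kernel_subgroup: "1\<^sub>m n \<in> kernel_subgroup n \<eta>"
  using one_UT by (auto simp: kernel_subgroup_def strictly_inside_def)

lemma lin_one: "lin n y (1\<^sub>m n) = 0"
  unfolding lin_def by (intro sum.neutral) auto

lemma normal_kernel_subgroup:
  fixes \<eta> :: "'a::{field,finite} arc set"
  assumes fq: "fq_set_partition n \<eta>"
  shows "normal (kernel_subgroup n \<eta>) (UT n)"
proof -
  let ?U = "UT n :: 'a mat monoid"
  interpret group ?U by (rule group_UT)
  have "subgroup (kernel_subgroup n \<eta>) ?U"
  proof (rule subgroupI)
    show "kernel_subgroup n \<eta> \<subseteq> carrier ?U" by (auto dest: kernel_subgroup_UT)
    show "kernel_subgroup n \<eta> \<noteq> {}" using one_kernel_subgroup by blast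
    show "g \<otimes>\<^bsub>?U\<^esub> h \<in> kernel_subgroup n \<eta>" if "g \<in> kernel_subgroup n \<eta>" "h \<in> kernel_subgroup n \<eta>" for g h
      using kernel_mult(1)[OF fq that] by simp
    \<comment> \<open>In a finite group the inverse is a power, so closure under products is
      enough.\<close>
    show "inv\<^bsub>?U\<^esub> g \<in> kernel_subgroup n \<eta>" if g: "g \<in> kernel_subgroup n \<eta>" for g
    proof -
      note g' = kernel_subgroup_UT[OF g]
      have pow: "g [^]\<^bsub>?U\<^esub> (k::nat) \<in> kernel_subgroup n \<eta>" for k
        by (induction k) (use g kernel_mult(1)[OF fq] one_kernel_subgroup in auto)
      have ord: "Coset.order ?U > 0" using finite_UT order_gt_0_iff_finite by blast
      then have "g [^]\<^bsub>?U\<^esub> (Coset.order ?U - 1) \<otimes>\<^bsub>?U\<^esub> g = \<one>\<^bsub>?U\<^esub>"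
        using pow_order_eq_1[OF g'] nat_pow_Suc[of g "Coset.order ?U - 1"] by simp
      then have "inv\<^bsub>?U\<^esub> g = g [^]\<^bsub>?U\<^esub> (Coset.order ?U - 1)"
        using inv_equality[OF _ g'] g' by (metis nat_pow_closed)
      then show ?thesis using pow by simp
    qed
  qed
  moreover have "g \<otimes>\<^bsub>?U\<^esub> h \<otimes>\<^bsub>?U\<^esub> inv\<^bsub>?U\<^esub> g \<in> kernel_subgroup n \<eta>"
    if "g \<in> carrier ?U" "h \<in> kernel_subgroup n \<eta>" for g h
    using kernel_conj(1)[OF fq that(2,1) UT_inv(1)[OF that(1)] UT_inv(3)[OF that(1)]] by simp
  ultimately show ?thesis unfolding normal_inv_iff by blast
qed

text \<open>Every position strictly inside is one entry forced to 0 in the subgroup and one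
  coefficient left free in the support; either side contributes a factor \<open>q\<close>. This
  identifies the constant in \<open>chi_block_eq\<close> with the index of the subgroup.\<close>

lemma card_rcosets_kernel_subgroup:
  fixes \<eta> :: "'a::{field,finite} arc set"
  assumes fq: "fq_set_partition n \<eta>"
  shows "card (rcosets\<^bsub>UT n\<^esub> kernel_subgroup n \<eta>) = card (chi_supp n \<eta>)"
proof -
  let ?U = "UT n :: 'a mat monoid" and ?I = "strictly_inside n \<eta>" and ?q = "card (UNIV :: 'a set)"
  interpret group ?U by (rule group_UT)
  interpret normal "kernel_subgroup n \<eta>" ?U by (rule normal_kernel_subgroup[OF fq])
  have "card (rcosets\<^bsub>?U\<^esub> kernel_subgroup n \<eta>) * card (kernel_subgroup n \<eta>) = Coset.order ?U"
    using lagrange[OF subgroup_axioms] .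
  moreover have "card (kernel_subgroup n \<eta>) = ?q ^ card (arc_positions n - ?I)"
    unfolding kernel_subgroup_def by (rule card_UT_fixed[OF strictly_inside_subset])
  moreover have "Coset.order ?U = ?q ^ card (arc_positions n)"
    using card_UT_fixed[of "{}" n, where 'a = 'a] by (simp add: Coset.order_def)
  moreover have "card (chi_supp n \<eta>) = ?q ^ card ?I"
  proof -
    have "arc_positions n - (arc_positions n - ?I) = ?I" using strictly_inside_subset by blast
    then show ?thesis unfolding chi_supp_def using card_strict_upper_fixed[of "arc_positions n - ?I" n "coefs \<eta>"] by simp
  qed
  moreover have "card (arc_positions n) = card ?I + card (arc_positions n - ?I)"
    using card_Un_disjoint[of ?I "arc_positions n - ?I"] strictly_inside_subset[of n \<eta>] finite_arc_positions[of n]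
    by (metis Diff_disjoint Un_Diff_cancel finite_Diff finite_subset sup.absorb2)
  ultimately show ?thesis by (simp add: power_add)
qed

section \<open>The superclasses\<close>

definition K_supp :: "nat \<Rightarrow> 'a::field arc set \<Rightarrow> 'a mat set" where
  "K_supp n \<eta> = {h \<in> carrier (UT n). (\<forall>i j a. (i, j, a) \<in> \<eta> \<longrightarrow> h $$ (i, j) = a) \<and>
     (\<forall>k l. k < l \<longrightarrow> l < n \<longrightarrow> h $$ (k, l) \<noteq> 0 \<longrightarrow> (\<exists>i j a. (i, j, a) \<in> \<eta> \<and> k \<le> i \<and> j \<le> l))}"

lemma K_suppD:
  assumes "h \<in> K_supp n \<eta>"
  shows "h \<in> carrier (UT n)" "(i, j, a) \<in> \<eta> \<Longrightarrow> h $$ (i, j) = a"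
    "k < l \<Longrightarrow> l < n \<Longrightarrow> h $$ (k, l) \<noteq> 0 \<Longrightarrow> \<exists>i j a. (i, j, a) \<in> \<eta> \<and> k \<le> i \<and> j \<le> l"
  using assms unfolding K_supp_def by blast+

text \<open>An entry of \<open>u * x * v\<close> collects the arcs contained in its position, and
  each of these contains an innermost arc. At an innermost arc nothing else is collected, so the
  label stays.\<close>

lemma K_fine_subset_K_supp:
  fixes \<nu> :: "'a::{field,finite} arc set"
  assumes fq: "fq_set_partition n \<nu>"
  shows "K_fine n \<nu> \<subseteq> K_supp n (sml \<nu>)"
proof
  fix h assume "h \<in> K_fine n \<nu>"
  then have h: "h \<in> carrier (UT n)" and o: "f_map n h \<in> two_sided_orbit n (x_elt n \<nu>)" by (auto simp: K_fine_def)
  obtain u v where uv: "u \<in> carrier (UT n)" "v \<in> carrier (UT n)" "f_map n h = u * x_elt n \<nu> * v"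
    using o unfolding two_sided_orbit_def by blast
  note x = x_elt_ut[OF fq]
  have hx: "h $$ (k, l) = (u * x_elt n \<nu> * v) $$ (k, l)" if "k < l" "l < n" for k l
    using f_map_index[OF h that] uv(3) by simp
  have arc: "\<exists>a. (i, j, a) \<in> \<nu>" if "i < j" "j < n" "x_elt n \<nu> $$ (i, j) \<noteq> 0" for i j
    using that by (intro coefs_nonzero) (simp add: x_elt_coefs)
  have "h $$ (i, j) = a" if a: "(i, j, a) \<in> sml \<nu>" for i j a
  proof -
    have a': "(i, j, a) \<in> \<nu>" using a sml_subset by blast
    note ij = fq_arcD[OF fq a']
    have "(u * x_elt n \<nu> * v) $$ (i, j) = x_elt n \<nu> $$ (i, j)"
    proof (rule sandwich_eq[OF uv(1) x uv(2)])
      fix r c assume rc: "i \<le> r" "r < c" "c \<le> j" "(r, c) \<noteq> (i, j)"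
      show "x_elt n \<nu> $$ (r, c) = 0"
      proof (rule ccontr)
        assume "x_elt n \<nu> $$ (r, c) \<noteq> 0"
        then obtain b where "(r, c, b) \<in> \<nu>" using arc[of r c] rc ij by auto
        then show False using sml_inner[OF fq a] rc by blast
      qed
    qed (use ij in auto)
    then show ?thesis using hx ij coefs_arc[OF fq a'] by (simp add: x_elt_coefs del: index_mult_mat)
  qed
  moreover have "\<exists>i j a. (i, j, a) \<in> sml \<nu> \<and> k \<le> i \<and> j \<le> l" if kl: "k < l" "l < n" "h $$ (k, l) \<noteq> 0" for k l
  proof -
    obtain i j where ij: "k \<le> i" "i < j" "j \<le> l" "x_elt n \<nu> $$ (i, j) \<noteq> 0"
      by (rule sandwich_nonzero[OF uv(1) x uv(2), of k l]) (use kl hx in auto)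
    then obtain a where "(i, j, a) \<in> \<nu>" using arc[of i j] kl by auto
    from sml_refine[OF fq this] obtain r c b where "(r, c, b) \<in> sml \<nu>" "i \<le> r" "c \<le> j" by blast
    then show ?thesis using ij by (intro exI[of _ r] exI[of _ c] exI[of _ b]) auto
  qed
  ultimately show "h \<in> K_supp n (sml \<nu>)" using h unfolding K_supp_def by blast
qed

lemma K_block_subset_K_supp: "K_block n (\<eta> :: 'a::{field,finite} arc set) \<subseteq> K_supp n \<eta>"
  unfolding K_block_def using K_fine_subset_K_supp by blast

text \<open>The argument of \<open>chi_supp_disjoint\<close> with containment reversed.\<close>

lemma K_supp_disjoint:
  fixes \<eta> \<eta>' :: "'a::{field,finite} arc set"
  assumes fq: "fq_set_partition n \<eta>" "fq_set_partition n \<eta>'" and nn: "nonnesting \<eta>" "nonnesting \<eta>'"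
    and h: "h \<in> K_supp n \<eta>" "h \<in> K_supp n \<eta>'"
  shows "\<eta> = \<eta>'"
proof -
  have sub: "\<eta> \<subseteq> \<eta>'" if fq: "fq_set_partition n \<eta>" "fq_set_partition n \<eta>'" and nn: "nonnesting \<eta>" "nonnesting \<eta>'"
    and h: "h \<in> K_supp n \<eta>" "h \<in> K_supp n \<eta>'" for \<eta> \<eta>' :: "'a arc set"
  proof
    fix p assume "p \<in> \<eta>"
    moreover obtain r c a where p: "p = (r, c, a)" by (cases p)
    ultimately have a: "(r, c, a) \<in> \<eta>" by simp
    note ra = fq_arcD[OF fq(1) a]
    have ha: "h $$ (r, c) = a" by (rule K_suppD(2)[OF h(1) a])
    then obtain i j b where b: "(i, j, b) \<in> \<eta>'" "r \<le> i" "j \<le> c"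
      using K_suppD(3)[OF h(2) ra(1,2)] ra(3) by blast
    note ib = fq_arcD[OF fq(2) b(1)]
    have hb: "h $$ (i, j) = b" by (rule K_suppD(2)[OF h(2) b(1)])
    then obtain k l d where d: "(k, l, d) \<in> \<eta>" "i \<le> k" "l \<le> j"
      using K_suppD(3)[OF h(1) ib(1,2)] ib(3) by blast
    have "r = k" "c = l" using fq_nested_eq(1,2)[OF fq(1) nn(1) a d(1)] d b by auto
    then have "i = r" "j = c" using d b by auto
    then show "p \<in> \<eta>'" using b ha hb p by simp
  qed
  show ?thesis using sub[OF fq nn h] sub[OF fq(2,1) nn(2,1) h(2,1)] by blast
qed

lemma K_block_cover:
  fixes h :: "'a::{field,finite} mat"
  assumes h: "h \<in> carrier (UT n)"
  obtains \<eta> where "fq_set_partition n \<eta>" "nonnesting \<eta>" "h \<in> K_block n \<eta>"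
proof -
  obtain \<nu> where nu: "fq_set_partition n \<nu>" "f_map n h \<in> two_sided_orbit n (x_elt n \<nu>)"
    by (rule two_sided_orbit_x_elt_exists[OF f_map_ut[OF h]])
  then have "h \<in> K_block n (sml \<nu>)" using h by (auto simp: K_block_def K_fine_def)
  then show thesis using that[OF fq_sml[OF nu(1)] nonnesting_sml] by blast
qed

text \<open>Nonnesting makes \<open>\<eta>\<close> itself one of the partitions with
  \<open>sml \<nu> = \<eta>\<close>, so the identity plus \<open>x_elt n \<eta>\<close> is a
  member.\<close>

lemma K_block_nonempty:
  fixes \<eta> :: "'a::{field,finite} arc set"
  assumes fq: "fq_set_partition n \<eta>" and nn: "nonnesting \<eta>"
  shows "K_block n \<eta> \<noteq> {}"
proof -
  note x = x_elt_ut[OF fq] 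
  note xc = ut_carrier_mat[OF x]
  have "1\<^sub>m n + x_elt n \<eta> \<in> carrier (UT n)" using x by (auto simp: UT_def)
  moreover have "f_map n (1\<^sub>m n + x_elt n \<eta>) = x_elt n \<eta>"
    unfolding f_map_def by (rule eq_matI) (use xc in auto)
  ultimately have "1\<^sub>m n + x_elt n \<eta> \<in> K_fine n \<eta>"
    using two_sided_orbit_refl[OF xc] by (simp add: K_fine_def)
  then show ?thesis using fq sml_nonnesting[OF nn] by (auto simp: K_block_def)
qed

lemma K_block_UT: "K_block n \<eta> \<subseteq> carrier (UT n)"
  by (auto simp: K_block_def K_fine_def)

lemma K_block_conj:
  fixes \<eta> :: "'a::{field,finite} arc set"
  assumes h: "h \<in> K_block n \<eta>" and g: "g \<in> carrier (UT n)"
  shows "g * h * inv\<^bsub>UT n\<^esub> g \<in> K_block n \<eta>"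
proof -
  obtain \<nu> where nu: "fq_set_partition n \<nu>" "sml \<nu> = \<eta>" "h \<in> K_fine n \<nu>" using h by (auto simp: K_block_def)
  then have h': "h \<in> carrier (UT n)" "f_map n h \<in> two_sided_orbit n (x_elt n \<nu>)" by (auto simp: K_fine_def)
  note i = UT_inv[OF g]
  note c = UT_carrier_mat[OF g] UT_carrier_mat[OF i(1)] UT_carrier_mat[OF h'(1)]
  have "g * f_map n h * inv\<^bsub>UT n\<^esub> g = g * h * inv\<^bsub>UT n\<^esub> g - g * 1\<^sub>m n * inv\<^bsub>UT n\<^esub> g"
    unfolding f_map_def using c by (simp add: mult_minus_distrib_mat[of _ n n _ n] minus_mult_distrib_mat[of _ n n _ _ n])
  then have "f_map n (g * h * inv\<^bsub>UT n\<^esub> g) = g * f_map n h * inv\<^bsub>UT n\<^esub> g" using c i(3) by (simp add: f_map_def)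
  moreover have "g * f_map n h * inv\<^bsub>UT n\<^esub> g \<in> two_sided_orbit n (x_elt n \<nu>)"
    by (rule two_sided_orbit_mult[OF ut_carrier_mat[OF x_elt_ut[OF nu(1)]] h'(2) g i(1)])
  moreover have "g * h * inv\<^bsub>UT n\<^esub> g \<in> carrier (UT n)" by (intro UT_mult_closed g h'(1) i(1))
  ultimately have "g * h * inv\<^bsub>UT n\<^esub> g \<in> K_fine n \<nu>" by (simp add: K_fine_def)
  then show ?thesis using nu by (auto simp: K_block_def)
qed

lemma K_block_conjugacy_classes:
  fixes \<eta> :: "'a::{field,finite} arc set"
  shows "K_block n \<eta> = (\<Union>x\<in>K_block n \<eta>. conjugacy_class (UT n) x)"
proof (intro equalityI subsetI)
  fix h assume h: "h \<in> K_block n \<eta>"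
  interpret group "UT n :: 'a mat monoid" by (rule group_UT)
  have "h = \<one>\<^bsub>UT n\<^esub> \<otimes>\<^bsub>UT n\<^esub> h \<otimes>\<^bsub>UT n\<^esub> inv\<^bsub>UT n\<^esub> \<one>\<^bsub>UT n\<^esub>"
    using subsetD[OF K_block_UT h] by (simp del: UT_mult_simp UT_one_simp)
  then have "h \<in> conjugacy_class (UT n) h" unfolding conjugacy_class_def by blast
  then show "h \<in> (\<Union>x\<in>K_block n \<eta>. conjugacy_class (UT n) x)" using h by blast
next
  fix h assume "h \<in> (\<Union>x\<in>K_block n \<eta>. conjugacy_class (UT n) x)"
  then show "h \<in> K_block n \<eta>" using K_block_conj by (auto simp: conjugacy_class_def)
qed

text \<open>A nonzero entry of \<open>h\<close> strictly inside \<open>\<eta>\<close> would contain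
  an arc of \<open>\<nu>\<close>. That arc is strictly inside as well, and there \<open>g\<close>
  has a nonzero label.\<close>

lemma kernel_subgroup_K_supp:
  fixes \<eta> \<nu> :: "'a::{field,finite} arc set"
  assumes g: "g \<in> K_supp n \<nu>" and h: "h \<in> K_supp n \<nu>"
    and gk: "g \<in> kernel_subgroup n \<eta>" and \<nu>: "fq_set_partition n \<nu>"
  shows "h \<in> kernel_subgroup n \<eta>"
proof -
  have "h $$ (k, l) = 0" if kl: "(k, l) \<in> strictly_inside n \<eta>" for k l
  proof (rule ccontr)
    assume "h $$ (k, l) \<noteq> 0"
    then obtain i j a where a: "(i, j, a) \<in> \<nu>" "k \<le> i" "j \<le> l"
      using K_suppD(3)[OF h, of k l] kl by (auto simp: strictly_inside_iff)
    note ij = fq_arcD[OF \<nu> a(1)]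
    have "(i, j) \<in> strictly_inside n \<eta>" by (rule strictly_inside_closed[OF kl a(2) ij(1) a(3)])
    then have "g $$ (i, j) = 0" using gk by (simp add: kernel_subgroup_def)
    then show False using K_suppD(2)[OF g a(1)] ij by simp
  qed
  then show ?thesis using K_suppD(1)[OF h] by (auto simp: kernel_subgroup_def)
qed

text \<open>If an arc of \<open>\<eta>\<close> contains an arc of \<open>\<nu>\<close>, the two have
  the same position, for otherwise \<open>g\<close> would have a nonzero label strictly inside; so
  both entries are that label. If it contains none, both entries are 0.\<close>

lemma lin_coefs_K_supp:
  fixes \<eta> \<nu> :: "'a::{field,finite} arc set"
  assumes g: "g \<in> K_supp n \<nu>" and h: "h \<in> K_supp n \<nu>"
    and gk: "g \<in> kernel_subgroup n \<eta>" and \<nu>: "fq_set_partition n \<nu>" and \<eta>: "fq_set_partition n \<eta>"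
  shows "lin n (coefs \<eta>) g = lin n (coefs \<eta>) h"
proof -
  have on_arc: "g $$ (i, j) = h $$ (i, j)" if a: "(i, j, a) \<in> \<eta>" for i j a
  proof (cases "\<exists>k l b. (k, l, b) \<in> \<nu> \<and> i \<le> k \<and> l \<le> j")
    case True
    then obtain k l b where b: "(k, l, b) \<in> \<nu>" "i \<le> k" "l \<le> j" by blast
    note kl = fq_arcD[OF \<nu> b(1)]
    have gb: "g $$ (k, l) = b" "h $$ (k, l) = b" using K_suppD(2)[OF g b(1)] K_suppD(2)[OF h b(1)] by auto
    have "(k, l) = (i, j)"
    proof (rule ccontr)
      assume "(k, l) \<noteq> (i, j)"
      then have "(k, l) \<in> strictly_inside n \<eta>"
        using arc_strictly_inside[OF a b(2) kl(1) b(3)] fq_arcD(2)[OF \<eta> a] by auto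
      then show False using gk gb kl by (simp add: kernel_subgroup_def)
    qed
    then show ?thesis using gb by simp
  next
    case False
    note ij = fq_arcD[OF \<eta> a]
    have "g $$ (i, j) = 0" using False K_suppD(3)[OF g ij(1,2)] by blast
    moreover have "h $$ (i, j) = 0" using False K_suppD(3)[OF h ij(1,2)] by blast
    ultimately show ?thesis by simp
  qed
  show ?thesis unfolding lin_def
  proof (intro sum.cong refl)
    fix p :: "nat \<times> nat"
    obtain i j where p: "p = (i, j)" by (cases p)
    show "coefs \<eta> p * g $$ p = coefs \<eta> p * h $$ p"
    proof (cases "coefs \<eta> p = 0")
      case False
      then obtain a where "(i, j, a) \<in> \<eta>" using coefs_nonzero p by blast
      then show ?thesis using on_arc p by simp
    qed simp
  qed
qed

lemma chi_block_constant:
  fixes \<eta> \<nu> :: "'a::{field,finite} arc set"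
  assumes \<theta>: "nontrivial_additive_character \<theta>" and \<eta>: "fq_set_partition n \<eta>" "nonnesting \<eta>"
    and \<nu>: "fq_set_partition n \<nu>" and g: "g \<in> K_block n \<nu>" and h: "h \<in> K_block n \<nu>"
  shows "chi_block n \<theta> \<eta> g = chi_block n \<theta> \<eta> h"
proof -
  have gs: "g \<in> K_supp n \<nu>" and hs: "h \<in> K_supp n \<nu>" using g h K_block_subset_K_supp by blast+
  note eq = chi_block_eq[OF \<theta> \<eta>]
  show ?thesis
  proof (cases "g \<in> kernel_subgroup n \<eta>")
    case True
    then show ?thesis
      using kernel_subgroup_K_supp[OF gs hs True \<nu>] lin_coefs_K_supp[OF gs hs True \<nu> \<eta>(1)]
      by (simp add: eq[OF K_suppD(1)[OF gs]] eq[OF K_suppD(1)[OF hs]] kernel_char_def)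
  next
    case False
    then have "h \<notin> kernel_subgroup n \<eta>" using kernel_subgroup_K_supp[OF hs gs _ \<nu>] by blast
    then show ?thesis using False by (simp add: eq[OF K_suppD(1)[OF gs]] eq[OF K_suppD(1)[OF hs]])
  qed
qed

section \<open>The supercharacter theory\<close>

lemma finite_strict_upper: "finite (strict_upper n :: (nat \<times> nat \<Rightarrow> 'a::{zero,finite}) set)"
proof (rule card_ge_0_finite)
  show "0 < card (strict_upper n :: (nat \<times> nat \<Rightarrow> 'a) set)"
    using card_strict_upper_fixed[of "{}" n, where 'a = 'a] by (simp add: finite_UNIV_card_ge_0)
qed

lemma card_chi_supp_pos:
  fixes \<eta> :: "'a::{field,finite} arc set"
  assumes "fq_set_partition n \<eta>" shows "card (chi_supp n \<eta>) > 0"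
proof -
  have "finite (chi_supp n \<eta>)" by (rule finite_subset[OF _ finite_strict_upper[of n]]) (auto simp: chi_supp_def)
  then show ?thesis using coefs_chi_supp[OF assms] card_gt_0_iff by blast
qed

lemma chi_block_character:
  fixes \<eta> :: "'a::{field,finite} arc set"
  assumes \<theta>: "nontrivial_additive_character \<theta>" and \<eta>: "fq_set_partition n \<eta>" "nonnesting \<eta>"
  shows "chi_block n \<theta> \<eta> \<in> characters (UT n)"
proof -
  let ?U = "UT n :: 'a mat monoid" and ?N = "kernel_subgroup n \<eta>"
  have "(\<lambda>g\<in>carrier ?U. if g \<in> ?N then of_nat (card (rcosets\<^bsub>?U\<^esub> ?N)) * kernel_char n \<theta> \<eta> g else 0) \<in> characters ?U"
  proof (rule induced_character[OF group_UT finite_UT normal_kernel_subgroup[OF \<eta>(1)]])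
    show "kernel_char n \<theta> \<eta> \<one>\<^bsub>?U\<^esub> = 1"
      by (simp add: kernel_char_def lin_one additive_character_zero[OF \<theta>])
    show "kernel_char n \<theta> \<eta> (x \<otimes>\<^bsub>?U\<^esub> y) = kernel_char n \<theta> \<eta> x * kernel_char n \<theta> \<eta> y" if "x \<in> ?N" "y \<in> ?N" for x y
      using kernel_mult(2)[OF \<eta>(1) that] \<theta> by (simp add: kernel_char_def nontrivial_additive_character_def)
    show "kernel_char n \<theta> \<eta> (inv\<^bsub>?U\<^esub> g \<otimes>\<^bsub>?U\<^esub> x \<otimes>\<^bsub>?U\<^esub> g) = kernel_char n \<theta> \<eta> x" if "g \<in> carrier ?U" "x \<in> ?N" for g x
      using kernel_conj(2)[OF \<eta>(1) that(2) UT_inv(1)[OF that(1)] that(1) UT_inv(2)[OF that(1)]]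
      by (simp add: kernel_char_def)
  qed
  also have "(\<lambda>g\<in>carrier ?U. if g \<in> ?N then of_nat (card (rcosets\<^bsub>?U\<^esub> ?N)) * kernel_char n \<theta> \<eta> g else 0) = chi_block n \<theta> \<eta>"
  proof (rule extensionalityI[of _ "carrier ?U"])
    fix g assume "g \<in> carrier ?U"
    then show "(\<lambda>g\<in>carrier ?U. if g \<in> ?N then of_nat (card (rcosets\<^bsub>?U\<^esub> ?N)) * kernel_char n \<theta> \<eta> g else 0) g = chi_block n \<theta> \<eta> g"
      by (simp add: chi_block_eq[OF \<theta> \<eta>] card_rcosets_kernel_subgroup[OF \<eta>(1)])
  qed (simp_all add: chi_block_def)
  finally show ?thesis .
qed

lemma chi_block_one:
  fixes \<eta> :: "'a::{field,finite} arc set"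
  assumes \<theta>: "nontrivial_additive_character \<theta>" and \<eta>: "fq_set_partition n \<eta>" "nonnesting \<eta>"
  shows "chi_block n \<theta> \<eta> (1\<^sub>m n) = of_nat (card (chi_supp n \<eta>))"
  using chi_block_eq[OF \<theta> \<eta> one_UT] one_kernel_subgroup[of n \<eta>]
  by (simp add: kernel_char_def lin_one additive_character_zero[OF \<theta>])

section \<open>Recovering a nonnesting partition from its linear character\<close>

lemma lin_transvection:
  assumes "i < j" "j < n" shows "lin n y (transvection n i j t) = y (i, j) * t"
proof -
  have "lin n y (transvection n i j t) = (\<Sum>p\<in>arc_positions n. if p = (i, j) then y (i, j) * t else 0)"
    unfolding lin_def by (intro sum.cong refl) (auto simp: transvection_index split: if_splits)
  then show ?thesis using assms by simp
qed

lemma transvection_kernel_subgroup: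
  assumes "i < j" "(i, j) \<notin> strictly_inside n \<eta>"
  shows "transvection n i j t \<in> kernel_subgroup n \<eta>"
proof -
  have "transvection n i j t $$ p = 0" if "p \<in> strictly_inside n \<eta>" for p
  proof -
    obtain k l where p: "p = (k, l)" by (cases p)
    then have "k < l" "l < n" "p \<noteq> (i, j)" using that assms(2) by (auto simp: strictly_inside_iff)
    then show ?thesis by (auto simp: p transvection_index)
  qed
  then show ?thesis using transvection_UT[OF assms(1)] by (simp add: kernel_subgroup_def)
qed

lemma kernel_char_separates:
  fixes \<eta> \<eta>' :: "'a::{field,finite} arc set"
  assumes \<theta>: "nontrivial_additive_character \<theta>"
    and fq: "fq_set_partition n \<eta>" "fq_set_partition n \<eta>'" and nn: "nonnesting \<eta>" "nonnesting \<eta>'"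
    and eq: "\<And>h. h \<in> kernel_subgroup n \<eta> \<Longrightarrow> h \<in> kernel_subgroup n \<eta>' \<Longrightarrow> kernel_char n \<theta> \<eta> h = kernel_char n \<theta> \<eta>' h"
  shows "\<eta> = \<eta>'"
proof -
  \<comment> \<open>The transvections at this position lie in both subgroups, where the two
    characters may be compared.\<close>
  have outer: "(i, j, a) \<in> \<eta>'" if fq: "fq_set_partition n \<eta>" "fq_set_partition n \<eta>'" and nn: "nonnesting \<eta>" "nonnesting \<eta>'"
    and eq: "\<And>h. h \<in> kernel_subgroup n \<eta> \<Longrightarrow> h \<in> kernel_subgroup n \<eta>' \<Longrightarrow> kernel_char n \<theta> \<eta> h = kernel_char n \<theta> \<eta>' h"
    and a: "(i, j, a) \<in> \<eta>" and out: "(i, j) \<notin> strictly_inside n \<eta>'" for \<eta> \<eta>' :: "'a arc set" and i j a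
  proof -
    note ij = fq_arcD[OF fq(1) a]
    have "\<theta> (a * t) = \<theta> (coefs \<eta>' (i, j) * t)" for t
      using eq[OF transvection_kernel_subgroup transvection_kernel_subgroup, of i j t] ij out
        arc_not_strictly_inside[OF fq(1) nn(1) a] coefs_arc[OF fq(1) a]
      by (simp add: kernel_char_def lin_transvection)
    moreover have "\<theta> (x + y) = \<theta> x * \<theta> y" "\<theta> x \<noteq> 0" for x y
      using \<theta> by (auto simp: nontrivial_additive_character_def)
    ultimately have triv: "\<theta> ((a - coefs \<eta>' (i, j)) * t) = 1" for t
      by (metis diff_add_cancel left_diff_distrib mult_cancel_right1)
    \<comment> \<open>A nonzero difference times \<open>t\<close> runs through the whole field,
      which would make \<open>\<theta>\<close> trivial.\<close>
    have "a = coefs \<eta>' (i, j)"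
    proof (rule ccontr)
      assume "a \<noteq> coefs \<eta>' (i, j)"
      then have "\<theta> s = 1" for s using triv[of "s / (a - coefs \<eta>' (i, j))"] by simp
      then show False using \<theta> by (auto simp: nontrivial_additive_character_def)
    qed
    then obtain b where "(i, j, b) \<in> \<eta>'" using ij coefs_nonzero by metis
    then show ?thesis using coefs_arc[OF fq(2)] \<open>a = coefs \<eta>' (i, j)\<close> by simp
  qed
  have sub: "\<eta> \<subseteq> \<eta>'" if fq: "fq_set_partition n \<eta>" "fq_set_partition n \<eta>'" and nn: "nonnesting \<eta>" "nonnesting \<eta>'"
    and eq: "\<And>h. h \<in> kernel_subgroup n \<eta> \<Longrightarrow> h \<in> kernel_subgroup n \<eta>' \<Longrightarrow> kernel_char n \<theta> \<eta> h = kernel_char n \<theta> \<eta>' h"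
    for \<eta> \<eta>' :: "'a arc set"
  proof
    fix p assume p: "p \<in> \<eta>"
    obtain i j a where ij: "p = (i, j, a)" by (cases p)
    have a: "(i, j, a) \<in> \<eta>" using p ij by simp
    \<comment> \<open>An arc of \<open>\<eta>'\<close> properly containing \<open>(i, j)\<close>
      cannot be strictly inside \<open>\<eta>\<close>, since then \<open>(i, j)\<close> would be
      too. By \<open>outer\<close> with the roles exchanged it belongs to \<open>\<eta>\<close>,
      against the antichain property.\<close>
    have "(i, j) \<notin> strictly_inside n \<eta>'"
    proof
      assume "(i, j) \<in> strictly_inside n \<eta>'"
      then obtain k l b where b: "(k, l, b) \<in> \<eta>'" "k \<le> i" "j \<le> l" "(k, l) \<noteq> (i, j)"
        unfolding strictly_inside_iff by blast
      have "(k, l) \<notin> strictly_inside n \<eta>"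
      proof
        assume "(k, l) \<in> strictly_inside n \<eta>"
        then have "(i, j) \<in> strictly_inside n \<eta>"
          using strictly_inside_closed b(2,3) fq_arcD(1)[OF fq(1) a] by blast
        then show False using arc_not_strictly_inside[OF fq(1) nn(1) a] by blast
      qed
      then have "(k, l, b) \<in> \<eta>" using outer[OF fq(2,1) nn(2,1) _ b(1)] eq by metis
      then have "(i, j) \<in> strictly_inside n \<eta>"
        using arc_strictly_inside[of k l b \<eta> i j n] b fq_arcD[OF fq(1) a] fq_arcD(2)[OF fq(2) b(1)] by auto
      then show False using arc_not_strictly_inside[OF fq(1) nn(1) a] by blast
    qed
    then show "p \<in> \<eta>'" using outer[OF fq nn eq a] ij by blast
  qed
  show ?thesis using sub[OF fq nn eq] sub[OF fq(2,1) nn(2,1)] eq by (metis subset_antisym)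
qed

text \<open>The normalised restriction of \<open>\<psi>\<close> equals either linear character on
  its own subgroup, so the two agree on the intersection.\<close>

lemma constituent_chi_block_unique:
  fixes \<eta> \<eta>' :: "'a::{field,finite} arc set"
  assumes \<theta>: "nontrivial_additive_character \<theta>"
    and fq: "fq_set_partition n \<eta>" "fq_set_partition n \<eta>'" and nn: "nonnesting \<eta>" "nonnesting \<eta>'"
    and c: "constituent (UT n) \<psi> (chi_block n \<theta> \<eta>)" "constituent (UT n) \<psi> (chi_block n \<theta> \<eta>')"
  shows "\<eta> = \<eta>'"
proof (rule kernel_char_separates[OF \<theta> fq nn])
  fix h assume h: "h \<in> kernel_subgroup n \<eta>" "h \<in> kernel_subgroup n \<eta>'"
  note hU = kernel_subgroup_UT[OF h(1)]
  have *: "\<psi> h = \<psi> (1\<^sub>m n) * kernel_char n \<theta> \<eta> h \<and> \<psi> (1\<^sub>m n) \<noteq> 0"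
    if "fq_set_partition n \<eta>" "nonnesting \<eta>" "constituent (UT n) \<psi> (chi_block n \<theta> \<eta>)" "h \<in> kernel_subgroup n \<eta>"
    for \<eta> :: "'a arc set"
    using constituent_eq_mult[OF group_UT finite_UT that(3) hU, of "kernel_char n \<theta> \<eta> h"]
      additive_character_norm[OF \<theta>] chi_block_eq[OF \<theta> that(1,2) hU] chi_block_one[OF \<theta> that(1,2)] that(4)
    by (simp add: kernel_char_def)
  show "kernel_char n \<theta> \<eta> h = kernel_char n \<theta> \<eta>' h"
    using *[OF fq(1) nn(1) c(1) h(1)] *[OF fq(2) nn(2) c(2) h(2)] by simp
qed

section \<open>The regular character and existence of the constituent\<close>

lemma chi_supp_cover:
  "(\<Union>\<eta>\<in>{\<eta> :: 'a::{field,finite} arc set. fq_set_partition n \<eta> \<and> nonnesting \<eta>}. chi_supp n \<eta>) = strict_upper n"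
proof (intro equalityI subsetI)
  fix y :: "nat \<times> nat \<Rightarrow> 'a" assume y: "y \<in> strict_upper n"
  obtain \<nu> where "fq_set_partition n \<nu>" "y \<in> chi_supp n (big \<nu>)" using chi_supp_big_exists[OF y] by metis
  then show "y \<in> (\<Union>\<eta>\<in>{\<eta> :: 'a arc set. fq_set_partition n \<eta> \<and> nonnesting \<eta>}. chi_supp n \<eta>)"
    using fq_big nonnesting_big by blast
qed (auto simp: chi_supp_def)

text \<open>The supports partition all coefficient families, so the total is a sum of
  \<open>\<theta>\<close> over all functionals on \<open>ut n\<close>, which cancels unless every
  entry above the diagonal is 0.\<close>

lemma sum_chi_block:
  fixes h :: "'a::{field,finite} mat"
  assumes \<theta>: "nontrivial_additive_character \<theta>" and h: "h \<in> carrier (UT n)"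
  shows "(\<Sum>\<eta> | fq_set_partition n \<eta> \<and> nonnesting \<eta>. chi_block n \<theta> \<eta> h) =
    (if h = 1\<^sub>m n then of_nat (card (strict_upper n :: (nat \<times> nat \<Rightarrow> 'a) set)) else 0)"
proof -
  let ?I = "{\<eta> :: 'a arc set. fq_set_partition n \<eta> \<and> nonnesting \<eta>}"
  have "(\<Sum>\<eta>\<in>?I. chi_block n \<theta> \<eta> h) = (\<Sum>\<eta>\<in>?I. \<Sum>y\<in>chi_supp n \<eta>. \<theta> (lin n y h))"
    using chi_block_eq_sum[OF _ _ h] by (intro sum.cong refl) auto
  also have "\<dots> = (\<Sum>y\<in>(\<Union>\<eta>\<in>?I. chi_supp n \<eta>). \<theta> (lin n y h))"
  proof (rule sum.UNION_disjoint[symmetric])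
    show "finite ?I" by (rule finite_subset[OF _ finite_fq_set_partitions[of n]]) auto
    show "\<forall>\<eta>\<in>?I. finite (chi_supp n \<eta>)"
      by (intro ballI finite_subset[OF _ finite_strict_upper[of n]]) (auto simp: chi_supp_def)
    show "\<forall>\<eta>\<in>?I. \<forall>\<eta>'\<in>?I. \<eta> \<noteq> \<eta>' \<longrightarrow> chi_supp n \<eta> \<inter> chi_supp n \<eta>' = {}"
      using chi_supp_disjoint[of n] by blast
  qed
  also have "\<dots> = (\<Sum>y\<in>strict_upper n. \<theta> (lin n y h))" unfolding chi_supp_cover ..
  also have "\<dots> = (if h = 1\<^sub>m n then of_nat (card (strict_upper n :: (nat \<times> nat \<Rightarrow> 'a) set)) else 0)"
  proof (cases "h = 1\<^sub>m n")
    case True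
    then show ?thesis by (simp add: lin_one additive_character_zero[OF \<theta>])
  next
    case False
    have "\<exists>p\<in>arc_positions n. h $$ p \<noteq> 0"
    proof (rule ccontr)
      assume z: "\<not> ?thesis"
      have "h = 1\<^sub>m n"
      proof (rule eq_matI)
        fix i j assume ij: "i < dim_row (1\<^sub>m n :: 'a mat)" "j < dim_col (1\<^sub>m n :: 'a mat)"
        then show "h $$ (i, j) = 1\<^sub>m n $$ (i, j)"
          using z UT_diag[OF h] UT_lower[OF h] by (cases i j rule: linorder_cases) auto
      qed (use UT_carrier_mat[OF h] in auto)
      then show False using False by simp
    qed
    then obtain p where p: "p \<in> arc_positions n" "h $$ p \<noteq> 0" by blast
    have "(\<Sum>y\<in>strict_upper n. \<theta> (lin n y h)) = 0"
      by (rule sum_additive_character_zero[OF \<theta> p]) (use p(1) in \<open>auto simp: strict_upper_def\<close>)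
    then show ?thesis using False by simp
  qed
  finally show ?thesis .
qed

lemma constituent_chi_block_exists:
  fixes \<theta> :: "'a::{field,finite} \<Rightarrow> complex"
  assumes \<theta>: "nontrivial_additive_character \<theta>" and \<psi>: "\<psi> \<in> irreducible_characters (UT n)"
  obtains \<eta> where "fq_set_partition n \<eta>" "nonnesting \<eta>" "constituent (UT n) \<psi> (chi_block n \<theta> \<eta>)"
proof -
  let ?U = "UT n :: 'a mat monoid"
  let ?I = "{\<eta> :: 'a arc set. fq_set_partition n \<eta> \<and> nonnesting \<eta>}"
  let ?S = "strict_upper n :: (nat \<times> nat \<Rightarrow> 'a) set"
  interpret group ?U by (rule group_UT)
  obtain d \<rho> where psi: "\<psi> = rep_character ?U d \<rho>" and r: "representation ?U d \<rho>"
    using \<psi> by (auto simp: irreducible_characters_def irreducible_representation_def)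
  have "\<psi> (1\<^sub>m n) = of_nat d" using rep_character_one[OF group_UT r] by (simp add: psi)
  moreover have "d > 0" using r by (simp add: representation_def)
  ultimately have p1: "\<psi> (1\<^sub>m n) \<noteq> 0" by simp
  \<comment> \<open>After the interchange only the identity contributes, with a positive multiple of
    the degree of \<open>\<psi>\<close>. So some inner product is nonzero.\<close>
  have "(\<Sum>\<eta>\<in>?I. \<Sum>g\<in>carrier ?U. chi_block n \<theta> \<eta> g * \<psi> (inv\<^bsub>?U\<^esub> g)) =
    (\<Sum>g\<in>carrier ?U. \<Sum>\<eta>\<in>?I. chi_block n \<theta> \<eta> g * \<psi> (inv\<^bsub>?U\<^esub> g))" by (rule sum.swap)
  also have "\<dots> = (\<Sum>g\<in>carrier ?U. if g = 1\<^sub>m n then of_nat (card ?S) * \<psi> (1\<^sub>m n) else 0)"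
    using sum_chi_block[OF \<theta>] inv_one by (intro sum.cong refl) (auto simp flip: sum_distrib_right)
  also have "\<dots> = of_nat (card ?S) * \<psi> (1\<^sub>m n)" using finite_UT[of n, where 'a = 'a] one_UT[of n, where 'a = 'a] by simp
  also have "\<dots> \<noteq> 0"
  proof -
    have "coefs ({} :: 'a arc set) \<in> ?S" by (rule coefs_strict_upper) (simp add: fq_set_partition_def)
    then have "?S \<noteq> {}" by blast
    then have "card ?S \<noteq> 0" by (simp add: card_eq_0_iff finite_strict_upper)
    then show ?thesis using p1 by simp
  qed
  finally obtain \<eta> where \<eta>: "\<eta> \<in> ?I" "(\<Sum>g\<in>carrier ?U. chi_block n \<theta> \<eta> g * \<psi> (inv\<^bsub>?U\<^esub> g)) \<noteq> 0"
    by (meson sum.neutral)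
  then have "constituent ?U \<psi> (chi_block n \<theta> \<eta>)"
    by (intro constituent_inner_product[OF group_UT finite_UT chi_block_character[OF \<theta>] \<psi>]) auto
  then show thesis using that \<eta>(1) by blast
qed

theorem theorem5p4:
  fixes n :: nat and \<theta> :: "'a::{field,finite} \<Rightarrow> complex"
  assumes "nontrivial_additive_character \<theta>"
  shows "supercharacter_theory (UT n)
    {K_block n \<nu> | \<nu>. fq_set_partition n \<nu> \<and> nonnesting \<nu>}
    {chi_block n \<theta> \<eta> | \<eta>. fq_set_partition n \<eta> \<and> nonnesting \<eta>}"
proof -
  let ?U = "UT n :: 'a mat monoid"
  let ?I = "{\<eta> :: 'a arc set. fq_set_partition n \<eta> \<and> nonnesting \<eta>}"
  have K: "{K_block n \<nu> | \<nu>. fq_set_partition n \<nu> \<and> nonnesting \<nu>} = K_block n ` ?I"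
    and X: "{chi_block n \<theta> \<eta> | \<eta>. fq_set_partition n \<eta> \<and> nonnesting \<eta>} = chi_block n \<theta> ` ?I" by blast+
  have Kdisj: "\<eta> = \<eta>'" if "\<eta> \<in> ?I" "\<eta>' \<in> ?I" "h \<in> K_block n \<eta>" "h \<in> K_block n \<eta>'" for \<eta> \<eta>' h
    using K_supp_disjoint[of n \<eta> \<eta>' h] K_block_subset_K_supp[of n] that by blast
  have part: "partition_on (carrier ?U) (K_block n ` ?I)"
  proof (rule partition_onI)
    show "\<Union> (K_block n ` ?I) = carrier ?U"
    proof (intro equalityI subsetI)
      fix h assume "h \<in> carrier ?U"
      then obtain \<eta> where "fq_set_partition n \<eta>" "nonnesting \<eta>" "h \<in> K_block n \<eta>" by (rule K_block_cover)
      then show "h \<in> \<Union> (K_block n ` ?I)" by blast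
    qed (use K_block_UT in blast)
    show "disjnt p q" if "p \<in> K_block n ` ?I" "q \<in> K_block n ` ?I" "p \<noteq> q" for p q
      using that Kdisj unfolding disjnt_def by blast
    show "{} \<notin> K_block n ` ?I"
      using K_block_nonempty[of n] by fastforce
  qed
  have injK: "inj_on (K_block n) ?I"
  proof (rule inj_onI)
    fix \<eta> \<eta>' assume e: "\<eta> \<in> ?I" "\<eta>' \<in> ?I" "K_block n \<eta> = K_block n \<eta>'"
    obtain h where "h \<in> K_block n \<eta>" using K_block_nonempty[of n \<eta>] e(1) by blast
    then show "\<eta> = \<eta>'" using Kdisj e by blast
  qed
  \<comment> \<open>The value at the identity shows that the two degrees are equal. Cancelling this
    positive number makes the linear characters agree on both subgroups.\<close>
  have injX: "inj_on (chi_block n \<theta>) ?I"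
  proof (rule inj_onI)
    fix \<eta> \<eta>' assume e: "\<eta> \<in> ?I" "\<eta>' \<in> ?I" "chi_block n \<theta> \<eta> = chi_block n \<theta> \<eta>'"
    then have fq: "fq_set_partition n \<eta>" "fq_set_partition n \<eta>'" and nn: "nonnesting \<eta>" "nonnesting \<eta>'" by auto
    show "\<eta> = \<eta>'"
    proof (rule kernel_char_separates[OF assms fq nn])
      fix h assume h: "h \<in> kernel_subgroup n \<eta>" "h \<in> kernel_subgroup n \<eta>'"
      have "card (chi_supp n \<eta>) = card (chi_supp n \<eta>')"
        using fun_cong[OF e(3), of "1\<^sub>m n"] by (simp add: chi_block_one[OF assms] fq nn)
      then show "kernel_char n \<theta> \<eta> h = kernel_char n \<theta> \<eta>' h"
        using fun_cong[OF e(3), of h] h card_chi_supp_pos[OF fq(1)]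
          chi_block_eq[OF assms fq(1) nn(1) kernel_subgroup_UT[OF h(1)]]
          chi_block_eq[OF assms fq(2) nn(2) kernel_subgroup_UT[OF h(1)]] by simp
    qed
  qed
  show ?thesis
    unfolding supercharacter_theory_def K X
  proof (intro conjI ballI)
    show "group ?U" by (rule group_UT)
    show "finite (carrier ?U)" by (rule finite_UT)
    show "partition_on (carrier ?U) (K_block n ` ?I)" by (rule part)
    show "\<exists>S\<subseteq>carrier ?U. k = (\<Union>x\<in>S. conjugacy_class ?U x)" if k': "k \<in> K_block n ` ?I" for k
    proof -
      obtain \<eta> :: "'a arc set" where k: "k = K_block n \<eta>" using k' by blast
      show ?thesis unfolding k using K_block_UT K_block_conjugacy_classes by (intro exI conjI)
    qed
    show "chi_block n \<theta> ` ?I \<subseteq> characters ?U" using chi_block_character[OF assms] by blast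
    show "card (chi_block n \<theta> ` ?I) = card (K_block n ` ?I)" by (simp add: card_image injK injX)
    show "\<chi> g = \<chi> h" if \<chi>: "\<chi> \<in> chi_block n \<theta> ` ?I" and k: "k \<in> K_block n ` ?I" and gh: "g \<in> k" "h \<in> k" for \<chi> k g h
    proof -
      obtain \<eta> where \<eta>: "fq_set_partition n \<eta>" "nonnesting \<eta>" "\<chi> = chi_block n \<theta> \<eta>" using \<chi> by blast
      obtain \<nu> where \<nu>: "fq_set_partition n \<nu>" "k = K_block n \<nu>" using k by blast
      show ?thesis unfolding \<eta>(3) by (rule chi_block_constant[OF assms \<eta>(1,2) \<nu>(1) gh[unfolded \<nu>(2)]])
    qed
    show "\<exists>!\<chi>. \<chi> \<in> chi_block n \<theta> ` ?I \<and> constituent ?U \<psi> \<chi>" if \<psi>: "\<psi> \<in> irreducible_characters ?U" for \<psi>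
    proof -
      obtain \<eta> where \<eta>: "fq_set_partition n \<eta>" "nonnesting \<eta>" "constituent ?U \<psi> (chi_block n \<theta> \<eta>)"
        by (rule constituent_chi_block_exists[OF assms \<psi>])
      show ?thesis
      proof (rule ex1I[of _ "chi_block n \<theta> \<eta>"])
        show "chi_block n \<theta> \<eta> \<in> chi_block n \<theta> ` ?I \<and> constituent ?U \<psi> (chi_block n \<theta> \<eta>)" using \<eta> by blast
        fix \<chi> assume "\<chi> \<in> chi_block n \<theta> ` ?I \<and> constituent ?U \<psi> \<chi>"
        then obtain \<eta>' where e: "fq_set_partition n \<eta>'" "nonnesting \<eta>'" "\<chi> = chi_block n \<theta> \<eta>'"
          "constituent ?U \<psi> (chi_block n \<theta> \<eta>')" by blast
        have "\<eta>' = \<eta>" by (rule constituent_chi_block_unique[OF assms e(1) \<eta>(1) e(2) \<eta>(2) e(4) \<eta>(3)])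
        then show "\<chi> = chi_block n \<theta> \<eta>" using e(3) by simp
      qed
    qed
  qed
qed

end
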